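(* Every nice graph is algebraic $(1,6)$-choosable.
   Context: All graphs are finite and simple, with vertex set $V=\{1,\dots,n\}$; an edge is a $2$-element subset $\{i,j\}$ of $V$. For $i\in V$, $E(i)$ is the set of edges incident to $i$. An edge $\{i,j\}$ is isolated if both $i$ and $j$ have degree $1$; a graph is nice if it has no isolated edges. For a graph $G=(V,E)$ define the polynomial in variables $x_e$ ($e\in E$) $$P_G=\prod_{\{i,j\}\in E,\ i<j}\Big(\sum_{e\in E(i)}x_e-\sum_{e\in E(j)}x_e\Big)$$ (the empty product is $1$). For $K:E\to\mathbb{N}$ write $x^K=\prod_{e\in E}x_e^{K(e)}$, and let $\mathrm{mon}(P)$ be the set of monomials $x^K$ with nonzero coefficient in $P$. For a positive integer $b$, $G$ is algebraic $(1,b)$-choosable if there is $K:E\to\mathbb{N}$ with $\sum_{e\in E}K(e)=|E|$ and $K(e)\le b-1$ for all $e\in E$ such that $x^K\in\mathrm{mon}(P_G)$. *)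

theory Defs
  imports Main "HOL-Library.Poly_Mapping"
begin

definition simple_graph :: "nat \<Rightarrow> nat set set \<Rightarrow> bool" where
  "simple_graph n E \<longleftrightarrow> (\<forall>e\<in>E. \<exists>i j. i \<in> {1..n} \<and> j \<in> {1..n} \<and> i \<noteq> j \<and> e = {i, j})"

definition inc :: "nat set set \<Rightarrow> nat \<Rightarrow> nat set set" where
  "inc E i = {e \<in> E. i \<in> e}"

definition deg :: "nat set set \<Rightarrow> nat \<Rightarrow> nat" where
  "deg E i = card (inc E i)"

definition isolated_edge :: "nat set set \<Rightarrow> nat set \<Rightarrow> bool" where
  "isolated_edge E e \<longleftrightarrow> e \<in> E \<and> (\<forall>v\<in>e. deg E v = 1)"

definition nice :: "nat set set \<Rightarrow> bool" where
  "nice E \<longleftrightarrow> \<not> (\<exists>e\<in>E. isolated_edge E e)"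

text \<open>Multivariate polynomials with integer coefficients in variables indexed by edges:
  a monomial is a finitely supported exponent map K, a polynomial maps monomials to coefficients.\<close>
type_synonym epoly = "(nat set \<Rightarrow>\<^sub>0 nat) \<Rightarrow>\<^sub>0 int"

definition var :: "nat set \<Rightarrow> epoly" where
  "var e = Poly_Mapping.single (Poly_Mapping.single e 1) 1"

definition PG :: "nat set set \<Rightarrow> epoly" where
  "PG E = (\<Prod>f\<in>E. (\<Sum>e\<in>inc E (Min f). var e) - (\<Sum>e\<in>inc E (Max f). var e))"

definition mon :: "epoly \<Rightarrow> (nat set \<Rightarrow>\<^sub>0 nat) set" where
  "mon P = {K. Poly_Mapping.lookup P K \<noteq> 0}"

definition alg_choosable_1b :: "nat set set \<Rightarrow> nat \<Rightarrow> bool" where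
  "alg_choosable_1b E b \<longleftrightarrow>
     (\<exists>K :: nat set \<Rightarrow>\<^sub>0 nat. Poly_Mapping.keys K \<subseteq> E
        \<and> (\<Sum>e\<in>E. Poly_Mapping.lookup K e) = card E
        \<and> (\<forall>e\<in>E. Poly_Mapping.lookup K e \<le> b - 1)
        \<and> K \<in> mon (PG E))"

end

theory Submission
  imports Defs "HOL-Library.Multiset"
begin

text \<open>
  Write \<open>s\<^sub>v\<close> for the sum of the variables at the vertex \<open>v\<close>, so that \<open>P\<^sub>G\<close> is the product of the
  differences \<open>s\<^sub>i - s\<^sub>j\<close>. Differentiate it along \<open>|E|\<close> directions \<open>a : E \<rightarrow> \<int>\<close>. If the resulting
  constant (a permanent) is nonzero and every edge lies in the support of at most five directions,
  then some monomial with all exponents at most five survives. Only the vertex sums of a direction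
  matter for the permanent, so alternating walks provide cheap directions: a walk of length two
  from \<open>u\<close> to \<open>v\<close> acts as \<open>u - v\<close>, one of length three as \<open>u + v\<close>.

  Let \<open>S\<close> be an optimal independent set and \<open>T\<close> its complement. Directions with vertex sums
  supported on \<open>S\<close> treat the edges between \<open>S\<close> and \<open>T\<close>; since \<open>S\<close> is independent, their part of the
  permanent is essentially one coefficient, at \<open>\<Prod> x\<^sub>s\<^bsup>deg s\<^esup>\<close>, of a product of forms \<open>x\<^sub>u \<plusminus> x\<^sub>v\<close>. If the
  product is a square \<open>F\<^sup>2\<close> in which every \<open>s\<close> occurs with the right multiplicity, this coefficient
  is \<open>\<plusminus>\<close> the sum of the squares of the coefficients of \<open>F\<close>, hence nonzero; parity corrections along
  a connected structure reduce to this case, up to one harmless unsquared form per component.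
  The edges inside \<open>T\<close> are then treated vertex by vertex along a linear order, which makes the
  remaining matrix block triangular.
\<close>

section \<open>Directional derivatives of products of linear forms\<close>

text \<open>The bound five is four plus one. A token, that is an edge from \<open>S\<close> to a
  vertex of \<open>T - Free\<close>, must be paired with another token at the same centre, since
  only then does the vertex sum at the centre cancel. An odd number of tokens cannot be matched up,
  so tokens are used zero to two times without changing the total at any vertex of \<open>S\<close>;
  squaring doubles this to at most four. The fifth direction at such an edge serves a triangle or a
  walk inside \<open>T\<close>. Squares are taken because a coefficient of an arbitrary product of
  forms \<open>x_u \<plusminus> x_v\<close> may vanish by cancellation.

  The obstacle is a vertex of \<open>T\<close> with a single neighbour in \<open>S\<close>: its
  token may have no partner. If the edge to that neighbour lies in a triangle, the triangle can
  replace the token; otherwise the vertex becomes a satellite of a neighbour in \<open>T\<close>, or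
  the centre of a satellite. Optimality of \<open>S\<close> and niceness supply that neighbour;
  optimality also makes vertices with the same single neighbour adjacent, which provides
  triangles.\<close>

definition mono1 :: "'a \<Rightarrow> 'a \<Rightarrow>\<^sub>0 nat" where
  "mono1 x = Poly_Mapping.single x 1"

lemma lookup_mono1 [simp]: "Poly_Mapping.lookup (mono1 x) y = (if x = y then 1 else 0)"
  by (simp add: mono1_def lookup_single when_def)

lemma keys_mono1 [simp]: "Poly_Mapping.keys (mono1 x) = {x}"
  by (simp add: mono1_def)

lemma lookup_single_mult_add:
  fixes p :: "'m::cancel_comm_monoid_add \<Rightarrow>\<^sub>0 'b::comm_semiring_1"
  shows "Poly_Mapping.lookup (Poly_Mapping.single a c * p) (a + L) = c * Poly_Mapping.lookup p L"
proof -
  have "Poly_Mapping.lookup (Poly_Mapping.single a c * p) (a + L) =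
    (\<Sum>l. (c * (\<Sum>q. Poly_Mapping.lookup p q when a + L = l + q)) when a = l)"
    by (simp add: lookup_mult lookup_single when_mult)
  also have "\<dots> = c * (\<Sum>q. Poly_Mapping.lookup p q when L = q)"
    by simp
  finally show ?thesis by simp
qed

lemma mono1_diff_add:
  assumes "Poly_Mapping.lookup K x > 0"
  shows "mono1 x + (K - mono1 x) = K"
  by (rule poly_mapping_eqI) (use assms in \<open>auto simp: lookup_add lookup_minus lookup_single when_def\<close>)

lemma lookup_single_mono1_mult:
  fixes p :: "('a \<Rightarrow>\<^sub>0 nat) \<Rightarrow>\<^sub>0 int"
  shows "Poly_Mapping.lookup (Poly_Mapping.single (mono1 x) c * p) K =
    c * (if Poly_Mapping.lookup K x > 0 then Poly_Mapping.lookup p (K - mono1 x) else 0)"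
proof (cases "Poly_Mapping.lookup K x > 0")
  case True
  then show ?thesis
    using lookup_single_mult_add[of "mono1 x" c p "K - mono1 x"] mono1_diff_add[OF True] by simp
next
  case False
  have "K \<noteq> mono1 x + q" for q
  proof
    assume "K = mono1 x + q"
    then have "Poly_Mapping.lookup K x = 1 + Poly_Mapping.lookup q x"
      by (simp add: lookup_add)
    with False show False by simp
  qed
  then have "(\<Sum>q. Poly_Mapping.lookup p q when K = mono1 x + q) = 0"
    by simp
  then have "Poly_Mapping.lookup (Poly_Mapping.single (mono1 x) c * p) K = 0"
    by (simp add: lookup_mult lookup_single when_mult)
  with False show ?thesis by simp
qed

definition linform :: "'a set \<Rightarrow> ('a \<Rightarrow> int) \<Rightarrow> ('a \<Rightarrow>\<^sub>0 nat) \<Rightarrow>\<^sub>0 int" where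
  "linform A a = (\<Sum>e\<in>A. Poly_Mapping.single (mono1 e) (a e))"

lemma lookup_linform_mult:
  "Poly_Mapping.lookup (linform A a * p) K =
    (\<Sum>e\<in>A. a e * (if Poly_Mapping.lookup K e > 0 then Poly_Mapping.lookup p (K - mono1 e) else 0))"
  by (simp add: linform_def sum_distrib_right lookup_sum lookup_single_mono1_mult)

text \<open>Laplace expansion along the columns \<open>ws\<close>; the value is \<open>0\<close> unless there are as many rows as
  columns.\<close>

fun permanent :: "('r \<Rightarrow> 'w \<Rightarrow> int) \<Rightarrow> 'r set \<Rightarrow> 'w list \<Rightarrow> int" where
  "permanent M F [] = (if F = {} then 1 else 0)"
| "permanent M F (w # ws) = (\<Sum>f\<in>F. M f w * permanent M (F - {f}) ws)"

text \<open>Acts on coefficient functions rather than polynomials, so no finiteness of supports has to be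
  carried along.\<close>

definition dirder :: "'a set \<Rightarrow> ('a \<Rightarrow> int) \<Rightarrow> (('a \<Rightarrow>\<^sub>0 nat) \<Rightarrow> int) \<Rightarrow> ('a \<Rightarrow>\<^sub>0 nat) \<Rightarrow> int" where
  "dirder A w c K = (\<Sum>e\<in>A. w e * (int (Poly_Mapping.lookup K e) + 1) * c (K + mono1 e))"

fun dirders :: "'a set \<Rightarrow> ('a \<Rightarrow> int) list \<Rightarrow> (('a \<Rightarrow>\<^sub>0 nat) \<Rightarrow> int) \<Rightarrow> ('a \<Rightarrow>\<^sub>0 nat) \<Rightarrow> int" where
  "dirders A [] c = c"
| "dirders A (w # ws) c = dirders A ws (dirder A w c)"

text \<open>The Leibniz rule on coefficients; the derivative of \<open>linform A a\<close> along
  \<open>w\<close> is the constant in the first summand.\<close>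

lemma dirder_linform_mult:
  assumes "finite A"
  shows "dirder A w (Poly_Mapping.lookup (linform A a * p)) K =
    (\<Sum>e\<in>A. a e * w e) * Poly_Mapping.lookup p K +
    (\<Sum>e\<in>A. a e * (if Poly_Mapping.lookup K e > 0
       then dirder A w (Poly_Mapping.lookup p) (K - mono1 e) else 0))"
proof -
  let ?l = Poly_Mapping.lookup
  have "dirder A w (?l (linform A a * p)) K =
    (\<Sum>e'\<in>A. \<Sum>e\<in>A. w e' * (int (?l K e') + 1) *
      (a e * (if ?l (K + mono1 e') e > 0 then ?l p (K + mono1 e' - mono1 e) else 0)))"
    by (simp add: dirder_def lookup_linform_mult sum_distrib_left)
  also have "\<dots> = (\<Sum>e\<in>A. \<Sum>e'\<in>A. w e' * (int (?l K e') + 1) *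
      (a e * (if ?l (K + mono1 e') e > 0 then ?l p (K + mono1 e' - mono1 e) else 0)))"
    by (rule sum.swap)
  \<comment> \<open>For \<open>e' = e\<close> the factor on the left is \<open>K e + 1\<close>, but
    the derivative at \<open>K - mono1 e\<close> only accounts for \<open>K e\<close>; the surplus 1
    produces the constant term.\<close>
  also have "\<dots> = (\<Sum>e\<in>A. \<Sum>e'\<in>A. (if e' = e then a e * w e * ?l p K else 0) +
      a e * (if ?l K e > 0 then w e' * (int (?l (K - mono1 e) e') + 1) *
        ?l p (K - mono1 e + mono1 e') else 0))"
  proof (intro sum.cong refl)
    fix e e'
    show "w e' * (int (?l K e') + 1) *
      (a e * (if ?l (K + mono1 e') e > 0 then ?l p (K + mono1 e' - mono1 e) else 0)) =
      (if e' = e then a e * w e * ?l p K else 0) +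
      a e * (if ?l K e > 0 then w e' * (int (?l (K - mono1 e) e') + 1) *
        ?l p (K - mono1 e + mono1 e') else 0)"
    proof (cases "?l K e > 0")
      case True
      have eq: "K + mono1 e' - mono1 e = K - mono1 e + mono1 e'"
        by (rule poly_mapping_eqI) (use True in \<open>auto simp: lookup_add lookup_minus lookup_single when_def\<close>)
      have eq2: "K - mono1 e + mono1 e = K"
        using mono1_diff_add[OF True] by (simp add: add.commute)
      show ?thesis
      proof (cases "e' = e")
        case True': True
        have "int (?l (K - mono1 e) e) + 1 = int (?l K e)"
          using True by (simp add: lookup_minus)
        then show ?thesis using True True' eq2
          by (simp add: eq lookup_add algebra_simps)
      next
        case False
        then show ?thesis using True
          by (simp add: eq lookup_add lookup_minus lookup_single when_def)
      qed
    next
      case False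
      then show ?thesis
        by (auto simp: lookup_add lookup_single when_def)
    qed
  qed
  also have "\<dots> = (\<Sum>e\<in>A. a e * w e) * ?l p K + (\<Sum>e\<in>A. a e * (if ?l K e > 0
       then dirder A w (?l p) (K - mono1 e) else 0))"
    using assms
    by (auto simp: sum.distrib sum_distrib_left sum_distrib_right dirder_def intro!: sum.cong)
  finally show ?thesis .
qed

text \<open>Every factor has a constant derivative, so differentiating once deletes one factor in
  all possible ways. This is the expansion of \<open>permanent\<close> along one column.\<close>

lemma dirder_prod_linform:
  assumes "finite A" "finite F"
  shows "dirder A w (Poly_Mapping.lookup (\<Prod>f\<in>F. linform A (a f))) K =
    (\<Sum>f\<in>F. (\<Sum>e\<in>A. a f e * w e) * Poly_Mapping.lookup (\<Prod>g\<in>F - {f}. linform A (a g)) K)"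
  using assms(2)
proof (induction F arbitrary: K rule: finite_induct)
  case empty
  have "K + mono1 e \<noteq> 0" for e
  proof
    assume "K + mono1 e = 0"
    then have "Poly_Mapping.lookup (K + mono1 e) e = 0" by simp
    then show False by (simp add: lookup_add)
  qed
  then show ?case by (simp add: dirder_def lookup_one)
next
  case (insert f F)
  let ?l = Poly_Mapping.lookup and ?P = "\<lambda>G. \<Prod>g\<in>G. linform A (a g)"
  let ?m = "\<lambda>f. \<Sum>e\<in>A. a f e * w e"
  have "dirder A w (?l (?P (insert f F))) K = dirder A w (?l (linform A (a f) * ?P F)) K"
    using insert by simp
  also have "\<dots> = ?m f * ?l (?P F) K + (\<Sum>e\<in>A. a f e * (if ?l K e > 0
       then (\<Sum>g\<in>F. ?m g * ?l (?P (F - {g})) (K - mono1 e)) else 0))"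
    by (simp add: dirder_linform_mult[OF assms(1)] insert.IH cong: if_cong)
  also have "(\<Sum>e\<in>A. a f e * (if ?l K e > 0
       then (\<Sum>g\<in>F. ?m g * ?l (?P (F - {g})) (K - mono1 e)) else 0)) =
     (\<Sum>e\<in>A. \<Sum>g\<in>F. ?m g * (a f e * (if ?l K e > 0 then ?l (?P (F - {g})) (K - mono1 e) else 0)))"
    by (intro sum.cong refl) (simp add: sum_distrib_left mult.left_commute)
  also have "\<dots> = (\<Sum>g\<in>F. \<Sum>e\<in>A. ?m g * (a f e * (if ?l K e > 0 then ?l (?P (F - {g})) (K - mono1 e) else 0)))"
    by (rule sum.swap)
  also have "\<dots> = (\<Sum>g\<in>F. ?m g * ?l (linform A (a f) * ?P (F - {g})) K)"
    unfolding lookup_linform_mult sum_distrib_left[symmetric] by simp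
  also have "\<dots> = (\<Sum>g\<in>F. ?m g * ?l (?P (insert f F - {g})) K)"
  proof (intro sum.cong refl)
    fix g assume "g \<in> F"
    then have "insert f F - {g} = insert f (F - {g})" using insert by auto
    then show "?m g * ?l (linform A (a f) * ?P (F - {g})) K = ?m g * ?l (?P (insert f F - {g})) K"
      using insert by simp
  qed
  also have "?m f * ?l (?P F) K + \<dots> = (\<Sum>g\<in>insert f F. ?m g * ?l (?P (insert f F - {g})) K)"
    using insert by simp
  finally show ?case .
qed

lemma dirders_sum:
  assumes "finite F"
  shows "dirders A ws (\<lambda>K. \<Sum>f\<in>F. m f * c f K) K = (\<Sum>f\<in>F. m f * dirders A ws (c f) K)"
proof (induction ws arbitrary: c)
  case Nil
  then show ?case by simp
next
  case (Cons w ws)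
  have "dirder A w (\<lambda>K. \<Sum>f\<in>F. m f * c f K) = (\<lambda>K. \<Sum>f\<in>F. m f * dirder A w (c f) K)"
  proof
    fix K
    show "dirder A w (\<lambda>K. \<Sum>f\<in>F. m f * c f K) K = (\<Sum>f\<in>F. m f * dirder A w (c f) K)"
      unfolding dirder_def sum_distrib_left by (subst sum.swap) (simp add: mult_ac)
  qed
  then show ?case using Cons by simp
qed

lemma dirders_prod_linform:
  assumes "finite A" "finite F"
  shows "dirders A ws (Poly_Mapping.lookup (\<Prod>f\<in>F. linform A (a f))) 0 =
    permanent (\<lambda>f w. \<Sum>e\<in>A. a f e * w e) F ws"
  using assms(2)
proof (induction ws arbitrary: F)
  case Nil
  show ?case
  proof (cases "F = {}")
    case True
    then show ?thesis by simp
  next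
    case False
    then obtain f where "f \<in> F" by auto
    then have "(\<Prod>f\<in>F. linform A (a f)) = linform A (a f) * (\<Prod>f\<in>F - {f}. linform A (a f))"
      using Nil by (simp add: prod.remove)
    then show ?thesis using False by (simp add: lookup_linform_mult)
  qed
next
  case (Cons w ws)
  let ?P = "\<lambda>G. \<Prod>g\<in>G. linform A (a g)"
  have "dirder A w (Poly_Mapping.lookup (?P F)) =
     (\<lambda>K. \<Sum>f\<in>F. (\<Sum>e\<in>A. a f e * w e) * Poly_Mapping.lookup (?P (F - {f})) K)"
    by (rule ext) (rule dirder_prod_linform[OF assms(1) Cons.prems])
  then show ?case using Cons by (simp add: dirders_sum)
qed

definition load :: "('a \<Rightarrow> int) list \<Rightarrow> 'a \<Rightarrow> nat" where
  "load ws e = length (filter (\<lambda>w. w e \<noteq> 0) ws)"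

lemma load_append [simp]: "load (ws @ ws') e = load ws e + load ws' e"
  by (simp add: load_def)

lemma load_map_distinct:
  assumes "distinct xs"
  shows "load (map a xs) e = card {x\<in>set xs. a x e \<noteq> 0}"
proof -
  have "load (map a xs) e = length (filter (\<lambda>x. a x e \<noteq> 0) xs)"
    by (simp add: load_def filter_map comp_def)
  also have "\<dots> = card (set (filter (\<lambda>x. a x e \<noteq> 0) xs))"
    using assms by (metis distinct_card distinct_filter)
  finally show ?thesis by simp
qed

text \<open>A nonzero derivative is traced back: each direction contributes one variable from its
  support, so the exponent of \<open>e\<close> grows by at most the number of directions containing
  \<open>e\<close>.\<close>

lemma dirders_neq_0_exponent:
  assumes "finite A" "dirders A ws c K \<noteq> 0"
  shows "\<exists>L. c L \<noteq> 0 \<and> Poly_Mapping.keys L \<subseteq> Poly_Mapping.keys K \<union> A \<and>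
    (\<Sum>e\<in>A. Poly_Mapping.lookup L e) = (\<Sum>e\<in>A. Poly_Mapping.lookup K e) + length ws \<and>
    (\<forall>e. Poly_Mapping.lookup L e \<le> Poly_Mapping.lookup K e + load ws e)"
  using assms(2)
proof (induction ws arbitrary: c)
  case Nil
  then show ?case by (auto simp: load_def)
next
  case (Cons w ws)
  from Cons.IH[of "dirder A w c"] Cons.prems obtain L where
    L: "dirder A w c L \<noteq> 0" "Poly_Mapping.keys L \<subseteq> Poly_Mapping.keys K \<union> A"
    "(\<Sum>e\<in>A. Poly_Mapping.lookup L e) = (\<Sum>e\<in>A. Poly_Mapping.lookup K e) + length ws"
    "\<forall>e. Poly_Mapping.lookup L e \<le> Poly_Mapping.lookup K e + load ws e" by auto
  from L(1) obtain e where e: "e \<in> A" "w e \<noteq> 0" "c (L + mono1 e) \<noteq> 0"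
    unfolding dirder_def by (auto elim!: sum.not_neutral_contains_not_neutral)
  have "Poly_Mapping.keys (L + mono1 e) \<subseteq> Poly_Mapping.keys K \<union> A"
    using keys_add[of L "mono1 e"] L(2) e(1) by auto
  moreover have "(\<Sum>x\<in>A. Poly_Mapping.lookup (L + mono1 e) x) =
      (\<Sum>e\<in>A. Poly_Mapping.lookup K e) + length (w # ws)"
    using L(3) e(1) assms(1) by (simp add: lookup_add sum.distrib lookup_single when_def)
  moreover have "Poly_Mapping.lookup (L + mono1 e) x \<le> Poly_Mapping.lookup K x + load (w # ws) x" for x
    using L(4)[rule_format, of x] e(2) by (auto simp: lookup_add lookup_single when_def load_def)
  ultimately show ?case using e(3) by blast
qed

section \<open>Vertex sums of a direction, and the reduction to a permanent\<close>

definition vweight :: "nat set set \<Rightarrow> (nat set \<Rightarrow> int) \<Rightarrow> nat \<Rightarrow> int" where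
  "vweight E a v = (\<Sum>e\<in>inc E v. a e)"

definition edge_ind :: "'e \<Rightarrow> 'e \<Rightarrow> int" where
  "edge_ind e x = (if x = e then 1 else 0)"

lemma vweight_add: "vweight E (\<lambda>e. a e + b e) x = vweight E a x + vweight E b x"
  by (simp add: vweight_def sum.distrib)

lemma vweight_diff: "vweight E (\<lambda>e. a e - b e) x = vweight E a x - vweight E b x"
  by (simp add: vweight_def sum_subtractf)

lemma vweight_scale: "vweight E (\<lambda>e. k * a e) x = k * vweight E a x"
  by (simp add: vweight_def sum_distrib_left)

lemma vweight_ind:
  assumes "finite E" "{u, v} \<in> E" "u \<noteq> v"
  shows "vweight E (edge_ind {u, v}) x = (if x = u then 1 else 0) + (if x = v then 1 else 0)"
proof -
  have "finite (inc E x)" using assms by (simp add: inc_def)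
  then have "vweight E (edge_ind {u, v}) x = (if {u, v} \<in> inc E x then 1 else 0)"
    by (simp add: vweight_def edge_ind_def)
  then show ?thesis using assms by (auto simp: inc_def)
qed

text \<open>The derivative along \<open>a\<close> of the factor of \<open>PG E\<close> that belongs
  to \<open>f\<close>, hence the matrix entry in row \<open>f\<close> and column
  \<open>a\<close>.\<close>

definition edge_diff :: "nat set set \<Rightarrow> nat set \<Rightarrow> (nat set \<Rightarrow> int) \<Rightarrow> int" where
  "edge_diff E f a = vweight E a (Min f) - vweight E a (Max f)"

lemma permanent_length:
  assumes "finite F" "permanent M F ws \<noteq> 0"
  shows "length ws = card F"
  using assms
proof (induction ws arbitrary: F)
  case Nil
  then show ?case by (auto split: if_splits)
next
  case (Cons w ws)
  then obtain f where f: "f \<in> F" "permanent M (F - {f}) ws \<noteq> 0"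
    by (auto elim!: sum.not_neutral_contains_not_neutral)
  with Cons.IH[of "F - {f}"] Cons.prems(1) have "length ws = card F - 1" by simp
  moreover have "card F > 0" using f(1) Cons.prems(1) by (auto simp: card_gt_0_iff)
  ultimately show ?case by simp
qed

lemma alg_choosable_if_permanent:
  assumes fin: "finite E" and nz: "permanent (edge_diff E) E ws \<noteq> 0"
    and load: "\<And>e. e \<in> E \<Longrightarrow> load ws e \<le> b - 1"
  shows "alg_choosable_1b E b"
proof -
  define a :: "nat set \<Rightarrow> nat set \<Rightarrow> int" where
    "a f e = (if Min f \<in> e then 1 else 0) - (if Max f \<in> e then 1 else 0)" for f e
  have sum_inc: "(\<Sum>e\<in>inc E i. g e) = (\<Sum>e\<in>E. if i \<in> e then g e else 0)" for i and g :: "nat set \<Rightarrow> 'z::comm_monoid_add"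
    unfolding inc_def using fin by (rule sum.inter_filter)
  have "(\<Sum>e\<in>inc E (Min f). var e) - (\<Sum>e\<in>inc E (Max f). var e) = linform E (a f)" for f
    unfolding sum_inc sum_subtractf[symmetric] linform_def
    by (intro sum.cong refl) (auto simp: a_def var_def mono1_def single_uminus)
  then have P: "PG E = (\<Prod>f\<in>E. linform E (a f))"
    by (simp add: PG_def)
  have M: "(\<Sum>e\<in>E. a f e * w e) = edge_diff E f w" for f w
    unfolding edge_diff_def vweight_def sum_inc sum_subtractf[symmetric]
    by (intro sum.cong refl) (auto simp: a_def)
  have "dirders E ws (Poly_Mapping.lookup (PG E)) 0 \<noteq> 0"
    using nz by (simp add: P dirders_prod_linform[OF fin fin] M)
  from dirders_neq_0_exponent[OF fin this] obtain L where L: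
    "Poly_Mapping.lookup (PG E) L \<noteq> 0" "Poly_Mapping.keys L \<subseteq> E"
    "(\<Sum>e\<in>E. Poly_Mapping.lookup L e) = length ws" "\<And>e. Poly_Mapping.lookup L e \<le> load ws e"
    by auto
  with permanent_length[OF fin nz] load show ?thesis
    unfolding alg_choosable_1b_def mon_def by (metis (mono_tags, lifting) mem_Collect_eq order_trans)
qed

section \<open>Permanents with signed rows, block or triangular shape, and repeated rows\<close>

lemma permanent_map: "permanent (\<lambda>f a. M f (g a)) F ws = permanent M F (map g ws)"
  by (induction ws arbitrary: F) simp_all

text \<open>Removes the signs that arise because the factors of \<open>PG\<close> are oriented from
  \<open>Min\<close> to \<open>Max\<close> rather than as the construction wants.\<close>

lemma permanent_row_scale:
  assumes "finite F" "\<And>f w. f \<in> F \<Longrightarrow> w \<in> set ws \<Longrightarrow> M f w = \<epsilon> f * M' f w"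
  shows "permanent M F ws = (\<Prod>f\<in>F. \<epsilon> f) * permanent M' F ws"
  using assms
proof (induction ws arbitrary: F)
  case Nil
  then show ?case by simp
next
  case (Cons w ws)
  have "permanent M F (w # ws) = (\<Sum>f\<in>F. (\<Prod>f\<in>F. \<epsilon> f) * (M' f w * permanent M' (F - {f}) ws))"
    unfolding permanent.simps
  proof (intro sum.cong refl)
    fix f assume f: "f \<in> F"
    have "permanent M (F - {f}) ws = (\<Prod>f\<in>F - {f}. \<epsilon> f) * permanent M' (F - {f}) ws"
      by (rule Cons.IH) (use Cons.prems in auto)
    moreover have "(\<Prod>f\<in>F. \<epsilon> f) = \<epsilon> f * (\<Prod>f\<in>F - {f}. \<epsilon> f)"
      using f Cons.prems(1) by (simp add: prod.remove)
    moreover have "M f w = \<epsilon> f * M' f w" using Cons.prems(2) f by simp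
    ultimately show "M f w * permanent M (F - {f}) ws = (\<Prod>f\<in>F. \<epsilon> f) * (M' f w * permanent M' (F - {f}) ws)"
      by simp
  qed
  then show ?case by (simp add: sum_distrib_left)
qed

lemma permanent_append_block:
  assumes "finite F" "finite G" "F \<inter> G = {}" "length ws = card F"
    and "\<And>g w. g \<in> G \<Longrightarrow> w \<in> set ws \<Longrightarrow> M g w = 0"
  shows "permanent M (F \<union> G) (ws @ ws') = permanent M F ws * permanent M G ws'"
  using assms
proof (induction ws arbitrary: F)
  case Nil
  then show ?case by simp
next
  case (Cons w ws)
  have "permanent M (F \<union> G) ((w # ws) @ ws') = (\<Sum>f\<in>F \<union> G. M f w * permanent M (F \<union> G - {f}) (ws @ ws'))"
    by simp
  also have "\<dots> = (\<Sum>f\<in>F. M f w * permanent M (F \<union> G - {f}) (ws @ ws'))"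
    using Cons.prems by (subst sum.union_disjoint) auto
  also have "\<dots> = (\<Sum>f\<in>F. M f w * (permanent M (F - {f}) ws * permanent M G ws'))"
  proof (intro sum.cong refl)
    fix f assume f: "f \<in> F"
    then have "F \<union> G - {f} = (F - {f}) \<union> G" using Cons.prems by auto
    then show "M f w * permanent M (F \<union> G - {f}) (ws @ ws') = M f w * (permanent M (F - {f}) ws * permanent M G ws')"
      using Cons.IH[of "F - {f}"] Cons.prems f by (simp add: Diff_Int_distrib2)
  qed
  also have "\<dots> = permanent M F (w # ws) * permanent M G ws'"
    by (simp add: sum_distrib_right mult.assoc)
  finally show ?case .
qed

text \<open>A column can only be matched with a row of its own level, because the rows of lower
  level are used up by then. All surviving terms equal the product of the
  \<open>\<epsilon> f\<close>, so nothing cancels and \<open>N\<close> counts the matchings that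
  preserve levels.\<close>

lemma permanent_triangular:
  fixes t :: "'r \<Rightarrow> nat"
  assumes "finite F" "image_mset t (mset_set F) = mset (map t fs)" "sorted (map t fs)"
    and zero: "\<And>f g. f \<in> F \<Longrightarrow> g \<in> set fs \<Longrightarrow> t g < t f \<Longrightarrow> M f (a g) = 0"
    and diag: "\<And>f g. f \<in> F \<Longrightarrow> g \<in> set fs \<Longrightarrow> t f = t g \<Longrightarrow> M f (a g) = \<epsilon> f"
  shows "\<exists>N>0. permanent M F (map a fs) = (\<Prod>f\<in>F. \<epsilon> f) * N"
  using assms
proof (induction fs arbitrary: F)
  case Nil
  then have "set_mset (image_mset t (mset_set F)) = {}" by simp
  with Nil(1) have "F = {}" by simp
  then show ?case by (intro exI[of _ 1]) simp
next
  case (Cons g fs)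
  define F0 where "F0 = {f \<in> F. t f = t g}"
  have minF: "t g \<le> t f" if "f \<in> F" for f
  proof -
    have "t f \<in># image_mset t (mset_set F)" using that Cons.prems(1) by auto
    then have "t f \<in> set (map t (g # fs))" unfolding Cons.prems(2) by simp
    with Cons.prems(3) show ?thesis by auto
  qed
  have "t g \<in># image_mset t (mset_set F)" unfolding Cons.prems(2) by simp
  then have ne: "F0 \<noteq> {}" using Cons.prems(1) by (auto simp: F0_def)
  have finF0: "finite F0" using Cons.prems(1) by (simp add: F0_def)
  have "\<forall>f\<in>F0. \<exists>N>0. permanent M (F - {f}) (map a fs) = (\<Prod>h\<in>F - {f}. \<epsilon> h) * N"
  proof
    fix f assume f: "f \<in> F0"
    have "mset_set F = add_mset f (mset_set (F - {f}))"
      using f Cons.prems(1) by (simp add: F0_def mset_set.remove)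
    then have "image_mset t (mset_set (F - {f})) = mset (map t fs)"
      using Cons.prems(2) f by (simp add: F0_def)
    then show "\<exists>N>0. permanent M (F - {f}) (map a fs) = (\<Prod>h\<in>F - {f}. \<epsilon> h) * N"
      by (intro Cons.IH) (use Cons.prems in auto)
  qed
  then obtain N where N: "\<And>f. f \<in> F0 \<Longrightarrow> N f > (0::int)"
    "\<And>f. f \<in> F0 \<Longrightarrow> permanent M (F - {f}) (map a fs) = (\<Prod>h\<in>F - {f}. \<epsilon> h) * N f"
    by metis
  have "permanent M F (map a (g # fs)) = (\<Sum>f\<in>F. M f (a g) * permanent M (F - {f}) (map a fs))" by simp
  also have "\<dots> = (\<Sum>f\<in>F0. M f (a g) * permanent M (F - {f}) (map a fs))"
  proof (rule sum.mono_neutral_right)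
    show "\<forall>f\<in>F - F0. M f (a g) * permanent M (F - {f}) (map a fs) = 0"
    proof
      fix f assume f: "f \<in> F - F0"
      with minF[of f] have "t g < t f" by (auto simp: F0_def order_less_le)
      then show "M f (a g) * permanent M (F - {f}) (map a fs) = 0"
        using Cons.prems(4)[of f g] f by simp
    qed
  qed (use Cons.prems in \<open>auto simp: F0_def\<close>)
  also have "\<dots> = (\<Sum>f\<in>F0. (\<Prod>h\<in>F. \<epsilon> h) * N f)"
  proof (intro sum.cong refl)
    fix f assume f: "f \<in> F0"
    then have "M f (a g) = \<epsilon> f" using Cons.prems(5)[of f g] by (simp add: F0_def)
    moreover have "(\<Prod>h\<in>F. \<epsilon> h) = \<epsilon> f * (\<Prod>h\<in>F - {f}. \<epsilon> h)"
      using f Cons.prems(1) by (simp add: F0_def prod.remove)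
    ultimately show "M f (a g) * permanent M (F - {f}) (map a fs) = (\<Prod>h\<in>F. \<epsilon> h) * N f"
      using N(2)[OF f] by simp
  qed
  also have "\<dots> = (\<Prod>h\<in>F. \<epsilon> h) * (\<Sum>f\<in>F0. N f)"
    by (simp add: sum_distrib_left)
  finally show ?case
    using sum_pos[of F0 N] finF0 ne N(1) by auto
qed

text \<open>Rows with the same \<open>s f\<close> coincide. Each assignment of columns to variables
  is counted once by the coefficient, and by the permanent once for every way to distribute the
  columns of a variable over its rows.\<close>

lemma permanent_eq_lookup_prod_list:
  assumes "finite F" "finite S" "s ` F \<subseteq> S"
  shows "permanent (\<lambda>f w. w (s f)) F ws =
    (\<Prod>x\<in>S. fact (card {f\<in>F. s f = x})) *
      Poly_Mapping.lookup (prod_list (map (linform S) ws)) (\<Sum>f\<in>F. mono1 (s f))"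
  using assms(1,3)
proof (induction ws arbitrary: F)
  case Nil
  show ?case
  proof (cases "F = {}")
    case True
    then show ?thesis by simp
  next
    case False
    then obtain f where f: "f \<in> F" by auto
    have "Poly_Mapping.lookup (\<Sum>f\<in>F. mono1 (s f)) (s f) \<noteq> 0"
      using f Nil by (auto simp: lookup_sum lookup_single when_def)
    then have "(\<Sum>f\<in>F. mono1 (s f)) \<noteq> 0" by auto
    then show ?thesis using False by (simp add: lookup_one)
  qed
next
  case (Cons w ws)
  let ?l = Poly_Mapping.lookup
  define R where "R = prod_list (map (linform S) ws)"
  define d where "d F = (\<Sum>f\<in>F. mono1 (s f))" for F
  define m where "m F x = card {f\<in>F. s f = x}" for F x
  have ld: "?l (d F) x = m F x" for x
    using Cons.prems(1) by (simp add: d_def m_def lookup_sum lookup_single when_def sum.If_cases Int_def)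
  have rm: "d (F - {f}) = d F - mono1 (s f)" if "f \<in> F" for f
  proof -
    have "d F = mono1 (s f) + d (F - {f})"
      unfolding d_def using that Cons.prems(1) by (simp add: sum.remove)
    then show ?thesis by simp
  qed
  have mf: "(\<Prod>x\<in>S. fact (m F x)) = int (m F (s f)) * (\<Prod>x\<in>S. fact (m (F - {f}) x))" if f: "f \<in> F" for f
  proof -
    have sf: "s f \<in> S" using f Cons.prems(2) by auto
    have 1: "m F (s f) = Suc (m (F - {f}) (s f))"
    proof -
      have "{g\<in>F. s g = s f} = insert f {g\<in>F - {f}. s g = s f}" using f by auto
      then show ?thesis unfolding m_def using Cons.prems(1) by simp
    qed
    have 2: "m F x = m (F - {f}) x" if "x \<noteq> s f" for x
    proof -
      have "{g\<in>F. s g = x} = {g\<in>F - {f}. s g = x}" using that by auto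
      then show ?thesis by (simp add: m_def)
    qed
    have "(\<Prod>x\<in>S. fact (m F x)) = fact (m F (s f)) * (\<Prod>x\<in>S - {s f}. fact (m F x))"
      using sf assms(2) by (simp add: prod.remove)
    also have "\<dots> = int (m F (s f)) * (fact (m (F - {f}) (s f)) * (\<Prod>x\<in>S - {s f}. fact (m (F - {f}) x)))"
      using 1 2 by simp
    also have "fact (m (F - {f}) (s f)) * (\<Prod>x\<in>S - {s f}. fact (m (F - {f}) x)) = (\<Prod>x\<in>S. fact (m (F - {f}) x))"
      using sf assms(2) by (simp add: prod.remove)
    finally show ?thesis .
  qed
  have "permanent (\<lambda>f w. w (s f)) F (w # ws) = (\<Sum>f\<in>F. w (s f) * ((\<Prod>x\<in>S. fact (m (F - {f}) x)) * ?l R (d (F - {f}))))"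
    unfolding permanent.simps
  proof (intro sum.cong refl)
    fix f assume "f \<in> F"
    have "permanent (\<lambda>f w. w (s f)) (F - {f}) ws = (\<Prod>x\<in>S. fact (m (F - {f}) x)) * ?l R (d (F - {f}))"
      unfolding R_def d_def m_def by (rule Cons.IH) (use Cons.prems in auto)
    then show "w (s f) * permanent (\<lambda>f w. w (s f)) (F - {f}) ws =
      w (s f) * ((\<Prod>x\<in>S. fact (m (F - {f}) x)) * ?l R (d (F - {f})))" by simp
  qed
  also have "\<dots> = (\<Sum>x\<in>S. \<Sum>f\<in>{f\<in>F. s f = x}. w (s f) * ((\<Prod>x\<in>S. fact (m (F - {f}) x)) * ?l R (d (F - {f}))))"
    using sum.group[OF Cons.prems(1) assms(2) Cons.prems(2)] by (rule sym)
  also have "\<dots> = (\<Sum>x\<in>S. (\<Prod>x\<in>S. fact (m F x)) * (w x * (if ?l (d F) x > 0 then ?l R (d F - mono1 x) else 0)))"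
  proof (intro sum.cong refl)
    fix x assume "x \<in> S"
    show "(\<Sum>f\<in>{f\<in>F. s f = x}. w (s f) * ((\<Prod>x\<in>S. fact (m (F - {f}) x)) * ?l R (d (F - {f})))) =
      (\<Prod>x\<in>S. fact (m F x)) * (w x * (if ?l (d F) x > 0 then ?l R (d F - mono1 x) else 0))"
    proof (cases "m F x = 0")
      case True
      then have "{f\<in>F. s f = x} = {}" using Cons.prems(1) by (simp add: m_def)
      then have "(\<Sum>f\<in>{f\<in>F. s f = x}. w (s f) * ((\<Prod>x\<in>S. fact (m (F - {f}) x)) * ?l R (d (F - {f})))) = 0"
        by (simp only: sum.empty)
      then show ?thesis using True by (simp add: ld)
    next
      case False
      \<comment> \<open>The product of factorials for \<open>F\<close> is \<open>m F x\<close> times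
        the one for \<open>F - {f}\<close>; multiplying by \<open>m F x\<close> and cancelling it at
        the end avoids a division.\<close>
      have "int (m F x) * (\<Sum>f\<in>{f\<in>F. s f = x}. w (s f) * ((\<Prod>x\<in>S. fact (m (F - {f}) x)) * ?l R (d (F - {f})))) =
        (\<Sum>f\<in>{f\<in>F. s f = x}. w x * ((\<Prod>x\<in>S. fact (m F x)) * ?l R (d F - mono1 x)))"
        unfolding sum_distrib_left by (intro sum.cong refl) (auto simp: mf rm)
      also have "\<dots> = int (m F x) * (w x * ((\<Prod>x\<in>S. fact (m F x)) * ?l R (d F - mono1 x)))"
        by (simp add: m_def)
      finally show ?thesis using False by (simp add: ld mult_ac)
    qed
  qed
  also have "\<dots> = (\<Prod>x\<in>S. fact (m F x)) * ?l (linform S w * R) (d F)"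
    by (simp add: lookup_linform_mult sum_distrib_left)
  finally show ?case by (simp add: R_def d_def m_def)
qed

section \<open>Coefficients of squares of products of binomial forms\<close>

definition bform :: "'a \<Rightarrow> 'a \<Rightarrow> int \<Rightarrow> ('a \<Rightarrow>\<^sub>0 nat) \<Rightarrow>\<^sub>0 int" where
  "bform a b \<eta> = Poly_Mapping.single (mono1 a) 1 + Poly_Mapping.single (mono1 b) \<eta>"

lemma lookup_bform_mult:
  "Poly_Mapping.lookup (bform a b \<eta> * p) K =
    (if Poly_Mapping.lookup K a > 0 then Poly_Mapping.lookup p (K - mono1 a) else 0) +
    \<eta> * (if Poly_Mapping.lookup K b > 0 then Poly_Mapping.lookup p (K - mono1 b) else 0)"
  by (simp add: bform_def distrib_right lookup_add lookup_single_mono1_mult)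

lemma bform_neq_0:
  assumes "a \<noteq> b"
  shows "bform a b \<eta> \<noteq> 0"
proof
  have "mono1 a \<noteq> mono1 b"
  proof
    assume "mono1 a = mono1 b"
    then have "Poly_Mapping.lookup (mono1 a) a = Poly_Mapping.lookup (mono1 b) a" by simp
    with assms show False by simp
  qed
  moreover assume "bform a b \<eta> = 0"
  then have "Poly_Mapping.lookup (bform a b \<eta>) (mono1 a) = 0" by simp
  ultimately show False by (simp add: bform_def lookup_add lookup_single)
qed

section \<open>The coefficientwise inner product of polynomials\<close>

definition inner :: "('m \<Rightarrow>\<^sub>0 int) \<Rightarrow> ('m \<Rightarrow>\<^sub>0 int) \<Rightarrow> int" where
  "inner p q = (\<Sum>K\<in>Poly_Mapping.keys p. Poly_Mapping.lookup p K * Poly_Mapping.lookup q K)"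

lemma inner_superset:
  assumes "finite A" "Poly_Mapping.keys p \<subseteq> A"
  shows "inner p q = (\<Sum>K\<in>A. Poly_Mapping.lookup p K * Poly_Mapping.lookup q K)"
  unfolding inner_def by (rule sum.mono_neutral_left) (use assms in \<open>auto simp: in_keys_iff\<close>)

lemma inner_commute: "inner p q = inner q p"
proof -
  let ?A = "Poly_Mapping.keys p \<union> Poly_Mapping.keys q"
  have "inner p q = (\<Sum>K\<in>?A. Poly_Mapping.lookup p K * Poly_Mapping.lookup q K)"
    by (rule inner_superset) auto
  also have "\<dots> = (\<Sum>K\<in>?A. Poly_Mapping.lookup q K * Poly_Mapping.lookup p K)"
    by (simp add: mult.commute)
  also have "\<dots> = inner q p"
    by (rule inner_superset[symmetric]) auto
  finally show ?thesis .
qed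

lemma inner_add_right: "inner p (q + r) = inner p q + inner p r"
  by (simp add: inner_def lookup_add distrib_left sum.distrib)

lemma inner_add_left: "inner (p + q) r = inner p r + inner q r"
  by (metis inner_add_right inner_commute)

lemma inner_scale_right:
  fixes p q :: "'m::cancel_comm_monoid_add \<Rightarrow>\<^sub>0 int"
  shows "inner p (Poly_Mapping.single 0 c * q) = c * inner p q"
proof -
  have "Poly_Mapping.lookup (Poly_Mapping.single 0 c * q) K = c * Poly_Mapping.lookup q K" for K
    using lookup_single_mult_add[of 0 c q K] by simp
  then show ?thesis by (simp add: inner_def sum_distrib_left mult.left_commute)
qed

lemma inner_scale_left:
  fixes p q :: "'m::cancel_comm_monoid_add \<Rightarrow>\<^sub>0 int"
  shows "inner (Poly_Mapping.single 0 c * q) p = c * inner q p"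
  by (metis inner_scale_right inner_commute)

lemma inner_self_pos:
  assumes "p \<noteq> 0"
  shows "inner p p > 0"
proof -
  have "Poly_Mapping.keys p \<noteq> {}" using assms by simp
  then show ?thesis
    unfolding inner_def
    by (intro sum_pos) (auto simp: in_keys_iff mult_less_0_iff zero_less_mult_iff)
qed

lemma inner_shift:
  fixes p q :: "'m::cancel_comm_monoid_add \<Rightarrow>\<^sub>0 int"
  shows "inner (Poly_Mapping.single L 1 * p) (Poly_Mapping.single L 1 * q) = inner p q"
proof -
  have "Poly_Mapping.keys (Poly_Mapping.single L 1 * p) \<subseteq> (\<lambda>K. L + K) ` Poly_Mapping.keys p"
    using keys_mult[of "Poly_Mapping.single L 1" p] by auto
  then have "inner (Poly_Mapping.single L 1 * p) (Poly_Mapping.single L 1 * q) =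
    (\<Sum>K\<in>(\<lambda>K. L + K) ` Poly_Mapping.keys p.
      Poly_Mapping.lookup (Poly_Mapping.single L 1 * p) K * Poly_Mapping.lookup (Poly_Mapping.single L 1 * q) K)"
    by (intro inner_superset) auto
  also have "\<dots> = inner p q"
    by (subst sum.reindex) (auto simp: inner_def lookup_single_mult_add)
  finally show ?thesis .
qed

text \<open>A token \<open>t\<close> asks for one factor \<open>x\<^bsub>s t\<^esub>\<close>. Two tokens \<open>t\<close>, \<open>t'\<close> at a common centre provide the
  form \<open>x\<^bsub>s t\<^esub> - \<kappa> t \<kappa> t' x\<^bsub>s t'\<^esub>\<close>.\<close>

locale token_forms =
  fixes s :: "'t \<Rightarrow> nat" and \<kappa> :: "'t \<Rightarrow> int"
  assumes sgn: "\<kappa> t = 1 \<or> \<kappa> t = -1"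
begin

definition pform :: "'t \<times> 't \<Rightarrow> (nat \<Rightarrow>\<^sub>0 nat) \<Rightarrow>\<^sub>0 int" where
  "pform p = bform (s (fst p)) (s (snd p)) (- (\<kappa> (fst p) * \<kappa> (snd p)))"

definition pforms :: "('t \<times> 't) list \<Rightarrow> (nat \<Rightarrow>\<^sub>0 nat) \<Rightarrow>\<^sub>0 int" where
  "pforms q = prod_list (map pform q)"

text \<open>The exponent obtained when, of two copies of every form, one supplies its first variable
  and the other its second: the middle coefficient of \<open>pforms (q @ q)\<close>.\<close>

definition expo :: "('t \<times> 't) list \<Rightarrow> nat \<Rightarrow>\<^sub>0 nat" where
  "expo q = sum_list (map (\<lambda>p. mono1 (s (fst p)) + mono1 (s (snd p))) q)"

lemma pforms_simps [simp]:
  "pforms [] = 1" "pforms (p # q) = pform p * pforms q" "pforms (q @ r) = pforms q * pforms r"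
  by (simp_all add: pforms_def)

lemma pforms_neq_0:
  assumes "\<And>p. p \<in> set q \<Longrightarrow> s (fst p) \<noteq> s (snd p)"
  shows "pforms q \<noteq> 0"
  using assms by (induction q) (auto simp: pform_def bform_neq_0)

text \<open>Multiplication by a form \<open>x\<^sub>a \<plusminus> x\<^sub>b\<close> followed by extraction of the coefficient at
  \<open>K + a + b\<close> is, up to sign, the adjoint of multiplication by that form. This is what makes the
  square of a product of such forms have a nonzero middle coefficient.\<close>

lemma lookup_mult_pforms:
  "\<exists>\<sigma>. (\<sigma> = 1 \<or> \<sigma> = -1) \<and> (\<forall>p K. Poly_Mapping.lookup (p * pforms q) (K + expo q) =
     \<sigma> * inner p (Poly_Mapping.single K 1 * pforms q))"
proof (induction q)
  case Nil
  have "Poly_Mapping.lookup p K = inner p (Poly_Mapping.single K 1)" for p :: "(nat \<Rightarrow>\<^sub>0 nat) \<Rightarrow>\<^sub>0 int" and K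
    by (subst inner_commute) (simp add: inner_def)
  then show ?case by (intro exI[of _ 1]) (simp add: expo_def)
next
  case (Cons ab q)
  obtain a b where ab: "ab = (a, b)" by (cases ab)
  from Cons obtain \<sigma> where \<sigma>: "\<sigma> = 1 \<or> \<sigma> = -1"
    "\<And>p K. Poly_Mapping.lookup (p * pforms q) (K + expo q) = \<sigma> * inner p (Poly_Mapping.single K 1 * pforms q)"
    by blast
  define \<eta> where "\<eta> = - (\<kappa> a * \<kappa> b)"
  have \<eta>: "\<eta> = 1 \<or> \<eta> = -1" using sgn[of a] sgn[of b] by (auto simp: \<eta>_def)
  let ?a = "mono1 (s a)" and ?b = "mono1 (s b)" and ?X = "\<lambda>K. Poly_Mapping.single K 1 :: (nat \<Rightarrow>\<^sub>0 nat) \<Rightarrow>\<^sub>0 int"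
  have "Poly_Mapping.lookup (p * pforms (ab # q)) (K + expo (ab # q)) =
    \<eta> * \<sigma> * inner p (?X K * pforms (ab # q))" for p K
  proof -
    let ?L = "K + (?a + ?b + expo q)"
    have "Poly_Mapping.lookup (p * pforms (ab # q)) (K + expo (ab # q)) =
      Poly_Mapping.lookup (bform (s a) (s b) \<eta> * (p * pforms q)) ?L"
      by (simp add: ab pform_def \<eta>_def expo_def mult_ac)
    \<comment> \<open>The target contains both variables of the form, so removing one leaves the
      other: the two coefficients appear exchanged. Since \<open>\<eta>\<close> is its own inverse,
      pulling it out restores the form.\<close>
    also have "\<dots> = Poly_Mapping.lookup (p * pforms q) (?L - ?a) + \<eta> * Poly_Mapping.lookup (p * pforms q) (?L - ?b)"
      unfolding lookup_bform_mult by (simp add: lookup_add)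
    also have "?L - ?a = (K + ?b) + expo q"
      by (rule poly_mapping_eqI) (simp add: lookup_add lookup_minus)
    also have "?L - ?b = (K + ?a) + expo q"
      by (rule poly_mapping_eqI) (simp add: lookup_add lookup_minus)
    also have "Poly_Mapping.lookup (p * pforms q) ((K + ?b) + expo q) +
        \<eta> * Poly_Mapping.lookup (p * pforms q) ((K + ?a) + expo q) =
      \<eta> * \<sigma> * (inner p (?X (K + ?a) * pforms q) + \<eta> * inner p (?X (K + ?b) * pforms q))"
      unfolding \<sigma>(2) using \<eta> by (auto simp: algebra_simps)
    also have "inner p (?X (K + ?a) * pforms q) + \<eta> * inner p (?X (K + ?b) * pforms q) =
      inner p (?X (K + ?a) * pforms q + Poly_Mapping.single 0 \<eta> * (?X (K + ?b) * pforms q))"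
      by (simp add: inner_add_right inner_scale_right)
    also have "?X (K + ?a) * pforms q + Poly_Mapping.single 0 \<eta> * (?X (K + ?b) * pforms q) =
      (?X K * bform (s a) (s b) \<eta>) * pforms q"
      unfolding mult.assoc[symmetric] bform_def by (simp add: mult_single algebra_simps)
    finally show ?thesis
      by (simp add: ab pform_def \<eta>_def mult.assoc)
  qed
  moreover have "\<eta> * \<sigma> = 1 \<or> \<eta> * \<sigma> = -1" using \<eta> \<sigma>(1) by auto
  ultimately show ?case by blast
qed

lemma lookup_square_pforms_neq_0:
  assumes "\<And>p. p \<in> set q \<Longrightarrow> s (fst p) \<noteq> s (snd p)"
  shows "Poly_Mapping.lookup (pforms (q @ q)) (expo q) \<noteq> 0"
proof -
  obtain \<sigma> where \<sigma>: "\<sigma> = 1 \<or> \<sigma> = -1" "\<And>p K. Poly_Mapping.lookup (p * pforms q) (K + expo q) =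
     \<sigma> * inner p (Poly_Mapping.single K 1 * pforms q)" using lookup_mult_pforms by blast
  show ?thesis
    using \<sigma>(1) \<sigma>(2)[of "pforms q" 0] inner_self_pos[OF pforms_neq_0[OF assms, of q]] by auto
qed

text \<open>One unsquared form \<open>x\<^sub>u \<plusminus> x\<^sub>v\<close> is harmless: by shift invariance of the inner product,
  \<open>2\<langle>(x\<^sub>u \<plusminus> x\<^sub>v) F, x\<^sub>u F\<rangle> = \<langle>(x\<^sub>u \<plusminus> x\<^sub>v) F, (x\<^sub>u \<plusminus> x\<^sub>v) F\<rangle>\<close>.\<close>

lemma lookup_form_square_pforms_neq_0:
  assumes "\<And>p. p \<in> set q \<Longrightarrow> s (fst p) \<noteq> s (snd p)" and "s u \<noteq> s v"
  shows "Poly_Mapping.lookup (pforms ((u, v) # q @ q)) (mono1 (s u) + expo q) \<noteq> 0"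
proof -
  obtain \<sigma> where \<sigma>: "\<sigma> = 1 \<or> \<sigma> = -1" "\<And>p K. Poly_Mapping.lookup (p * pforms q) (K + expo q) =
     \<sigma> * inner p (Poly_Mapping.single K 1 * pforms q)" using lookup_mult_pforms by blast
  define \<eta> where "\<eta> = - (\<kappa> u * \<kappa> v)"
  have \<eta>: "\<eta> = 1 \<or> \<eta> = -1" using sgn[of u] sgn[of v] by (auto simp: \<eta>_def)
  let ?X = "\<lambda>K. Poly_Mapping.single K 1 :: (nat \<Rightarrow>\<^sub>0 nat) \<Rightarrow>\<^sub>0 int"
  define A where "A = ?X (mono1 (s u)) * pforms q"
  define B where "B = ?X (mono1 (s v)) * pforms q"
  have G: "pform (u, v) * pforms q = A + Poly_Mapping.single 0 \<eta> * B"
    by (simp add: pform_def bform_def \<eta>_def A_def B_def distrib_right mult.assoc[symmetric] mult_single)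
  have AB: "inner A A = inner B B" by (simp add: A_def B_def inner_shift)
  have "pform (u, v) * pforms q \<noteq> 0"
    using pforms_neq_0[OF assms(1), of q] assms(2) by (simp add: pform_def bform_neq_0)
  then have "0 < inner (pform (u, v) * pforms q) (pform (u, v) * pforms q)"
    by (rule inner_self_pos)
  also have "\<dots> = 2 * inner (pform (u, v) * pforms q) A"
    unfolding G inner_add_left inner_add_right inner_scale_left inner_scale_right inner_commute[of A B]
    using AB \<eta> by auto
  finally have "inner (pform (u, v) * pforms q) A > 0" by simp
  then show ?thesis
    using \<sigma>(1) \<sigma>(2)[of "pform (u, v) * pforms q" "mono1 (s u)"] by (auto simp: A_def mult.assoc)
qed

lemma lookup_pforms_homogeneous:
  assumes "finite A" "\<And>p. p \<in> set q \<Longrightarrow> s (fst p) \<in> A \<and> s (snd p) \<in> A"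
    and "Poly_Mapping.lookup (pforms q) K \<noteq> 0"
  shows "(\<Sum>x\<in>A. Poly_Mapping.lookup K x) = length q"
  using assms(2,3)
proof (induction q arbitrary: K)
  case Nil
  then show ?case by (simp add: lookup_one when_def split: if_splits)
next
  case (Cons p q)
  have p: "s (fst p) \<in> A" "s (snd p) \<in> A" using Cons.prems(1)[of p] by auto
  from Cons.prems(2) have "\<exists>x\<in>{s (fst p), s (snd p)}. Poly_Mapping.lookup K x > 0 \<and>
      Poly_Mapping.lookup (pforms q) (K - mono1 x) \<noteq> 0"
    by (auto simp: pform_def lookup_bform_mult split: if_splits)
  then obtain x where x: "x \<in> A" "Poly_Mapping.lookup K x > 0" "Poly_Mapping.lookup (pforms q) (K - mono1 x) \<noteq> 0"
    using p by blast
  have "(\<Sum>y\<in>A. Poly_Mapping.lookup (K - mono1 x) y) = length q"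
    by (rule Cons.IH) (use Cons.prems x in auto)
  moreover have "Poly_Mapping.lookup K y = (if x = y then 1 else 0) + Poly_Mapping.lookup (K - mono1 x) y" for y
    using arg_cong[OF mono1_diff_add[OF x(2)], of "\<lambda>K. Poly_Mapping.lookup K y"]
    by (simp only: lookup_add lookup_mono1)
  ultimately show ?case using x(1) assms(1) by (simp add: sum.distrib)
qed

text \<open>The degree hypothesis says that \<open>pforms q\<close> uses up the whole part of the
  target in \<open>A\<close>. Hence \<open>r\<close> supplies exactly \<open>M\<close>, whatever
  variables it contains.\<close>

lemma lookup_pforms_mult_disjoint:
  assumes "finite A" "\<And>p. p \<in> set q \<Longrightarrow> s (fst p) \<in> A \<and> s (snd p) \<in> A"
    and "(\<Sum>x\<in>A. Poly_Mapping.lookup K x) = length q" "Poly_Mapping.keys K \<subseteq> A"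
    and "Poly_Mapping.keys M \<inter> A = {}"
  shows "Poly_Mapping.lookup (pforms q * r) (K + M) = Poly_Mapping.lookup (pforms q) K * Poly_Mapping.lookup r M"
  using assms(2,3,4)
proof (induction q arbitrary: K)
  case Nil
  then have "K = 0" using assms(1) by (intro poly_mapping_eqI) (auto simp: in_keys_iff)
  then show ?case by simp
next
  case (Cons p q)
  have step: "(if Poly_Mapping.lookup (K + M) x > 0 then Poly_Mapping.lookup (pforms q * r) (K + M - mono1 x) else 0) =
    (if Poly_Mapping.lookup K x > 0 then Poly_Mapping.lookup (pforms q) (K - mono1 x) else 0) * Poly_Mapping.lookup r M"
    if x: "x \<in> A" for x
  proof -
    have Mx: "Poly_Mapping.lookup M x = 0" using x assms(5) by (auto simp: in_keys_iff)
    show ?thesis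
    proof (cases "Poly_Mapping.lookup K x > 0")
      case True
      have *: "K + M - mono1 x = (K - mono1 x) + M"
        by (rule poly_mapping_eqI) (use True in \<open>auto simp: lookup_add lookup_minus\<close>)
      have "Poly_Mapping.lookup K y = (if x = y then 1 else 0) + Poly_Mapping.lookup (K - mono1 x) y" for y
        using arg_cong[OF mono1_diff_add[OF True], of "\<lambda>K. Poly_Mapping.lookup K y"]
        by (simp only: lookup_add lookup_mono1)
      then have "(\<Sum>y\<in>A. Poly_Mapping.lookup (K - mono1 x) y) = length q"
        using Cons.prems(2) x assms(1) by (simp add: sum.distrib)
      moreover have "Poly_Mapping.keys (K - mono1 x) \<subseteq> A"
        using Cons.prems(3) by (auto simp: in_keys_iff lookup_minus)
      ultimately have "Poly_Mapping.lookup (pforms q * r) ((K - mono1 x) + M) =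
          Poly_Mapping.lookup (pforms q) (K - mono1 x) * Poly_Mapping.lookup r M"
        using Cons.prems(1) by (intro Cons.IH) auto
      then show ?thesis using True Mx by (simp add: * lookup_add)
    next
      case False
      then show ?thesis using Mx by (simp add: lookup_add)
    qed
  qed
  have p: "s (fst p) \<in> A" "s (snd p) \<in> A" using Cons.prems(1) by auto
  show ?case
    by (simp only: pforms_simps mult.assoc pform_def lookup_bform_mult step[OF p(1)] step[OF p(2)])
      (simp add: algebra_simps)
qed

section \<open>Lists of pairs with prescribed multiplicities\<close>

definition occ :: "('t \<times> 't) list \<Rightarrow> 't \<Rightarrow> nat" where
  "occ q t = length (filter (\<lambda>p. fst p = t \<or> snd p = t) q)"

lemma occ_simps [simp]:
  "occ [] t = 0" "occ (p # q) t = (if fst p = t \<or> snd p = t then 1 else 0) + occ q t"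
  "occ (q @ r) t = occ q t + occ r t"
  by (simp_all add: occ_def)

lemma occ_eq_0: "(\<And>p. p \<in> set q \<Longrightarrow> fst p \<noteq> t \<and> snd p \<noteq> t) \<Longrightarrow> occ q t = 0"
  by (induction q) auto

lemma lookup_expo:
  assumes "finite Tok" "\<And>p. p \<in> set q \<Longrightarrow> fst p \<in> Tok \<and> snd p \<in> Tok \<and> fst p \<noteq> snd p"
  shows "Poly_Mapping.lookup (expo q) x = (\<Sum>t\<in>{t\<in>Tok. s t = x}. occ q t)"
  using assms(2)
proof (induction q)
  case Nil
  then show ?case by (simp add: expo_def)
next
  case (Cons p q)
  obtain a b where p: "p = (a, b)" by (cases p)
  have ab: "a \<in> Tok" "b \<in> Tok" "a \<noteq> b" using Cons.prems[of p] by (auto simp: p)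
  have "(\<Sum>t\<in>{t\<in>Tok. s t = x}. occ (p # q) t) =
    (\<Sum>t\<in>{t\<in>Tok. s t = x}. (if t = a then 1 else 0) + (if t = b then 1 else 0) + occ q t)"
    using ab by (intro sum.cong refl) (auto simp: p)
  also have "\<dots> = (if s a = x then 1 else 0) + (if s b = x then 1 else 0) + (\<Sum>t\<in>{t\<in>Tok. s t = x}. occ q t)"
    using ab assms(1) by (simp add: sum.distrib)
  finally show ?case using Cons by (simp add: expo_def p lookup_add)
qed

end

lemma (in token_forms) pair_up:
  assumes "finite A" "even (card A)"
  shows "\<exists>q. (\<forall>p\<in>set q. fst p \<in> A \<and> snd p \<in> A \<and> fst p \<noteq> snd p) \<and>
    (\<forall>t. occ q t = (if t \<in> A then 1 else 0))"
  using assms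
proof (induction "card A" arbitrary: A rule: less_induct)
  case less
  show ?case
  proof (cases "A = {}")
    case True
    then show ?thesis by (intro exI[of _ "[]"]) simp
  next
    case False
    then obtain a where a: "a \<in> A" by auto
    have "A \<noteq> {a}" using less.prems(2) by auto
    then obtain b where b: "b \<in> A" "b \<noteq> a" using a by auto
    have c: "card (A - {a, b}) = card A - 2" "card A \<ge> 2"
    proof -
      have "card {a, b} \<le> card A" using a b less.prems by (intro card_mono) auto
      then show "card A \<ge> 2" using b by simp
      show "card (A - {a, b}) = card A - 2"
        using a b less.prems(1) by (subst card_Diff_subset) auto
    qed
    with less.hyps[of "A - {a, b}"] less.prems obtain q where q:
      "\<forall>p\<in>set q. fst p \<in> A - {a, b} \<and> snd p \<in> A - {a, b} \<and> fst p \<noteq> snd p"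
      "\<forall>t. occ q t = (if t \<in> A - {a, b} then 1 else 0)"
      by auto
    show ?thesis
      using q a b by (intro exI[of _ "(a, b) # q"]) auto
  qed
qed

text \<open>A loopless multigraph on \<open>N\<close> with degrees \<open>\<mu>\<close>. The values
  0 and 2 must not be mixed: on two tokens they would force a token to be paired with itself. This
  is the reason for demanding uniform signs at each centre in the parity correction.\<close>

lemma (in token_forms) pair_multiplicities:
  assumes fin: "finite N" and card: "card N \<ge> 2"
    and mu: "(\<forall>t\<in>N. \<mu> t \<in> {0, 1}) \<or> (\<forall>t\<in>N. \<mu> t \<in> {1, 2})" and ev: "even (\<Sum>t\<in>N. \<mu> t :: nat)"
  shows "\<exists>q. (\<forall>p\<in>set q. fst p \<in> N \<and> snd p \<in> N \<and> fst p \<noteq> snd p) \<and> (\<forall>t\<in>N. occ q t = \<mu> t)"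
  using mu
proof
  assume mu: "\<forall>t\<in>N. \<mu> t \<in> {0, 1}"
  define A where "A = {t\<in>N. \<mu> t = 1}"
  have "(\<Sum>t\<in>N. \<mu> t) = (\<Sum>t\<in>N. if \<mu> t = 1 then 1 else 0)"
    using mu by (intro sum.cong) auto
  also have "\<dots> = card A" using fin by (simp add: A_def sum.If_cases Int_def)
  finally have "even (card A)" using ev by simp
  with pair_up[of A] fin obtain q where q: "\<forall>p\<in>set q. fst p \<in> A \<and> snd p \<in> A \<and> fst p \<noteq> snd p"
    "\<forall>t. occ q t = (if t \<in> A then 1 else 0)" by (auto simp: A_def)
  then show ?thesis using mu by (intro exI[of _ q]) (auto simp: A_def)
next
  assume mu: "\<forall>t\<in>N. \<mu> t \<in> {1, 2}"
  define A where "A = {t\<in>N. \<mu> t = 2}"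
  have fA: "finite A" "A \<subseteq> N" using fin by (auto simp: A_def)
  have muA: "\<mu> t = (if t \<in> A then 2 else 1)" if "t \<in> N" for t
    using mu that by (auto simp: A_def)
  have "(\<Sum>t\<in>N. \<mu> t) = (\<Sum>t\<in>N. 1 + (if \<mu> t = 2 then 1 else 0))"
    using mu by (intro sum.cong) auto
  also have "\<dots> = (\<Sum>t\<in>N. 1) + (\<Sum>t\<in>N. if \<mu> t = 2 then 1 else 0)" by (rule sum.distrib)
  also have "\<dots> = card N + card A" using fin by (simp add: A_def sum.If_cases Int_def)
  finally have par: "even (card N + card A)" using ev by simp
  show ?thesis
  proof (cases "even (card N)")
    case True
    with par have "even (card A)" by simp
    from pair_up[OF fA(1) this] obtain q where q: "\<forall>p\<in>set q. fst p \<in> A \<and> snd p \<in> A \<and> fst p \<noteq> snd p"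
      "\<forall>t. occ q t = (if t \<in> A then 1 else 0)" by auto
    from pair_up[OF fin True] obtain r where r: "\<forall>p\<in>set r. fst p \<in> N \<and> snd p \<in> N \<and> fst p \<noteq> snd p"
      "\<forall>t. occ r t = (if t \<in> N then 1 else 0)" by auto
    show ?thesis using q r muA fA(2) by (intro exI[of _ "q @ r"]) auto
  next
    case False
    \<comment> \<open>A path with middle vertex \<open>x\<close> of degree two and ends
      \<open>y\<close>, \<open>z\<close> of degree one absorbs both odd parities; matchings of
      \<open>N - {x, y, z}\<close> and of \<open>A - {x}\<close> do the rest.\<close>
    with par have odd: "odd (card A)" by simp
    then have "A \<noteq> {}" by auto
    then obtain x where x: "x \<in> A" by auto
    have N3: "card N \<ge> 3" using card False by presburger
    then have "card (N - {x}) \<ge> 2" using x fA fin by (simp add: subset_iff)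
    then obtain B where "B \<subseteq> N - {x}" "card B = 2" by (rule obtain_subset_with_card_n)
    then obtain y z where yz: "y \<in> N - {x}" "z \<in> N - {x}" "y \<noteq> z"
      by (auto simp: card_2_iff)
    have "card (N - {x, y, z}) = card N - 3"
      using x yz fin fA by (subst card_Diff_subset) (auto simp: card_insert_if)
    with N3 False have "even (card (N - {x, y, z}))" by simp
    from pair_up[OF _ this] fin obtain r where r:
      "\<forall>p\<in>set r. fst p \<in> N - {x, y, z} \<and> snd p \<in> N - {x, y, z} \<and> fst p \<noteq> snd p"
      "\<forall>t. occ r t = (if t \<in> N - {x, y, z} then 1 else 0)" by auto
    have "even (card (A - {x}))" using odd x fA(1) by simp
    from pair_up[OF _ this] fA obtain q where q: "\<forall>p\<in>set q. fst p \<in> A - {x} \<and> snd p \<in> A - {x} \<and> fst p \<noteq> snd p"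
      "\<forall>t. occ q t = (if t \<in> A - {x} then 1 else 0)" by auto
    show ?thesis
      using q r muA fA(2) x yz by (intro exI[of _ "(x, y) # (x, z) # q @ r"]) auto
  qed
qed

section \<open>Parity correction\<close>

text \<open>Centres are adjacent if they have tokens with a common value of \<open>s\<close>. A
  connected set is grown centre by centre from \<open>c0\<close>, so that parities can be repaired
  from the newest centre back to the root.\<close>

inductive connected_centres :: "'t set \<Rightarrow> ('t \<Rightarrow> nat) \<Rightarrow> ('t \<Rightarrow> 'c) \<Rightarrow> 'c \<Rightarrow> 'c set \<Rightarrow> bool"
  for Tok s c c0 where
  connected_centres_root: "connected_centres Tok s c c0 {c0}"
| connected_centres_insert: "connected_centres Tok s c c0 C \<Longrightarrow> t \<in> Tok \<Longrightarrow> t' \<in> Tok \<Longrightarrow> s t = s t' \<Longrightarrow> c t' \<in> C \<Longrightarrow> c t \<notin> C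
    \<Longrightarrow> connected_centres Tok s c c0 (insert (c t) C)"

lemma connected_centres_subset: "connected_centres Tok s c c0 C \<Longrightarrow> c0 \<in> C \<and> C \<subseteq> insert c0 (c ` Tok)"
  by (induction rule: connected_centres.induct) auto

text \<open>\<open>1 + \<epsilon> t\<close> will be the multiplicity with which the token \<open>t\<close> is used. Attaching a new centre by a
  shared value of \<open>s\<close> moves one unit between the new centre and an old one; the direction of the
  move is chosen so that the signs at the old centre stay uniform.\<close>

lemma connected_centres_parity:
  assumes "connected_centres Tok s c c0 C" "finite Tok"
  shows "\<exists>\<epsilon> :: 't \<Rightarrow> int. (\<forall>t. \<epsilon> t \<in> {-1, 0, 1}) \<and> (\<forall>t. c t \<notin> C \<longrightarrow> \<epsilon> t = 0) \<and>
    (\<forall>x. (\<Sum>t\<in>{t\<in>Tok. s t = x}. \<epsilon> t) = 0) \<and>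
    (\<forall>d. (\<forall>t. c t = d \<longrightarrow> \<epsilon> t \<ge> 0) \<or> (\<forall>t. c t = d \<longrightarrow> \<epsilon> t \<le> 0)) \<and>
    (\<forall>d\<in>C - {c0}. even (\<Sum>t\<in>{t\<in>Tok. c t = d}. \<epsilon> t) = pr d)"
  using assms(1)
proof (induction arbitrary: pr rule: connected_centres.induct)
  case connected_centres_root
  show ?case by (intro exI[of _ "\<lambda>_. 0"]) auto
next
  case (connected_centres_insert C t t')
  show ?case
  proof (cases "pr (c t)")
    case True
    obtain \<epsilon> :: "'t \<Rightarrow> int" where \<epsilon>: "\<forall>t. \<epsilon> t \<in> {-1, 0, 1}" "\<forall>t. c t \<notin> C \<longrightarrow> \<epsilon> t = 0"
      "\<forall>x. (\<Sum>t\<in>{t\<in>Tok. s t = x}. \<epsilon> t) = 0"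
      "\<forall>d. (\<forall>t. c t = d \<longrightarrow> \<epsilon> t \<ge> 0) \<or> (\<forall>t. c t = d \<longrightarrow> \<epsilon> t \<le> 0)"
      "\<forall>d\<in>C - {c0}. even (\<Sum>t\<in>{t\<in>Tok. c t = d}. \<epsilon> t) = pr d"
      using connected_centres_insert.IH[of pr] by (elim exE conjE) (rule that)
    have "(\<Sum>u\<in>{u\<in>Tok. c u = c t}. \<epsilon> u) = 0"
      using \<epsilon>(2) connected_centres_insert.hyps by (intro sum.neutral) auto
    then have "\<forall>d\<in>insert (c t) C - {c0}. even (\<Sum>u\<in>{u\<in>Tok. c u = d}. \<epsilon> u) = pr d"
      using \<epsilon>(5) True by fastforce
    moreover have "\<forall>u. c u \<notin> insert (c t) C \<longrightarrow> \<epsilon> u = 0" using \<epsilon>(2) by simp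
    ultimately show ?thesis using \<epsilon>(1,3,4) by (intro exI[of _ \<epsilon>] conjI)
  next
    case False
    \<comment> \<open>The unit moved below changes the parity at the old centre \<open>c t'\<close>;
      the induction hypothesis is therefore asked for the opposite parity there.\<close>
    obtain \<epsilon> :: "'t \<Rightarrow> int" where \<epsilon>: "\<forall>t. \<epsilon> t \<in> {-1, 0, 1}" "\<forall>t. c t \<notin> C \<longrightarrow> \<epsilon> t = 0"
      "\<forall>x. (\<Sum>t\<in>{t\<in>Tok. s t = x}. \<epsilon> t) = 0"
      "\<forall>d. (\<forall>t. c t = d \<longrightarrow> \<epsilon> t \<ge> 0) \<or> (\<forall>t. c t = d \<longrightarrow> \<epsilon> t \<le> 0)"
      "\<forall>d\<in>C - {c0}. even (\<Sum>t\<in>{t\<in>Tok. c t = d}. \<epsilon> t) = (pr(c t' := \<not> pr (c t'))) d"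
      using connected_centres_insert.IH[of "pr(c t' := \<not> pr (c t'))"] by (elim exE conjE) (rule that)
    \<comment> \<open>A nonzero value at \<open>t'\<close> is cancelled, never increased, so that
      all values stay in -1, 0, 1.\<close>
    define \<delta> where "\<delta> = (if \<epsilon> t' \<noteq> 0 then - \<epsilon> t' else if (\<forall>u. c u = c t' \<longrightarrow> \<epsilon> u \<ge> 0) then 1 else - 1)"
    define \<epsilon>' where "\<epsilon>' u = \<epsilon> u + ((if u = t' then \<delta> else 0) - (if u = t then \<delta> else 0))" for u
    have ne: "t \<noteq> t'" "c t \<noteq> c t'" using connected_centres_insert.hyps by auto
    have t0: "\<epsilon> t = 0" using \<epsilon>(2) connected_centres_insert.hyps by simp
    have d1: "\<delta> = 1 \<or> \<delta> = -1" using \<epsilon>(1)[rule_format, of t'] by (auto simp: \<delta>_def)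
    have dt: "\<epsilon>' t' \<in> {-1,0,1}" "\<epsilon>' t = -\<delta>"
    proof -
      have "\<epsilon>' t' = \<epsilon> t' + \<delta>" using ne by (simp add: \<epsilon>'_def)
      then show "\<epsilon>' t' \<in> {-1,0,1}" by (simp add: \<delta>_def)
      show "\<epsilon>' t = -\<delta>" using ne t0 by (simp add: \<epsilon>'_def)
    qed
    have sums: "(\<Sum>u\<in>A. \<epsilon>' u) = (\<Sum>u\<in>A. \<epsilon> u) + ((if t' \<in> A then \<delta> else 0) - (if t \<in> A then \<delta> else 0))" if "finite A" for A
      using that by (simp add: \<epsilon>'_def sum.distrib sum_subtractf)
    have r1: "\<forall>u. \<epsilon>' u \<in> {-1,0,1}"
    proof
      fix u
      have "\<epsilon>' u = \<epsilon> u" if "u \<noteq> t" "u \<noteq> t'" using that by (simp add: \<epsilon>'_def)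
      then show "\<epsilon>' u \<in> {-1,0,1}"
        using \<epsilon>(1)[rule_format, of u] dt d1 by (cases "u = t"; cases "u = t'") auto
    qed
    have r2: "\<epsilon>' u = 0" if "c u \<notin> insert (c t) C" for u
    proof -
      have "u \<noteq> t" "u \<noteq> t'" "\<epsilon> u = 0" using that connected_centres_insert.hyps \<epsilon>(2) by auto
      then show ?thesis by (simp add: \<epsilon>'_def)
    qed
    have r3: "(\<Sum>u\<in>{u\<in>Tok. s u = x}. \<epsilon>' u) = 0" for x
      using \<epsilon>(3) connected_centres_insert.hyps assms(2) by (simp add: sums)
    have r4: "(\<forall>u. c u = d \<longrightarrow> \<epsilon>' u \<ge> 0) \<or> (\<forall>u. c u = d \<longrightarrow> \<epsilon>' u \<le> 0)" for d
    proof -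
      consider "d = c t" | "d = c t'" | "d \<noteq> c t" "d \<noteq> c t'" by blast
      then show ?thesis
      proof cases
        case 1
        have "\<epsilon>' u = 0" if "c u = d" "u \<noteq> t" for u
        proof -
          have "u \<noteq> t'" "\<epsilon> u = 0" using that 1 ne connected_centres_insert.hyps \<epsilon>(2) by auto
          then show ?thesis using that by (simp add: \<epsilon>'_def)
        qed
        then have *: "\<epsilon>' u = (if u = t then \<epsilon>' t else 0)" if "c u = d" for u
          using that by auto
        show ?thesis
        proof (cases "\<epsilon>' t \<ge> 0")
          case True
          then have "\<epsilon>' u \<ge> 0" if "c u = d" for u using *[OF that] by (simp split: if_splits)
          then show ?thesis by blast
        next
          case False
          then have "\<epsilon>' u \<le> 0" if "c u = d" for u using *[OF that] by (simp split: if_splits)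
          then show ?thesis by blast
        qed
      next
        case 2
        have o: "\<epsilon>' u = \<epsilon> u" if "c u = d" "u \<noteq> t'" for u
          using that 2 ne by (auto simp: \<epsilon>'_def)
        have n: "\<epsilon>' t' = \<epsilon> t' + \<delta>" using ne by (simp add: \<epsilon>'_def)
        show ?thesis
        proof (cases "\<epsilon> t' = 0")
          case True
          show ?thesis
          proof (cases "\<forall>u. c u = c t' \<longrightarrow> \<epsilon> u \<ge> 0")
            case True': True
            then have "\<delta> = 1" using True by (simp add: \<delta>_def)
            then have "\<epsilon>' u \<ge> 0" if "c u = d" for u
              using True' True o[of u] n 2 that by (cases "u = t'") auto
            then show ?thesis by blast
          next
            case False
            then have "\<delta> = -1" using True by (simp add: \<delta>_def)
            moreover have "\<forall>u. c u = c t' \<longrightarrow> \<epsilon> u \<le> 0" using False \<epsilon>(4) by blast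
            ultimately have "\<epsilon>' u \<le> 0" if "c u = d" for u
              using True o[of u] n 2 that by (cases "u = t'") auto
            then show ?thesis by blast
          qed
        next
          case False
          then have "\<epsilon>' t' = 0" using n by (simp add: \<delta>_def)
          then have *: "\<epsilon>' u = (if u = t' then 0 else \<epsilon> u)" if "c u = d" for u
            using o[of u] that by auto
          from \<epsilon>(4)[rule_format, of d] show ?thesis
          proof
            assume "\<forall>u. c u = d \<longrightarrow> 0 \<le> \<epsilon> u"
            then have "\<epsilon>' u \<ge> 0" if "c u = d" for u using *[OF that] that by simp
            then show ?thesis by blast
          next
            assume "\<forall>u. c u = d \<longrightarrow> \<epsilon> u \<le> 0"
            then have "\<epsilon>' u \<le> 0" if "c u = d" for u using *[OF that] that by simp
            then show ?thesis by blast
          qed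
        qed
      next
        case 3
        then have "\<epsilon>' u = \<epsilon> u" if "c u = d" for u using that by (auto simp: \<epsilon>'_def)
        then show ?thesis using \<epsilon>(4)[rule_format, of d] by simp
      qed
    qed
    have r5: "even (\<Sum>u\<in>{u\<in>Tok. c u = d}. \<epsilon>' u) = pr d" if d: "d \<in> insert (c t) C - {c0}" for d
    proof -
      have S: "(\<Sum>u\<in>{u\<in>Tok. c u = d}. \<epsilon>' u) = (\<Sum>u\<in>{u\<in>Tok. c u = d}. \<epsilon> u) +
          ((if c t' = d then \<delta> else 0) - (if c t = d then \<delta> else 0))"
        using connected_centres_insert.hyps assms(2) by (simp add: sums)
      have od: "odd \<delta>" using d1 by auto
      consider "d = c t" | "d = c t'" | "d \<noteq> c t" "d \<noteq> c t'" by blast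
      then show ?thesis
      proof cases
        case 1
        have "(\<Sum>u\<in>{u\<in>Tok. c u = d}. \<epsilon> u) = 0"
          using \<epsilon>(2) 1 connected_centres_insert.hyps by (intro sum.neutral) auto
        then show ?thesis using S 1 ne od False by auto
      next
        case 2
        then have "even (\<Sum>u\<in>{u\<in>Tok. c u = d}. \<epsilon> u) = (\<not> pr d)"
          using \<epsilon>(5)[rule_format, of d] d connected_centres_insert.hyps by auto
        then show ?thesis using S 2 ne od by auto
      next
        case 3
        then show ?thesis using S \<epsilon>(5)[rule_format, of d] d by auto
      qed
    qed
    from r2 have r2': "\<forall>u. c u \<notin> insert (c t) C \<longrightarrow> \<epsilon>' u = 0" by blast
    show ?thesis
      by (intro exI[of _ \<epsilon>'] conjI r1 r2' allI r3 r4 ballI r5)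
  qed
qed

text \<open>A connected set of maximal size cannot be extended, so it is a full component.\<close>

lemma connected_centres_closed:
  assumes "finite Tok"
  shows "\<exists>C. connected_centres Tok s c c0 C \<and> (\<forall>t\<in>Tok. \<forall>t'\<in>Tok. s t = s t' \<longrightarrow> c t' \<in> C \<longrightarrow> c t \<in> C)"
proof -
  have bound: "card C \<le> card (insert c0 (c ` Tok))" if "connected_centres Tok s c c0 C" for C
    using connected_centres_subset[OF that] assms by (intro card_mono) auto
  obtain C where C: "connected_centres Tok s c c0 C" "\<And>D. connected_centres Tok s c c0 D \<Longrightarrow> card D \<le> card C"
    using ex_has_greatest_nat[of "connected_centres Tok s c c0" "{c0}" card "Suc (card (insert c0 (c ` Tok)))"]
      connected_centres_root[of Tok s c c0] bound by (metis le_imp_less_Suc)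
  have fC: "finite C" using connected_centres_subset[OF C(1)] assms by (auto intro: finite_subset)
  have "c t \<in> C" if "t \<in> Tok" "t' \<in> Tok" "s t = s t'" "c t' \<in> C" for t t'
  proof (rule ccontr)
    assume "c t \<notin> C"
    from C(2)[OF connected_centres_insert[OF C(1) that this]] this fC show False by simp
  qed
  with C(1) show ?thesis by blast
qed

context token_forms
begin

lemma pair_all_centres:
  assumes "finite D" "\<And>d. d \<in> D \<Longrightarrow> \<exists>q. (\<forall>p\<in>set q. fst p \<in> Tok \<and> snd p \<in> Tok \<and> c (fst p) = d \<and> c (snd p) = d \<and> fst p \<noteq> snd p)
      \<and> (\<forall>t\<in>Tok. c t = d \<longrightarrow> occ q t = \<mu> t)"
  shows "\<exists>q. (\<forall>p\<in>set q. fst p \<in> Tok \<and> snd p \<in> Tok \<and> c (fst p) \<in> D \<and> c (fst p) = c (snd p) \<and> fst p \<noteq> snd p)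
      \<and> (\<forall>t\<in>Tok. c t \<in> D \<longrightarrow> occ q t = \<mu> t)"
  using assms
proof (induction D rule: finite_induct)
  case empty
  show ?case by (intro exI[of _ "[]"]) simp
next
  case (insert d D)
  then obtain q where q: "\<forall>p\<in>set q. fst p \<in> Tok \<and> snd p \<in> Tok \<and> c (fst p) \<in> D \<and> c (fst p) = c (snd p) \<and> fst p \<noteq> snd p"
    "\<forall>t\<in>Tok. c t \<in> D \<longrightarrow> occ q t = \<mu> t" by auto
  obtain r where r: "\<forall>p\<in>set r. fst p \<in> Tok \<and> snd p \<in> Tok \<and> c (fst p) = d \<and> c (snd p) = d \<and> fst p \<noteq> snd p"
    "\<forall>t\<in>Tok. c t = d \<longrightarrow> occ r t = \<mu> t" using insert.prems[of d] by auto
  have "occ (q @ r) t = \<mu> t" if t: "t \<in> Tok" "c t \<in> insert d D" for t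
  proof (cases "c t = d")
    case True
    then have "occ q t = 0" using q(1) insert.hyps by (intro occ_eq_0) auto
    then show ?thesis using r(2) t True by simp
  next
    case False
    then have "occ r t = 0" using r(1) by (intro occ_eq_0) auto
    then show ?thesis using q(2) t False by simp
  qed
  then show ?case using q(1) r(1) by (intro exI[of _ "q @ r"]) auto
qed

text \<open>The multiplicities \<open>1 + \<epsilon> t\<close> have the same total as the tokens
  over each value of \<open>s\<close>, so a pairing with these multiplicities has the target as its
  middle exponent. Only the parity at the root is not controlled. If it is odd, one token
  \<open>u\<close> is taken out there and its variable is supplied by one unsquared form.\<close>

lemma token_pairs_connected:
  assumes fin: "finite Tok" and connected_centres: "connected_centres Tok s c c0 (c ` Tok)"
    and inj: "\<And>t t'. t \<in> Tok \<Longrightarrow> t' \<in> Tok \<Longrightarrow> c t = c t' \<Longrightarrow> s t = s t' \<Longrightarrow> t = t'"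
    and two: "\<And>t. t \<in> Tok \<Longrightarrow> \<exists>t'\<in>Tok. c t' = c t \<and> t' \<noteq> t"
  shows "\<exists>ps. (\<forall>p\<in>set ps. fst p \<in> Tok \<and> snd p \<in> Tok \<and> c (fst p) = c (snd p) \<and> fst p \<noteq> snd p) \<and>
    (\<forall>t. occ ps t \<le> 4) \<and> Poly_Mapping.lookup (pforms ps) (\<Sum>t\<in>Tok. mono1 (s t)) \<noteq> 0"
proof -
  define N where "N d = {t\<in>Tok. c t = d}" for d
  have finN: "finite (N d)" for d using fin by (simp add: N_def)
  have cardN: "card (N d) \<ge> 2" if "d \<in> c ` Tok" for d
  proof -
    from that obtain t where t: "t \<in> Tok" "d = c t" by auto
    from two[OF t(1)] obtain t' where t': "t' \<in> Tok" "c t' = c t" "t' \<noteq> t" by auto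
    have "card {t, t'} \<le> card (N d)" using t t' finN by (intro card_mono) (auto simp: N_def)
    then show ?thesis using t'(3) by simp
  qed
  obtain \<epsilon>0 :: "'t \<Rightarrow> int" where \<epsilon>0: "\<forall>t. \<epsilon>0 t \<in> {-1, 0, 1}"
    "\<forall>x. (\<Sum>t\<in>{t\<in>Tok. s t = x}. \<epsilon>0 t) = 0"
    "\<forall>d. (\<forall>t. c t = d \<longrightarrow> \<epsilon>0 t \<ge> 0) \<or> (\<forall>t. c t = d \<longrightarrow> \<epsilon>0 t \<le> 0)"
    "\<forall>d\<in>c ` Tok - {c0}. even (\<Sum>t\<in>{t\<in>Tok. c t = d}. \<epsilon>0 t) = even (card (N d))"
    using connected_centres_parity[OF connected_centres fin, of "\<lambda>d. even (card (N d))"] by (elim exE conjE) (rule that)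
  \<comment> \<open>A global change of sign makes the multiplicities at the root at most one.
    Squaring and the additional form then use a token of the root at most three times; with
    multiplicity two this could be five.\<close>
  define \<epsilon> where "\<epsilon> = (if \<forall>t. c t = c0 \<longrightarrow> \<epsilon>0 t \<le> 0 then \<epsilon>0 else (\<lambda>t. - \<epsilon>0 t))"
  have \<epsilon>cases: "\<epsilon> = \<epsilon>0 \<or> \<epsilon> = (\<lambda>t. - \<epsilon>0 t)" by (simp add: \<epsilon>_def)
  have e1: "\<epsilon> t \<in> {-1, 0, 1}" for t using \<epsilon>cases \<epsilon>0(1)[rule_format, of t] by auto
  have e2: "(\<Sum>t\<in>{t\<in>Tok. s t = x}. \<epsilon> t) = 0" for x
    using \<epsilon>cases \<epsilon>0(2)[rule_format, of x] by (auto simp: sum_negf)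
  have e3: "(\<forall>t. c t = d \<longrightarrow> \<epsilon> t \<ge> 0) \<or> (\<forall>t. c t = d \<longrightarrow> \<epsilon> t \<le> 0)" for d
    using \<epsilon>cases \<epsilon>0(3)[rule_format, of d] by auto
  have e4: "even (\<Sum>t\<in>N d. \<epsilon> t) = even (card (N d))" if "d \<in> c ` Tok" "d \<noteq> c0" for d
    using \<epsilon>cases \<epsilon>0(4)[rule_format, of d] that by (auto simp: N_def sum_negf)
  have e5: "\<epsilon> t \<le> 0" if "c t = c0" for t
    using \<epsilon>0(3)[rule_format, of c0] that by (auto simp: \<epsilon>_def)
  define \<mu> where "\<mu> t = nat (1 + \<epsilon> t)" for t
  have \<mu>: "int (\<mu> t) = 1 + \<epsilon> t" for t using e1[of t] by (auto simp: \<mu>_def)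
  have m2: "\<mu> t \<le> 2" for t using e1[of t] by (auto simp: \<mu>_def)
  have m0: "\<mu> t \<le> 1" if "c t = c0" for t using e5[OF that] by (auto simp: \<mu>_def)
  have m3: "(\<forall>t\<in>N d. \<mu> t \<in> {0, 1}) \<or> (\<forall>t\<in>N d. \<mu> t \<in> {1, 2})" for d
    using e3[of d]
  proof
    assume a: "\<forall>t. c t = d \<longrightarrow> \<epsilon> t \<ge> 0"
    have "\<mu> t \<in> {1, 2}" if "c t = d" for t using a[rule_format, OF that] e1[of t] by (auto simp: \<mu>_def)
    then show ?thesis by (auto simp: N_def)
  next
    assume a: "\<forall>t. c t = d \<longrightarrow> \<epsilon> t \<le> 0"
    have "\<mu> t \<in> {0, 1}" if "c t = d" for t using a[rule_format, OF that] e1[of t] by (auto simp: \<mu>_def)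
    then show ?thesis by (auto simp: N_def)
  qed
  have m4: "even (\<Sum>t\<in>N d. \<mu> t)" if "d \<in> c ` Tok" "d \<noteq> c0" for d
  proof -
    have "int (\<Sum>t\<in>N d. \<mu> t) = int (card (N d)) + (\<Sum>t\<in>N d. \<epsilon> t)"
      by (simp add: \<mu> sum.distrib)
    moreover have "even (int (card (N d)) + (\<Sum>t\<in>N d. \<epsilon> t))" using e4[OF that] by auto
    ultimately show ?thesis by (metis even_of_nat_iff)
  qed
  have m5: "(\<Sum>t\<in>{t\<in>Tok. s t = x}. \<mu> t) = card {t\<in>Tok. s t = x}" for x
  proof -
    have "int (\<Sum>t\<in>{t\<in>Tok. s t = x}. \<mu> t) = int (card {t\<in>Tok. s t = x})"
      using e2[of x] by (simp add: \<mu> sum.distrib)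
    then show ?thesis by (simp only: of_nat_eq_iff)
  qed
  have target: "Poly_Mapping.lookup (\<Sum>t\<in>Tok. mono1 (s t)) x = card {t\<in>Tok. s t = x}" for x
    using fin by (simp add: lookup_sum sum.If_cases Int_def)
  have pairs: "\<exists>q. (\<forall>p\<in>set q. fst p \<in> Tok \<and> snd p \<in> Tok \<and> c (fst p) = c (snd p) \<and> fst p \<noteq> snd p)
      \<and> (\<forall>t\<in>Tok. occ q t = \<mu>' t)"
    if "\<And>d. d \<in> c ` Tok \<Longrightarrow> (\<forall>t\<in>N d. \<mu>' t \<in> {0, 1}) \<or> (\<forall>t\<in>N d. \<mu>' t \<in> {1, 2})"
      "\<And>d. d \<in> c ` Tok \<Longrightarrow> even (\<Sum>t\<in>N d. \<mu>' t)" for \<mu>' :: "'t \<Rightarrow> nat"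
  proof -
    have "\<exists>q. (\<forall>p\<in>set q. fst p \<in> Tok \<and> snd p \<in> Tok \<and> c (fst p) = d \<and> c (snd p) = d \<and> fst p \<noteq> snd p)
      \<and> (\<forall>t\<in>Tok. c t = d \<longrightarrow> occ q t = \<mu>' t)" if d: "d \<in> c ` Tok" for d
      using pair_multiplicities[OF finN cardN[OF d], of \<mu>'] \<open>d \<in> c ` Tok\<close> that
        \<open>\<And>d. d \<in> c ` Tok \<Longrightarrow> (\<forall>t\<in>N d. \<mu>' t \<in> {0, 1}) \<or> (\<forall>t\<in>N d. \<mu>' t \<in> {1, 2})\<close>[OF d]
        \<open>\<And>d. d \<in> c ` Tok \<Longrightarrow> even (\<Sum>t\<in>N d. \<mu>' t)\<close>[OF d]
      by (auto simp: N_def)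
    from pair_all_centres[of "c ` Tok" Tok c \<mu>', OF finite_imageI[OF fin] this] show ?thesis
      by fastforce
  qed
  have sd: "s (fst p) \<noteq> s (snd p)" if "fst p \<in> Tok \<and> snd p \<in> Tok \<and> c (fst p) = c (snd p) \<and> fst p \<noteq> snd p" for p
    using inj[of "fst p" "snd p"] that by blast
  show ?thesis
  proof (cases "even (\<Sum>t\<in>N c0. \<mu> t)")
    case True
    with m4 have "even (\<Sum>t\<in>N d. \<mu> t)" if "d \<in> c ` Tok" for d using that by (cases "d = c0") auto
    from pairs[OF m3 this] obtain q where q:
      "\<forall>p\<in>set q. fst p \<in> Tok \<and> snd p \<in> Tok \<and> c (fst p) = c (snd p) \<and> fst p \<noteq> snd p"
      "\<forall>t\<in>Tok. occ q t = \<mu> t" by auto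
    have o2: "occ q t \<le> 2" for t
    proof (cases "t \<in> Tok")
      case False
      then have "occ q t = 0" using q(1) by (intro occ_eq_0) auto
      then show ?thesis by simp
    qed (use q(2) m2 in auto)
    have "expo q = (\<Sum>t\<in>Tok. mono1 (s t))"
    proof (rule poly_mapping_eqI)
      fix x
      have "Poly_Mapping.lookup (expo q) x = (\<Sum>t\<in>{t\<in>Tok. s t = x}. occ q t)"
        using q(1) by (intro lookup_expo[OF fin]) auto
      also have "\<dots> = (\<Sum>t\<in>{t\<in>Tok. s t = x}. \<mu> t)" using q(2) by (intro sum.cong) auto
      finally show "Poly_Mapping.lookup (expo q) x = Poly_Mapping.lookup (\<Sum>t\<in>Tok. mono1 (s t)) x"
        by (simp only: m5 target)
    qed
    moreover have "Poly_Mapping.lookup (pforms (q @ q)) (expo q) \<noteq> 0"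
    proof (rule lookup_square_pforms_neq_0)
      fix p assume "p \<in> set q"
      with q(1) show "s (fst p) \<noteq> s (snd p)" by (intro sd) (rule bspec)
    qed
    ultimately have r3: "Poly_Mapping.lookup (pforms (q @ q)) (\<Sum>t\<in>Tok. mono1 (s t)) \<noteq> 0"
      by (simp only: not_False_eq_True)
    have r2: "\<forall>t. occ (q @ q) t \<le> 4"
    proof
      fix t show "occ (q @ q) t \<le> 4" using o2[of t] by simp
    qed
    have r1: "\<forall>p\<in>set (q @ q). fst p \<in> Tok \<and> snd p \<in> Tok \<and> c (fst p) = c (snd p) \<and> fst p \<noteq> snd p"
      using q(1) by (simp only: set_append Un_absorb)
    show ?thesis by (rule exI[of _ "q @ q"]) (intro conjI r1 r2 r3)
  next
    case False
    have "\<exists>u\<in>N c0. \<mu> u \<noteq> 0"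
    proof (rule ccontr)
      assume "\<not> ?thesis"
      then have "(\<Sum>t\<in>N c0. \<mu> t) = 0" by (intro sum.neutral) auto
      with False show False by simp
    qed
    then obtain u where u: "u \<in> Tok" "c u = c0" "\<mu> u \<noteq> 0" by (auto simp: N_def)
    have u1: "\<mu> u = 1" using m0[OF u(2)] u(3) by simp
    from two[OF u(1)] obtain v where v: "v \<in> Tok" "c v = c u" "v \<noteq> u" by auto
    define \<mu>' where "\<mu>' = \<mu>(u := 0)"
    have muu: "\<mu> t = \<mu>' t + (if t = u then 1 else 0)" for t using u1 by (simp add: \<mu>'_def)
    have "(\<forall>t\<in>N d. \<mu>' t \<in> {0, 1}) \<or> (\<forall>t\<in>N d. \<mu>' t \<in> {1, 2})" for d
    proof (cases "d = c0")
      case True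
      have "\<mu>' t \<in> {0, 1}" if "t \<in> N d" for t
        using m0[of t] that True by (auto simp: \<mu>'_def N_def le_Suc_eq)
      then show ?thesis by blast
    next
      case False
      then have "\<mu>' t = \<mu> t" if "t \<in> N d" for t using that u by (auto simp: \<mu>'_def N_def)
      with m3[of d] show ?thesis by simp
    qed
    moreover have "even (\<Sum>t\<in>N d. \<mu>' t)" if d: "d \<in> c ` Tok" for d
    proof (cases "d = c0")
      case True
      have "(\<Sum>t\<in>N d. \<mu> t) = (\<Sum>t\<in>N d. \<mu>' t) + (\<Sum>t\<in>N d. if t = u then 1 else 0)"
        unfolding muu by (rule sum.distrib)
      also have "(\<Sum>t\<in>N d. if t = u then 1 else 0) = (1::nat)"
        using True u finN by (simp add: N_def)
      finally show ?thesis using False True by simp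
    next
      case False
      then have "(\<Sum>t\<in>N d. \<mu>' t) = (\<Sum>t\<in>N d. \<mu> t)"
        using u by (intro sum.cong) (auto simp: \<mu>'_def N_def)
      then show ?thesis using m4[OF d False] by simp
    qed
    ultimately obtain q where q:
      "\<forall>p\<in>set q. fst p \<in> Tok \<and> snd p \<in> Tok \<and> c (fst p) = c (snd p) \<and> fst p \<noteq> snd p"
      "\<forall>t\<in>Tok. occ q t = \<mu>' t" using pairs[of \<mu>'] by auto
    have o2: "occ q t \<le> 2 \<and> (c t = c0 \<longrightarrow> occ q t \<le> 1)" for t
    proof (cases "t \<in> Tok")
      case False
      then have "occ q t = 0" using q(1) by (intro occ_eq_0) auto
      then show ?thesis by simp
    next
      case True
      then show ?thesis using q(2) m2[of t] m0[of t] muu[of t] by (simp split: if_splits)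
    qed
    have "mono1 (s u) + expo q = (\<Sum>t\<in>Tok. mono1 (s t))"
    proof (rule poly_mapping_eqI)
      fix x
      have "Poly_Mapping.lookup (expo q) x = (\<Sum>t\<in>{t\<in>Tok. s t = x}. occ q t)"
        using q(1) by (intro lookup_expo[OF fin]) auto
      also have "\<dots> = (\<Sum>t\<in>{t\<in>Tok. s t = x}. \<mu>' t)" using q(2) by (intro sum.cong) auto
      finally have 1: "Poly_Mapping.lookup (expo q) x = (\<Sum>t\<in>{t\<in>Tok. s t = x}. \<mu>' t)" .
      have "(\<Sum>t\<in>{t\<in>Tok. s t = x}. \<mu> t) =
        (\<Sum>t\<in>{t\<in>Tok. s t = x}. \<mu>' t) + (\<Sum>t\<in>{t\<in>Tok. s t = x}. if t = u then 1 else 0)"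
        unfolding muu by (rule sum.distrib)
      also have "(\<Sum>t\<in>{t\<in>Tok. s t = x}. if t = u then 1 else 0) = (if s u = x then 1 else (0::nat))"
        using u fin by simp
      finally show "Poly_Mapping.lookup (mono1 (s u) + expo q) x = Poly_Mapping.lookup (\<Sum>t\<in>Tok. mono1 (s t)) x"
        using 1 by (simp add: m5 target lookup_add)
    qed
    moreover have "Poly_Mapping.lookup (pforms ((u, v) # q @ q)) (mono1 (s u) + expo q) \<noteq> 0"
    proof (rule lookup_form_square_pforms_neq_0)
      fix p assume "p \<in> set q"
      with q(1) show "s (fst p) \<noteq> s (snd p)" by (intro sd) (rule bspec)
    next
      show "s u \<noteq> s v" using sd[of "(u, v)"] u v by simp
    qed
    ultimately have r3: "Poly_Mapping.lookup (pforms ((u, v) # q @ q)) (\<Sum>t\<in>Tok. mono1 (s t)) \<noteq> 0"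
      by (simp only: not_False_eq_True)
    have r2: "\<forall>t. occ ((u, v) # q @ q) t \<le> 4"
    proof
      fix t
      show "occ ((u, v) # q @ q) t \<le> 4"
      proof (cases "c t = c0")
        case True
        then show ?thesis using o2[of t] by simp
      next
        case False
        then have "t \<noteq> u" "t \<noteq> v" using u v by auto
        then show ?thesis using o2[of t] by simp
      qed
    qed
    have r1: "\<forall>p\<in>set ((u, v) # q @ q). fst p \<in> Tok \<and> snd p \<in> Tok \<and> c (fst p) = c (snd p) \<and> fst p \<noteq> snd p"
      using q(1) u v by simp
    show ?thesis by (rule exI[of _ "(u, v) # q @ q"]) (intro conjI r1 r2 r3)
  qed
qed

text \<open>Different components share no value of \<open>s\<close>, so their products of forms have
  disjoint variables and the coefficients multiply.\<close>

lemma token_pairs: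
  assumes "finite Tok"
    and "\<And>t t'. t \<in> Tok \<Longrightarrow> t' \<in> Tok \<Longrightarrow> c t = c t' \<Longrightarrow> s t = s t' \<Longrightarrow> t = t'"
    and "\<And>t. t \<in> Tok \<Longrightarrow> \<exists>t'\<in>Tok. c t' = c t \<and> t' \<noteq> t"
  shows "\<exists>ps. (\<forall>p\<in>set ps. fst p \<in> Tok \<and> snd p \<in> Tok \<and> c (fst p) = c (snd p) \<and> fst p \<noteq> snd p) \<and>
    (\<forall>t. occ ps t \<le> 4) \<and> Poly_Mapping.lookup (pforms ps) (\<Sum>t\<in>Tok. mono1 (s t)) \<noteq> 0"
  using assms
proof (induction "card Tok" arbitrary: Tok rule: less_induct)
  case less
  note fin = less.prems(1) and inj = less.prems(2) and two = less.prems(3)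
  show ?case
  proof (cases "Tok = {}")
    case True
    then show ?thesis by (intro exI[of _ "[]"]) simp
  next
    case False
    then obtain t0 where t0: "t0 \<in> Tok" by auto
    obtain C where C: "connected_centres Tok s c (c t0) C" "\<And>t t'. t \<in> Tok \<Longrightarrow> t' \<in> Tok \<Longrightarrow> s t = s t' \<Longrightarrow> c t' \<in> C \<Longrightarrow> c t \<in> C"
      using connected_centres_closed[OF fin, of s c "c t0"] by blast
    have Csub: "c t0 \<in> C" "C \<subseteq> c ` Tok" using connected_centres_subset[OF C(1)] t0 by auto
    define T1 where "T1 = {t\<in>Tok. c t \<in> C}"
    define T2 where "T2 = {t\<in>Tok. c t \<notin> C}"
    have TT: "Tok = T1 \<union> T2" "T1 \<inter> T2 = {}" by (auto simp: T1_def T2_def)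
    have fin1: "finite T1" "finite T2" using fin by (auto simp: T1_def T2_def)
    have c1: "c ` T1 = C" using Csub by (auto simp: T1_def)
    have "connected_centres T1 s c (c t0) C"
    proof -
      have "connected_centres T1 s c (c t0) D" if "connected_centres Tok s c (c t0) D" "D \<subseteq> C" for D
        using that
      proof (induction rule: connected_centres.induct)
        case connected_centres_root
        show ?case by (rule connected_centres.connected_centres_root)
      next
        case (connected_centres_insert D t t')
        then show ?case by (intro connected_centres.connected_centres_insert) (auto simp: T1_def)
      qed
      then show ?thesis using C(1) by blast
    qed
    then have cn: "connected_centres T1 s c (c t0) (c ` T1)" by (simp add: c1)
    have tw1: "\<exists>t'\<in>T1. c t' = c t \<and> t' \<noteq> t" if "t \<in> T1" for t
      using two[of t] that by (auto simp: T1_def)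
    have in1: "t = t'" if "t \<in> T1" "t' \<in> T1" "c t = c t'" "s t = s t'" for t t'
      using inj that by (auto simp: T1_def)
    have "\<exists>ps. (\<forall>p\<in>set ps. fst p \<in> T1 \<and> snd p \<in> T1 \<and> c (fst p) = c (snd p) \<and> fst p \<noteq> snd p) \<and>
      (\<forall>t. occ ps t \<le> 4) \<and> Poly_Mapping.lookup (pforms ps) (\<Sum>t\<in>T1. mono1 (s t)) \<noteq> 0"
      by (rule token_pairs_connected[OF fin1(1) cn], erule (3) in1, erule tw1)
    then obtain p1 where p1:
      "\<forall>p\<in>set p1. fst p \<in> T1 \<and> snd p \<in> T1 \<and> c (fst p) = c (snd p) \<and> fst p \<noteq> snd p"
      "\<forall>t. occ p1 t \<le> 4" "Poly_Mapping.lookup (pforms p1) (\<Sum>t\<in>T1. mono1 (s t)) \<noteq> 0"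
      by (elim exE conjE) (rule that)
    have "t0 \<in> Tok - T2" using t0 Csub by (auto simp: T2_def)
    then have cd: "card T2 < card Tok" using fin by (intro psubset_card_mono) (auto simp: T2_def)
    have tw2: "\<exists>t'\<in>T2. c t' = c t \<and> t' \<noteq> t" if "t \<in> T2" for t
      using two[of t] that by (auto simp: T2_def)
    have in2: "t = t'" if "t \<in> T2" "t' \<in> T2" "c t = c t'" "s t = s t'" for t t'
      using inj that by (auto simp: T2_def)
    have "\<exists>ps. (\<forall>p\<in>set ps. fst p \<in> T2 \<and> snd p \<in> T2 \<and> c (fst p) = c (snd p) \<and> fst p \<noteq> snd p) \<and>
      (\<forall>t. occ ps t \<le> 4) \<and> Poly_Mapping.lookup (pforms ps) (\<Sum>t\<in>T2. mono1 (s t)) \<noteq> 0"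
      by (rule less.hyps[OF cd fin1(2)], erule (3) in2, erule tw2)
    then obtain p2 where p2:
      "\<forall>p\<in>set p2. fst p \<in> T2 \<and> snd p \<in> T2 \<and> c (fst p) = c (snd p) \<and> fst p \<noteq> snd p"
      "\<forall>t. occ p2 t \<le> 4" "Poly_Mapping.lookup (pforms p2) (\<Sum>t\<in>T2. mono1 (s t)) \<noteq> 0"
      by (elim exE conjE) (rule that)
    have disj: "s ` T1 \<inter> s ` T2 = {}"
    proof -
      have False if "t \<in> T1" "t' \<in> T2" "s t = s t'" for t t'
        using C(2)[of t' t] that by (simp add: T1_def T2_def)
      then show ?thesis by blast
    qed
    have sT: "s (fst p) \<in> s ` T1 \<and> s (snd p) \<in> s ` T1" if "p \<in> set p1" for p
      using p1(1) that by auto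
    have fs: "finite (s ` T1)" using fin1 by simp
    have key: "Poly_Mapping.keys (\<Sum>t\<in>T. mono1 (s t)) \<subseteq> s ` T" for T
    proof (cases "finite T")
      case True
      then show ?thesis by (auto simp: in_keys_iff lookup_sum split: if_splits)
    qed simp
    have "Poly_Mapping.lookup (pforms p1 * pforms p2) ((\<Sum>t\<in>T1. mono1 (s t)) + (\<Sum>t\<in>T2. mono1 (s t))) =
      Poly_Mapping.lookup (pforms p1) (\<Sum>t\<in>T1. mono1 (s t)) * Poly_Mapping.lookup (pforms p2) (\<Sum>t\<in>T2. mono1 (s t))"
      using lookup_pforms_homogeneous[OF fs sT p1(3)] key[of T1] key[of T2] disj sT
      by (intro lookup_pforms_mult_disjoint[OF fs]) auto
    moreover have "(\<Sum>t\<in>Tok. mono1 (s t)) = (\<Sum>t\<in>T1. mono1 (s t)) + (\<Sum>t\<in>T2. mono1 (s t))"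
      unfolding TT(1) using fin1 TT(2) by (rule sum.union_disjoint)
    ultimately have r3: "Poly_Mapping.lookup (pforms (p1 @ p2)) (\<Sum>t\<in>Tok. mono1 (s t)) \<noteq> 0"
      using p1(3) p2(3) by simp
    have r2: "occ (p1 @ p2) t \<le> 4" for t
    proof (cases "t \<in> T1")
      case True
      then have "occ p2 t = 0" using p2(1) TT(2) by (intro occ_eq_0) auto
      then show ?thesis using p1(2) by simp
    next
      case False
      then have "occ p1 t = 0" using p1(1) TT(2) by (intro occ_eq_0) auto
      then show ?thesis using p2(2) by simp
    qed
    have r1: "\<forall>p\<in>set (p1 @ p2). fst p \<in> Tok \<and> snd p \<in> Tok \<and> c (fst p) = c (snd p) \<and> fst p \<noteq> snd p"
      using p1(1) p2(1) TT(1) by (simp only: set_append) blast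
    show ?thesis by (rule exI[of _ "p1 @ p2"]) (intro conjI r1 allI r2 r3)
  qed
qed

end

section \<open>Splitting the graph\<close>

text \<open>The vertices of \<open>Y\<close> are the leaves of disjoint stars with centres
  \<open>\<pi> w\<close>, and each vertex of \<open>X\<close> has to be a leaf or a centre. Adding a
  vertex \<open>w\<close> is only delicate when its chosen neighbour \<open>y\<close> is already a
  leaf.\<close>

lemma star_cover:
  assumes "finite X" "X \<subseteq> T" "\<And>x. x \<in> X \<Longrightarrow> \<exists>y\<in>T. R x y"
    and irr: "\<And>x. \<not> R x x" and sym: "\<And>x y. R x y \<Longrightarrow> R y x"
  shows "\<exists>Y \<pi>. Y \<subseteq> X \<and> (\<forall>w\<in>Y. \<pi> w \<in> T - Y \<and> R w (\<pi> w)) \<and> X \<subseteq> Y \<union> \<pi> ` Y"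
  using assms(1,2,3)
proof (induction X rule: finite_induct)
  case empty
  then show ?case by auto
next
  case (insert w X)
  have "\<exists>Y \<pi>. Y \<subseteq> X \<and> (\<forall>w\<in>Y. \<pi> w \<in> T - Y \<and> R w (\<pi> w)) \<and> X \<subseteq> Y \<union> \<pi> ` Y"
    by (rule insert.IH) (use insert.prems in auto)
  then obtain Y \<pi> where Y: "Y \<subseteq> X" "\<forall>w\<in>Y. \<pi> w \<in> T - Y \<and> R w (\<pi> w)" "X \<subseteq> Y \<union> \<pi> ` Y"
    by (elim exE conjE) (rule that)
  have wY: "w \<notin> Y" "w \<in> T" using insert Y(1) by auto
  show ?case
  proof (cases "w \<in> \<pi> ` Y")
    case True
    then show ?thesis using Y by (intro exI[of _ Y] exI[of _ \<pi>]) auto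
  next
    case False
    obtain y where y: "y \<in> T" "R w y" using insert.prems by auto
    then have yw: "y \<noteq> w" using irr by auto
    show ?thesis
    proof (cases "y \<in> Y")
      case False': False
      have "X \<subseteq> Y \<union> (\<pi>(w := y)) ` Y" using Y(3) wY(1) by (auto simp: image_iff)
      then show ?thesis
        using Y(1,2) wY False False' y yw by (intro exI[of _ "insert w Y"] exI[of _ "\<pi>(w := y)"]) auto
    next
      case True
      show ?thesis
      proof (cases "\<pi> y \<in> X \<and> (\<forall>v\<in>Y. \<pi> v = \<pi> y \<longrightarrow> v = y)")
        \<comment> \<open>The old centre of \<open>y\<close> has no other leaf and has to stay
          covered: the star is turned over, with \<open>y\<close> as centre of both \<open>w\<close>
          and the old centre.\<close>
        case True': True
        define \<pi>' where "\<pi>' = (\<lambda>v. if v = w \<or> v = \<pi> y then y else \<pi> v)"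
        define Y' where "Y' = insert w (insert (\<pi> y) (Y - {y}))"
        have nz: "\<pi> y \<notin> Y" "R y (\<pi> y)" "\<pi> y \<in> T" using Y(2)[rule_format, OF True] by auto
        have ny: "\<pi> y \<noteq> y" using nz(2) irr by metis
        have "Y' \<subseteq> insert w X" using Y(1) True' by (auto simp: Y'_def)
        moreover have "\<pi>' v \<in> T - Y' \<and> R v (\<pi>' v)" if v: "v \<in> Y'" for v
        proof (cases "v = w \<or> v = \<pi> y")
          case True
          then show ?thesis using y yw sym[OF nz(2)] nz ny by (auto simp: \<pi>'_def Y'_def)
        next
          case nv: False
          then have vY: "v \<in> Y" "v \<noteq> y" using v by (auto simp: Y'_def)
          then have "\<pi> v \<noteq> \<pi> y" "\<pi> v \<noteq> w" using True' False by auto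
          then show ?thesis using Y(2)[rule_format, OF vY(1)] nv by (auto simp: \<pi>'_def Y'_def)
        qed
        moreover have "insert w X \<subseteq> Y' \<union> \<pi>' ` Y'"
        proof
          fix x assume x: "x \<in> insert w X"
          have yi: "y \<in> \<pi>' ` Y'" by (rule image_eqI[of _ _ w]) (auto simp: \<pi>'_def Y'_def)
          show "x \<in> Y' \<union> \<pi>' ` Y'"
          proof (cases "x \<in> insert w Y \<or> x = \<pi> y")
            case True
            then show ?thesis using yi by (cases "x = y") (auto simp: Y'_def)
          next
            case nx: False
            then obtain v where v: "v \<in> Y" "x = \<pi> v" using x Y(3) by auto
            then have "v \<noteq> y" "v \<noteq> w" "v \<noteq> \<pi> y" using nx wY nz by auto
            then have "x = \<pi>' v" "v \<in> Y'" using v by (auto simp: \<pi>'_def Y'_def)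
            then show ?thesis by blast
          qed
        qed
        ultimately show ?thesis by (intro exI[of _ Y'] exI[of _ \<pi>']) simp
      next
        \<comment> \<open>The old centre of \<open>y\<close> is outside \<open>X\<close> or keeps
          another leaf, so \<open>y\<close> can be moved to a star with centre
          \<open>w\<close>.\<close>
        case F: False
        define \<pi>' where "\<pi>' = \<pi>(y := w)"
        have "\<pi>' v \<in> T - Y \<and> R v (\<pi>' v)" if v: "v \<in> Y" for v
          using Y(2)[rule_format, OF v] wY sym[OF y(2)] by (auto simp: \<pi>'_def)
        moreover have "insert w X \<subseteq> Y \<union> \<pi>' ` Y"
        proof
          fix x assume x: "x \<in> insert w X"
          show "x \<in> Y \<union> \<pi>' ` Y"
          proof (cases "x = w")
            case True
            then show ?thesis using \<open>y \<in> Y\<close> by (auto simp: \<pi>'_def)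
          next
            case xw: False
            show ?thesis
            proof (cases "x \<in> Y")
              case False
              then obtain v where v: "v \<in> Y" "x = \<pi> v" using x xw Y(3) by auto
              then obtain v' where "v' \<in> Y" "x = \<pi> v'" "v' \<noteq> y"
                using F x xw by (cases "v = y") auto
              then show ?thesis by (auto simp: \<pi>'_def)
            qed simp
          qed
        qed
        moreover have "Y \<subseteq> insert w X" using Y(1) by auto
        ultimately show ?thesis by (intro exI[of _ Y] exI[of _ \<pi>']) simp
      qed
    qed
  qed
qed

text \<open>Supplies \<open>\<tau>\<close> on a class of at least two vertices with a common single
  neighbour in \<open>S\<close>. Injectivity ensures that an edge occurs as
  \<open>{sn w, \<tau> w}\<close> for at most one \<open>w\<close>.\<close>

lemma ex_derangement:
  assumes "finite A" "card A \<ge> 2"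
  shows "\<exists>\<sigma>. inj_on \<sigma> A \<and> \<sigma> ` A \<subseteq> A \<and> (\<forall>a\<in>A. \<sigma> a \<noteq> a)"
  using assms
proof (induction A rule: finite_induct)
  case empty
  then show ?case by simp
next
  case (insert x A)
  have "A \<noteq> {}" using insert by auto
  then obtain a where a: "a \<in> A" by auto
  show ?case
  proof (cases "card A \<ge> 2")
    case True
    with insert.IH obtain \<sigma> where \<sigma>: "inj_on \<sigma> A" "\<sigma> ` A \<subseteq> A" "\<forall>a\<in>A. \<sigma> a \<noteq> a" by auto
    \<comment> \<open>The new element \<open>x\<close> is spliced in between \<open>a\<close> and
      \<open>\<sigma> a\<close>.\<close>
    define \<tau> where "\<tau> = \<sigma>(x := \<sigma> a, a := x)"
    have "inj_on \<tau> (insert x A)"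
      using \<sigma> a insert.hyps by (auto simp: \<tau>_def inj_on_def)
    moreover have "\<tau> ` insert x A \<subseteq> insert x A" "\<forall>b\<in>insert x A. \<tau> b \<noteq> b"
      using \<sigma> a insert.hyps by (auto simp: \<tau>_def)
    ultimately show ?thesis by (intro exI[of _ \<tau>] conjI)
  next
    case False
    then have "card A = 1" using insert by simp
    then have "A = {a}" using a by (auto simp: card_1_singleton_iff)
    then show ?thesis
      using insert.hyps by (intro exI[of _ "\<lambda>y. if y = x then a else x"]) (auto simp: inj_on_def)
  qed
qed

section \<open>The independent set and the roles of the remaining vertices\<close>

definition private_nbr :: "nat set set \<Rightarrow> nat set \<Rightarrow> nat \<Rightarrow> nat \<Rightarrow> bool" where
  "private_nbr E S w s \<longleftrightarrow> s \<in> S \<and> (\<forall>x\<in>S. {x, w} \<in> E \<longleftrightarrow> x = s)"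

lemma simple_graph_finite:
  assumes "simple_graph n E"
  shows "finite E"
proof (rule finite_subset)
  show "E \<subseteq> Pow {1..n}" using assms by (auto simp: simple_graph_def)
qed simp

lemma simple_graph_no_loop:
  assumes "simple_graph n E"
  shows "{u, u} \<notin> E"
  using assms unfolding simple_graph_def by (metis doubleton_eq_iff insert_absorb2)

text \<open>The independent set maximises the number of its elements plus half the number of its leaves;
  the leaf bonus keeps leaves out of the complement.\<close>

lemma ex_independent_set:
  assumes sg: "simple_graph n E" and nice: "nice E"
  shows "\<exists>S. S \<subseteq> \<Union>E \<and> (\<forall>u\<in>S. \<forall>v\<in>S. {u, v} \<notin> E) \<and> (\<forall>w\<in>\<Union>E - S. \<exists>s\<in>S. {s, w} \<in> E) \<and>
    (\<forall>w\<in>\<Union>E - S. \<forall>s. private_nbr E S w s \<longrightarrow> (\<exists>z\<in>\<Union>E - S. {z, w} \<in> E)) \<and>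
    (\<forall>w1\<in>\<Union>E - S. \<forall>w2\<in>\<Union>E - S. \<forall>s. w1 \<noteq> w2 \<longrightarrow> private_nbr E S w1 s \<longrightarrow> private_nbr E S w2 s \<longrightarrow> {w1, w2} \<in> E)"
proof -
  \<comment> \<open>Weights are doubled to stay integral.\<close>
  define wt :: "nat \<Rightarrow> nat" where "wt v = 2 + (if deg E v = 1 then 1 else 0)" for v
  define indep where "indep S \<longleftrightarrow> S \<subseteq> \<Union>E \<and> (\<forall>u\<in>S. \<forall>v\<in>S. {u, v} \<notin> E)" for S
  have finV: "finite (\<Union>E)"
  proof (rule finite_subset)
    show "\<Union>E \<subseteq> {1..n}" using sg by (auto simp: simple_graph_def)
  qed simp
  have bound: "sum wt S < Suc (sum wt (\<Union>E))" if "indep S" for S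
    using that finV by (auto simp: indep_def less_Suc_eq_le intro!: sum_mono2)
  have "indep {}" by (simp add: indep_def)
  then obtain S where S: "indep S" "\<And>S'. indep S' \<Longrightarrow> sum wt S' \<le> sum wt S"
    using ex_has_greatest_nat[of indep "{}" "sum wt" "Suc (sum wt (\<Union>E))"] bound by blast
  have finS: "finite S" using S(1) finV by (auto simp: indep_def intro: finite_subset)
  have SV: "S \<subseteq> \<Union>E" and Sind: "\<And>u v. u \<in> S \<Longrightarrow> v \<in> S \<Longrightarrow> {u, v} \<notin> E"
    using S(1) by (auto simp: indep_def)
  have nl: "{u, u} \<notin> E" for u using simple_graph_no_loop[OF sg] .
  have wt: "wt v \<ge> 2" "wt v \<le> 3" for v by (auto simp: wt_def)
  have maximal: "\<exists>s\<in>S. {s, w} \<in> E" if w: "w \<in> \<Union>E - S" for w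
  proof (rule ccontr)
    assume no: "\<not> ?thesis"
    have "indep (insert w S)"
      unfolding indep_def
    proof (intro conjI ballI)
      show "insert w S \<subseteq> \<Union>E" using w SV by auto
      fix u v assume uv: "u \<in> insert w S" "v \<in> insert w S"
      show "{u, v} \<notin> E"
      proof (cases "u = w")
        case True
        then show ?thesis using uv no nl by (cases "v = w") (auto simp: insert_commute)
      next
        case False
        then show ?thesis using uv no Sind by (cases "v = w") auto
      qed
    qed
    from S(2)[OF this] have "sum wt (insert w S) \<le> sum wt S" .
    moreover have "sum wt (insert w S) = wt w + sum wt S" using w finS by simp
    ultimately show False using wt(1)[of w] by linarith
  qed
  \<comment> \<open>Exchange argument: if \<open>s\<close> is the only neighbour in \<open>S\<close>
    of every vertex of the independent set \<open>W\<close>, then \<open>W\<close> can replace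
    \<open>s\<close> and must not be heavier.\<close>
  have swap: False
    if W: "W \<subseteq> \<Union>E - S" "finite W" "\<And>w. w \<in> W \<Longrightarrow> private_nbr E S w s" "\<And>u v. u \<in> W \<Longrightarrow> v \<in> W \<Longrightarrow> {u, v} \<notin> E"
      and sS: "s \<in> S" and gt: "sum wt W > wt s" for W s
  proof -
    have "indep ((S - {s}) \<union> W)"
      unfolding indep_def
    proof (intro conjI ballI)
      show "S - {s} \<union> W \<subseteq> \<Union>E" using W SV by auto
      fix u v assume uv: "u \<in> S - {s} \<union> W" "v \<in> S - {s} \<union> W"
      have nb: "{x, w} \<notin> E" if "x \<in> S - {s}" "w \<in> W" for x w
        using W(3)[OF that(2)] that(1) by (auto simp: private_nbr_def)
      show "{u, v} \<notin> E"
        using uv nb[of u v] nb[of v u] Sind[of u v] W(4)[of u v] by (auto simp: insert_commute)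
    qed
    from S(2)[OF this] have "sum wt (S - {s} \<union> W) \<le> sum wt S" .
    moreover have "sum wt (S - {s} \<union> W) = sum wt (S - {s}) + sum wt W"
      using W finS by (intro sum.union_disjoint) auto
    moreover have "sum wt S = wt s + sum wt (S - {s})" using sS finS by (simp add: sum.remove)
    ultimately show False using gt by linarith
  qed
  have leaf: "\<exists>z\<in>\<Union>E - S. {z, w} \<in> E" if w: "w \<in> \<Union>E - S" and p: "private_nbr E S w s" for w s
  proof (rule ccontr)
    assume no: "\<not> ?thesis"
    have sw: "s \<in> S" "{s, w} \<in> E" using p by (auto simp: private_nbr_def)
    have "inc E w = {{s, w}}"
    proof
      show "{{s, w}} \<subseteq> inc E w" using sw by (auto simp: inc_def)
      show "inc E w \<subseteq> {{s, w}}"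
      proof
        fix e assume e: "e \<in> inc E w"
        then obtain i j where ij: "e = {i, j}" "i \<noteq> j" using sg by (auto simp: inc_def simple_graph_def)
        then obtain z where z: "e = {z, w}" using e by (auto simp: inc_def)
        have zE: "{z, w} \<in> E" using e z by (auto simp: inc_def)
        then have "z \<in> S" using no by auto
        then have "z = s" using p zE by (auto simp: private_nbr_def)
        then show "e \<in> {{s, w}}" using z by simp
      qed
    qed
    then have dw: "deg E w = 1" by (simp add: deg_def)
    \<comment> \<open>Niceness makes \<open>s\<close> a non-leaf, so exchanging it for the leaf
      \<open>w\<close> would gain the bonus.\<close>
    have "\<not> isolated_edge E {s, w}" using nice sw by (auto simp: nice_def)
    then have "deg E s \<noteq> 1" using sw dw by (auto simp: isolated_edge_def)
    then have "wt s < sum wt {w}" using dw by (simp add: wt_def)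
    with swap[of "{w}" s] w p sw nl show False by auto
  qed
  have clique: "{w1, w2} \<in> E"
    if "w1 \<in> \<Union>E - S" "w2 \<in> \<Union>E - S" "w1 \<noteq> w2" "private_nbr E S w1 s" "private_nbr E S w2 s" for w1 w2 s
  proof (rule ccontr)
    assume no: "{w1, w2} \<notin> E"
    \<comment> \<open>Two vertices weigh at least 4 and \<open>s\<close> at most 3; the bonus is
      small enough not to spoil this exchange.\<close>
    have "wt s < sum wt {w1, w2}" using wt(2)[of s] wt(1)[of w1] wt(1)[of w2] that(3) by simp
    moreover have "s \<in> S" using that(4) by (simp add: private_nbr_def)
    moreover have "{u, v} \<notin> E" if "u \<in> {w1, w2}" "v \<in> {w1, w2}" for u v
    proof -
      have "{u, v} \<in> {{w1, w1}, {w2, w2}, {w1, w2}}" using that by blast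
      then show ?thesis using no nl[of w1] nl[of w2] by (elim insertE) auto
    qed
    ultimately show False
      using swap[of "{w1, w2}" s] that(1,2,4,5) by auto
  qed
  show ?thesis
    by (intro exI[of _ S] conjI ballI allI impI SV Sind maximal leaf clique)
qed

text \<open>
  \<open>S\<close> is independent with complement \<open>T\<close>, and \<open>sn w\<close> is a neighbour of \<open>w \<in> T\<close> in \<open>S\<close>, the only one
  if \<open>w \<in> Sat \<union> Free\<close>. A vertex of \<open>Free\<close> forms a triangle with \<open>sn w\<close> and \<open>\<tau> w\<close>, which yields the
  direction \<open>2 sn w\<close>. A vertex of \<open>Sat\<close> has no such triangle and is attached as a satellite to the
  centre \<open>\<pi> w\<close>. By \<open>two\<close>, every other vertex of \<open>T\<close> is a centre of at least two tokens.
\<close>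

locale edge_split =
  fixes E :: "nat set set" and S T Sat Free :: "nat set" and \<pi> \<tau> sn :: "nat \<Rightarrow> nat"
  assumes fin: "finite E" "finite S" "finite T"
    and edge: "\<And>e. e \<in> E \<Longrightarrow> \<exists>u\<in>S \<union> T. \<exists>v\<in>T. u \<noteq> v \<and> e = {u, v}"
    and disj: "S \<inter> T = {}"
    and sn: "\<And>w. w \<in> T \<Longrightarrow> sn w \<in> S" "\<And>w. w \<in> T \<Longrightarrow> {sn w, w} \<in> E"
    and sub: "Sat \<subseteq> T" "Free \<subseteq> T" "Sat \<inter> Free = {}"
    and sn_unique: "\<And>w x. w \<in> Sat \<union> Free \<Longrightarrow> x \<in> S \<Longrightarrow> {x, w} \<in> E \<Longrightarrow> x = sn w"
    and pi: "\<And>w. w \<in> Sat \<Longrightarrow> \<pi> w \<in> T - Sat - Free" "\<And>w. w \<in> Sat \<Longrightarrow> {w, \<pi> w} \<in> E"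
      "\<And>w. w \<in> Sat \<Longrightarrow> {sn w, \<pi> w} \<notin> E"
    and sn_inj: "\<And>w w'. w \<in> Sat \<Longrightarrow> w' \<in> Sat \<Longrightarrow> sn w = sn w' \<Longrightarrow> w = w'"
    and tau: "\<And>w. w \<in> Free \<Longrightarrow> \<tau> w \<in> T - Sat" "\<And>w. w \<in> Free \<Longrightarrow> {w, \<tau> w} \<in> E"
      "\<And>w. w \<in> Free \<Longrightarrow> {sn w, \<tau> w} \<in> E"
      "\<And>w w'. w \<in> Free \<Longrightarrow> w' \<in> Free \<Longrightarrow> sn w = sn w' \<Longrightarrow> \<tau> w = \<tau> w' \<Longrightarrow> w = w'"
    and two: "\<And>w. w \<in> T - Sat - Free \<Longrightarrow> (\<exists>x\<in>S. x \<noteq> sn w \<and> {x, w} \<in> E) \<or> (\<exists>y\<in>Sat. \<pi> y = w)"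

text \<open>Vertices of \<open>T\<close> with one neighbour in \<open>S\<close> and no triangle on
  that edge are covered by stars, whose leaves form \<open>Sat\<close>. Those with a triangle are
  declared free unless they are centres of stars. What remains has a second neighbour in
  \<open>S\<close> or a satellite, which is the condition \<open>two\<close>.\<close>

lemma ex_edge_split:
  assumes sg: "simple_graph n E" and nice: "nice E"
  shows "\<exists>S T Sat Free \<pi> \<tau> sn. edge_split E S T Sat Free \<pi> \<tau> sn"
proof -
  obtain S where S: "S \<subseteq> \<Union>E" "\<forall>u\<in>S. \<forall>v\<in>S. {u, v} \<notin> E" "\<forall>w\<in>\<Union>E - S. \<exists>s\<in>S. {s, w} \<in> E"
    "\<forall>w\<in>\<Union>E - S. \<forall>s. private_nbr E S w s \<longrightarrow> (\<exists>z\<in>\<Union>E - S. {z, w} \<in> E)"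
    "\<forall>w1\<in>\<Union>E - S. \<forall>w2\<in>\<Union>E - S. \<forall>s. w1 \<noteq> w2 \<longrightarrow> private_nbr E S w1 s \<longrightarrow> private_nbr E S w2 s \<longrightarrow> {w1, w2} \<in> E"
    using ex_independent_set[OF assms] by (elim exE conjE) (rule that)
  define T where "T = \<Union>E - S"
  have fV: "finite (\<Union>E)"
  proof (rule finite_subset)
    show "\<Union>E \<subseteq> {1..n}" using sg by (auto simp: simple_graph_def)
  qed simp
  then have fST: "finite S" "finite T" using S(1) by (auto simp: T_def intro: finite_subset)
  have nl: "{u, u} \<notin> E" for u using simple_graph_no_loop[OF sg] .
  define sn where "sn w = (SOME s. s \<in> S \<and> {s, w} \<in> E)" for w
  have sn: "sn w \<in> S \<and> {sn w, w} \<in> E" if "w \<in> T" for w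
    unfolding sn_def by (rule someI_ex) (use S(3) that in \<open>auto simp: T_def\<close>)
  define W where "W = {w\<in>T. private_nbr E S w (sn w)}"
  have W_sn: "x = sn w" if "w \<in> W" "x \<in> S" "{x, w} \<in> E" for w x
    using that by (auto simp: W_def private_nbr_def)
  define tri where "tri w \<longleftrightarrow> (\<exists>z\<in>T. {z, sn w} \<in> E \<and> {w, z} \<in> E)" for w
  define X where "X = {w\<in>W. \<not> tri w}"
  have clique: "{w, w'} \<in> E" if "w \<in> W" "w' \<in> W" "sn w = sn w'" "w \<noteq> w'" for w w'
    using S(5) that by (auto simp: W_def T_def)
  have tri_clique: "tri w" if "w \<in> W" "w' \<in> W" "sn w = sn w'" "w \<noteq> w'" for w w'
    unfolding tri_def using clique[OF that] sn[of w'] that by (intro bexI[of _ w']) (auto simp: W_def insert_commute)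
  have "\<exists>y\<in>T. {w, y} \<in> E" if "w \<in> X" for w
  proof -
    have "w \<in> \<Union>E - S" "private_nbr E S w (sn w)" using that by (auto simp: X_def W_def T_def)
    with S(4) obtain z where "z \<in> T" "{z, w} \<in> E" by (auto simp: T_def)
    then show ?thesis by (auto simp: insert_commute)
  qed
  then have "\<exists>Y \<pi>. Y \<subseteq> X \<and> (\<forall>w\<in>Y. \<pi> w \<in> T - Y \<and> {w, \<pi> w} \<in> E) \<and> X \<subseteq> Y \<union> \<pi> ` Y"
    using fST nl by (intro star_cover) (auto simp: X_def W_def insert_commute)
  then obtain Sat \<pi> where Sat: "Sat \<subseteq> X" "\<forall>w\<in>Sat. \<pi> w \<in> T - Sat \<and> {w, \<pi> w} \<in> E" "X \<subseteq> Sat \<union> \<pi> ` Sat"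
    by (elim exE conjE) (rule that)
  define Free where "Free = {w\<in>W. tri w \<and> w \<notin> \<pi> ` Sat}"
  define P where "P s = {w\<in>W. sn w = s}" for s
  have finP: "finite (P s)" for s using fST by (simp add: P_def W_def)
  \<comment> \<open>Each class \<open>P s\<close> is a clique, so for two or more elements a
    derangement selects the third vertices of the triangles injectively; a class of one vertex takes
    any triangle.\<close>
  have "\<forall>s. \<exists>\<sigma>. card (P s) \<ge> 2 \<longrightarrow> inj_on \<sigma> (P s) \<and> \<sigma> ` P s \<subseteq> P s \<and> (\<forall>a\<in>P s. \<sigma> a \<noteq> a)"
    using ex_derangement[OF finP] by blast
  then obtain \<sigma> where \<sigma>: "\<And>s. card (P s) \<ge> 2 \<Longrightarrow> inj_on (\<sigma> s) (P s) \<and> \<sigma> s ` P s \<subseteq> P s \<and> (\<forall>a\<in>P s. \<sigma> s a \<noteq> a)"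
    by metis
  define \<tau> where "\<tau> w = (if card (P (sn w)) \<ge> 2 then \<sigma> (sn w) w else (SOME z. z \<in> T \<and> {z, sn w} \<in> E \<and> {w, z} \<in> E))" for w
  have P1: "w' = w" if "\<not> card (P (sn w)) \<ge> 2" "w \<in> W" "w' \<in> W" "sn w' = sn w" for w w'
  proof (rule ccontr)
    assume "w' \<noteq> w"
    moreover have "card {w, w'} \<le> card (P (sn w))"
      using that finP by (intro card_mono) (auto simp: P_def)
    ultimately show False using that(1) by simp
  qed
  have tau: "\<tau> w \<in> T - Sat \<and> {w, \<tau> w} \<in> E \<and> {sn w, \<tau> w} \<in> E" if w: "w \<in> Free" for w
  proof -
    have wW: "w \<in> W" "tri w" using w by (auto simp: Free_def)
    show ?thesis
    proof (cases "card (P (sn w)) \<ge> 2")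
      case True
      then have t: "\<tau> w \<in> P (sn w)" "\<tau> w \<noteq> w" using \<sigma>[OF True] wW by (auto simp: \<tau>_def P_def)
      then have t': "\<tau> w \<in> W" "sn (\<tau> w) = sn w" by (auto simp: P_def)
      have "tri (\<tau> w)" using tri_clique[OF t'(1) wW(1) t'(2) t(2)] .
      then have "\<tau> w \<notin> Sat" using Sat(1) by (auto simp: X_def)
      moreover have "{w, \<tau> w} \<in> E" using clique[of w "\<tau> w"] wW t t' by auto
      moreover have "\<tau> w \<in> T" using t'(1) by (simp add: W_def)
      ultimately show ?thesis using sn[of "\<tau> w"] t'(2) by simp
    next
      case False
      then have t: "\<tau> w = (SOME z. z \<in> T \<and> {z, sn w} \<in> E \<and> {w, z} \<in> E)" by (simp add: \<tau>_def)
      have z: "\<tau> w \<in> T \<and> {\<tau> w, sn w} \<in> E \<and> {w, \<tau> w} \<in> E"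
        unfolding t by (rule someI_ex) (use wW in \<open>auto simp: tri_def\<close>)
      \<comment> \<open>A satellite adjacent to \<open>sn w\<close> has it as its only neighbour in
        \<open>S\<close>, hence would be a second element of the class of \<open>w\<close>.\<close>
      have "\<tau> w \<notin> Sat"
      proof
        assume "\<tau> w \<in> Sat"
        then have zW: "\<tau> w \<in> W" using Sat(1) by (auto simp: X_def)
        have "sn w \<in> S" using sn wW by (auto simp: W_def)
        then have "sn (\<tau> w) = sn w" using W_sn[OF zW, of "sn w"] z by (auto simp: insert_commute)
        from P1[OF False wW(1) zW this] z nl[of w] show False by simp
      qed
      then show ?thesis using z by (simp add: insert_commute)
    qed
  qed
  have "edge_split E S T Sat Free \<pi> \<tau> sn"
  proof
    show "finite E" by (rule simple_graph_finite[OF sg])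
    show "finite S" "finite T" by (fact fST)+
    show "S \<inter> T = {}" by (auto simp: T_def)
  next
    fix e assume e: "e \<in> E"
    then obtain i j where ij: "i \<noteq> j" "e = {i, j}" using sg by (auto simp: simple_graph_def)
    have V: "i \<in> S \<union> T" "j \<in> S \<union> T" using e ij by (auto simp: T_def)
    show "\<exists>u\<in>S \<union> T. \<exists>v\<in>T. u \<noteq> v \<and> e = {u, v}"
    proof (cases "j \<in> T")
      case True
      then show ?thesis using V ij by auto
    next
      case False
      then have "i \<in> T" using V S(2) e ij by auto
      then show ?thesis using V ij by (intro bexI[of _ j] bexI[of _ i]) auto
    qed
  next
    fix w assume "w \<in> T"
    then show "sn w \<in> S" "{sn w, w} \<in> E" using sn by auto
  next
    show "Sat \<subseteq> T" using Sat(1) by (auto simp: X_def W_def)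
    show "Free \<subseteq> T" by (auto simp: Free_def W_def)
    show "Sat \<inter> Free = {}" using Sat(1) by (auto simp: X_def Free_def)
  next
    fix w x assume "w \<in> Sat \<union> Free" "x \<in> S" "{x, w} \<in> E"
    then show "x = sn w" using W_sn[of w x] Sat(1) by (auto simp: X_def Free_def)
  next
    fix w assume w: "w \<in> Sat"
    show "\<pi> w \<in> T - Sat - Free" using w Sat(2) by (auto simp: Free_def)
    show "{w, \<pi> w} \<in> E" using w Sat(2) by auto
    have "\<not> tri w" using w Sat(1) by (auto simp: X_def)
    then show "{sn w, \<pi> w} \<notin> E" using w Sat(2) by (auto simp: tri_def insert_commute)
  next
    fix w w' assume "w \<in> Sat" "w' \<in> Sat" "sn w = sn w'"
    then show "w = w'" using tri_clique[of w w'] Sat(1) by (auto simp: X_def)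
  next
    fix w assume w: "w \<in> Free"
    show "\<tau> w \<in> T - Sat" "{w, \<tau> w} \<in> E" "{sn w, \<tau> w} \<in> E" using tau[OF w] by auto
  next
    fix w w' assume w: "w \<in> Free" "w' \<in> Free" "sn w = sn w'" "\<tau> w = \<tau> w'"
    then have W: "w \<in> W" "w' \<in> W" by (auto simp: Free_def)
    show "w = w'"
    proof (cases "card (P (sn w)) \<ge> 2")
      case True
      then have "\<sigma> (sn w) w = \<sigma> (sn w) w'" using w by (simp add: \<tau>_def)
      moreover have "w \<in> P (sn w)" "w' \<in> P (sn w)" using W w by (auto simp: P_def)
      ultimately show ?thesis using \<sigma>[OF True] by (auto dest: inj_onD)
    next
      case False
      from P1[OF False W w(3)[symmetric]] show ?thesis by (rule sym)
    qed
  next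
    fix w assume w: "w \<in> T - Sat - Free"
    show "(\<exists>x\<in>S. x \<noteq> sn w \<and> {x, w} \<in> E) \<or> (\<exists>y\<in>Sat. \<pi> y = w)"
    proof (cases "w \<in> W")
      case True
      then have "w \<in> \<pi> ` Sat" using w Sat(3) by (auto simp: X_def Free_def)
      then show ?thesis by auto
    next
      case False
      then show ?thesis using w sn[of w] by (auto simp: W_def private_nbr_def)
    qed
  qed
  then show ?thesis by blast
qed

lemma card_le_1: "(\<And>x y. x \<in> A \<Longrightarrow> y \<in> A \<Longrightarrow> x = y) \<Longrightarrow> card A \<le> 1"
  by (cases "finite A") (auto simp: card_le_Suc0_iff_eq)

context edge_split
begin

subsection \<open>Edges between \<open>S\<close> and \<open>T\<close>\<close>

definition Tok :: "(nat \<times> nat) set" where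
  "Tok = {(x, w). x \<in> S \<and> w \<in> T - Free \<and> {x, w} \<in> E}"

definition centre :: "nat \<times> nat \<Rightarrow> nat" where
  "centre t = (if snd t \<in> Sat then \<pi> (snd t) else snd t)"

definition tsign :: "nat \<times> nat \<Rightarrow> int" where
  "tsign t = (if snd t \<in> Sat then - 1 else 1)"

text \<open>The vertex sums of the half form are \<open>1\<close> at the end in \<open>S\<close> and \<open>tsign t\<close> at the centre, so the
  centre cancels in a \<open>pair_form\<close>.\<close>

definition half_form :: "nat \<times> nat \<Rightarrow> nat set \<Rightarrow> int" where
  "half_form t = (if snd t \<in> Sat then (\<lambda>e. edge_ind {fst t, snd t} e - edge_ind {snd t, \<pi> (snd t)} e)
     else edge_ind {fst t, snd t})"

definition pair_form :: "(nat \<times> nat) \<times> (nat \<times> nat) \<Rightarrow> nat set \<Rightarrow> int" where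
  "pair_form p e = half_form (fst p) e - tsign (fst p) * tsign (snd p) * half_form (snd p) e"

text \<open>On the odd cycle the signs cancel at \<open>w\<close> and \<open>\<tau> w\<close> but
  add up at \<open>sn w\<close>; this is how a single vertex comes to carry the whole vertex
  sum.\<close>

definition free_form :: "nat \<Rightarrow> nat set \<Rightarrow> int" where
  "free_form w e = edge_ind {sn w, w} e + edge_ind {sn w, \<tau> w} e - edge_ind {w, \<tau> w} e"

lemma ST_neq: "x \<in> S \<Longrightarrow> w \<in> T \<Longrightarrow> x \<noteq> w"
  using disj by auto

lemma no_loop: "{u, u} \<notin> E"
proof
  assume "{u, u} \<in> E"
  from edge[OF this] show False by (auto simp: doubleton_eq_iff)
qed

lemma finTok: "finite Tok"
  by (rule finite_subset[of _ "S \<times> T"]) (auto simp: Tok_def fin)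

sublocale token_forms fst tsign
  by standard (auto simp: tsign_def)

lemma pi_neq: "w \<in> Sat \<Longrightarrow> \<pi> w \<noteq> w"
  using pi(2)[of w] no_loop[of w] by metis

lemma vweight_half_form:
  assumes "t \<in> Tok"
  shows "vweight E (half_form t) x = (if x = fst t then 1 else 0) + tsign t * (if x = centre t then 1 else 0)"
proof -
  obtain a w where t: "t = (a, w)" by (cases t)
  have a: "a \<in> S" "w \<in> T" "{a, w} \<in> E" "a \<noteq> w" using assms ST_neq by (auto simp: t Tok_def)
  show ?thesis
  proof (cases "w \<in> Sat")
    case True
    then show ?thesis
      using a pi(2)[OF True] pi_neq[OF True] fin(1)
      by (simp add: t half_form_def centre_def tsign_def vweight_diff vweight_ind)
  next
    case False
    then show ?thesis
      using a fin(1) by (simp add: t half_form_def centre_def tsign_def vweight_ind)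
  qed
qed

lemma vweight_pair_form:
  assumes "t \<in> Tok" "t' \<in> Tok" "centre t = centre t'"
  shows "vweight E (pair_form (t, t')) x = (if x = fst t then 1 else 0) - tsign t * tsign t' * (if x = fst t' then 1 else 0)"
proof -
  have "vweight E (pair_form (t, t')) x = vweight E (half_form t) x - tsign t * tsign t' * vweight E (half_form t') x"
    unfolding pair_form_def fst_conv snd_conv vweight_diff vweight_scale ..
  then show ?thesis
    unfolding vweight_half_form[OF assms(1)] vweight_half_form[OF assms(2)] assms(3) by (simp add: tsign_def)
qed

lemma tau_neq: "w \<in> Free \<Longrightarrow> \<tau> w \<noteq> w"
  using tau(2)[of w] no_loop[of w] by metis

lemma vweight_free_form:
  assumes w: "w \<in> Free"
  shows "vweight E (free_form w) x = (if x = sn w then 2 else 0)"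
proof -
  have T: "w \<in> T" "\<tau> w \<in> T" "sn w \<in> S" using w sub tau(1)[OF w] sn(1) by auto
  have "vweight E (free_form w) x = vweight E (edge_ind {sn w, w}) x + vweight E (edge_ind {sn w, \<tau> w}) x - vweight E (edge_ind {w, \<tau> w}) x"
    unfolding free_form_def vweight_diff vweight_add ..
  then show ?thesis
    using sn(2)[OF T(1)] tau(2,3)[OF w] tau_neq[OF w] ST_neq[OF T(3) T(1)] ST_neq[OF T(3) T(2)] fin(1)
    by (auto simp: vweight_ind)
qed

text \<open>Guarantees that the two variables of each paired form differ. A satellite and its centre
  have no common neighbour in \<open>S\<close> because the satellite has no triangle, and two
  satellites never share theirs.\<close>

lemma Tok_fst_inj:
  assumes t: "t \<in> Tok" "t' \<in> Tok" and c: "centre t = centre t'" and f: "fst t = fst t'"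
  shows "t = t'"
proof -
  obtain a w where tw: "t = (a, w)" by (cases t)
  with f obtain w' where tw': "t' = (a, w')" by (cases t') auto
  have aS: "a \<in> S" "{a, w} \<in> E" "{a, w'} \<in> E" using t by (auto simp: tw tw' Tok_def)
  have 1: False if "v \<in> Sat" "{a, v} \<in> E" "{a, \<pi> v} \<in> E" for v
    using sn_unique[of v a] that aS pi(3)[of v] by auto
  have "w = w'"
  proof (cases "w \<in> Sat")
    case True
    show ?thesis
    proof (cases "w' \<in> Sat")
      case True': True
      have "a = sn w" "a = sn w'" using sn_unique[of w a] sn_unique[of w' a] aS True True' by auto
      then show ?thesis using sn_inj[OF True True'] by simp
    next
      case False
      then have "\<pi> w = w'" using c True by (simp add: centre_def tw tw')
      then show ?thesis using 1[of w] True aS by simp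
    qed
  next
    case False
    show ?thesis
    proof (cases "w' \<in> Sat")
      case True
      then have "\<pi> w' = w" using c False by (simp add: centre_def tw tw')
      then show ?thesis using 1[of w'] True aS by simp
    next
      case False': False
      then show ?thesis using c False by (simp add: centre_def tw tw')
    qed
  qed
  then show ?thesis by (simp add: tw tw')
qed

lemma Tok_centre_two:
  assumes t: "t \<in> Tok"
  shows "\<exists>t'\<in>Tok. centre t' = centre t \<and> t' \<noteq> t"
proof -
  obtain a w where tw: "t = (a, w)" by (cases t)
  have a: "a \<in> S" "w \<in> T - Free" "{a, w} \<in> E" using t by (auto simp: tw Tok_def)
  show ?thesis
  proof (cases "w \<in> Sat")
    case True
    have pT: "\<pi> w \<in> T - Sat - Free" by (rule pi(1)[OF True])
    then have "(sn (\<pi> w), \<pi> w) \<in> Tok" using sn[of "\<pi> w"] by (auto simp: Tok_def)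
    then show ?thesis using pT True pi_neq[OF True] by (intro bexI[of _ "(sn (\<pi> w), \<pi> w)"]) (auto simp: tw centre_def)
  next
    case False
    then have "w \<in> T - Sat - Free" using a by auto
    from two[OF this] show ?thesis
    proof
      assume "\<exists>x\<in>S. x \<noteq> sn w \<and> {x, w} \<in> E"
      then obtain x where x: "x \<in> S" "x \<noteq> sn w" "{x, w} \<in> E" by auto
      define y where "y = (if a = sn w then x else sn w)"
      have "(y, w) \<in> Tok" "y \<noteq> a" using x a sn[of w] by (auto simp: y_def Tok_def)
      then show ?thesis by (intro bexI[of _ "(y, w)"]) (auto simp: tw centre_def)
    next
      assume "\<exists>y\<in>Sat. \<pi> y = w"
      then obtain y where y: "y \<in> Sat" "\<pi> y = w" by auto
      have "(sn y, y) \<in> Tok" using y sub sn[of y] by (auto simp: Tok_def)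
      then show ?thesis using y False by (intro bexI[of _ "(sn y, y)"]) (auto simp: tw centre_def)
    qed
  qed
qed

text \<open>Distinct tokens have disjoint supports: an edge \<open>{w, \<pi> w}\<close> determines
  the satellite \<open>w\<close>, which has a single token. The pair forms at an edge are thus
  bounded by the uses of one token.\<close>

lemma half_form_support_unique:
  assumes t: "t \<in> Tok" "t' \<in> Tok" and e: "half_form t e \<noteq> 0" "half_form t' e \<noteq> 0"
  shows "t = t'"
proof -
  obtain a w a' w' where tw: "t = (a, w)" "t' = (a', w')" by (cases t, cases t') auto
  have A: "a \<in> S" "a' \<in> S" "w \<in> T" "w' \<in> T" "{a, w} \<in> E" "{a', w'} \<in> E"
    using t by (auto simp: tw Tok_def)
  have s1: "e = {a, w} \<or> (w \<in> Sat \<and> e = {w, \<pi> w})"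
    using e(1) by (simp add: tw half_form_def edge_ind_def split: if_splits)
  have s2: "e = {a', w'} \<or> (w' \<in> Sat \<and> e = {w', \<pi> w'})"
    using e(2) by (simp add: tw half_form_def edge_ind_def split: if_splits)
  have piT: "v \<in> Sat \<Longrightarrow> \<pi> v \<in> T - Sat" for v using pi(1) by auto
  have "w = w' \<and> a = a'"
  proof (cases "e = {a, w}")
    case True
    have "a \<in> e \<inter> S" using True A by simp
    moreover have "v \<in> Sat \<Longrightarrow> {v, \<pi> v} \<inter> S = {}" for v using piT[of v] sub(1) disj by auto
    ultimately have "e = {a', w'}" using s2 by auto
    then show ?thesis using True A ST_neq by (auto simp: doubleton_eq_iff)
  next
    case False
    then have w: "w \<in> Sat" "e = {w, \<pi> w}" using s1 by auto
    then have "e \<inter> S = {}" using piT[of w] sub(1) disj by auto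
    then have w': "w' \<in> Sat" "e = {w', \<pi> w'}" using s2 A by auto
    have "w = w'" using w w' piT[of w] piT[of w'] by (auto simp: doubleton_eq_iff)
    then show ?thesis using sn_unique[of w a] sn_unique[of w' a'] w w' A by auto
  qed
  then show ?thesis by (simp add: tw)
qed

definition outer_edges :: "nat set set" where "outer_edges = {e\<in>E. e \<inter> S \<noteq> {}}"
definition inner_edges :: "nat set set" where "inner_edges = {e\<in>E. e \<inter> S = {}}"

definition S_end :: "nat set \<Rightarrow> nat" where "S_end e = (THE x. x \<in> e \<inter> S)"

lemma S_end_eq: "x \<in> S \<Longrightarrow> w \<in> T \<Longrightarrow> S_end {x, w} = x"
  unfolding S_end_def using disj by (intro the_equality) auto

lemma outer_edges_cases:
  assumes "e \<in> outer_edges"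
  obtains x w where "x \<in> S" "w \<in> T" "e = {x, w}" "{x, w} \<in> E"
proof -
  from assms have e: "e \<in> E" "e \<inter> S \<noteq> {}" by (auto simp: outer_edges_def)
  from edge[OF e(1)] obtain u v where uv: "u \<in> S \<union> T" "v \<in> T" "e = {u, v}" by auto
  then have "u \<in> S" using e(2) disj by auto
  then show ?thesis using that uv e(1) by auto
qed

text \<open>The target exponent splits into the tokens and one edge per free vertex, the latter
  matching the monomial produced by the free forms.\<close>

lemma outer_edges_sum: "(\<Sum>f\<in>outer_edges. mono1 (S_end f)) = (\<Sum>t\<in>Tok. mono1 (fst t)) + (\<Sum>w\<in>Free. mono1 (sn w))"
proof -
  let ?g = "\<lambda>t :: nat \<times> nat. {fst t, snd t}"
  define A where "A = Tok \<union> (\<lambda>w. (sn w, w)) ` Free"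
  have finA: "finite A" "finite Free" using finTok fin sub by (auto simp: A_def intro: finite_subset)
  have A: "fst t \<in> S \<and> snd t \<in> T" if "t \<in> A" for t
    using that sub sn(1) by (auto simp: A_def Tok_def)
  have inj: "inj_on ?g A"
  proof (rule inj_onI)
    fix t t' assume t: "t \<in> A" "t' \<in> A" "?g t = ?g t'"
    then show "t = t'" using A[OF t(1)] A[OF t(2)] ST_neq by (cases t; cases t') (auto simp: doubleton_eq_iff)
  qed
  have img: "?g ` A = outer_edges"
  proof
    show "?g ` A \<subseteq> outer_edges" using sub sn by (auto simp: A_def Tok_def outer_edges_def)
    show "outer_edges \<subseteq> ?g ` A"
    proof
      fix e assume "e \<in> outer_edges"
      then obtain x w where x: "x \<in> S" "w \<in> T" "e = {x, w}" "{x, w} \<in> E" by (rule outer_edges_cases)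
      have "(x, w) \<in> A"
      proof (cases "w \<in> Free")
        case True
        then have "x = sn w" using sn_unique[of w x] x by auto
        then show ?thesis using True by (auto simp: A_def)
      next
        case False
        then show ?thesis using x by (auto simp: A_def Tok_def)
      qed
      then show "e \<in> ?g ` A" using x by force
    qed
  qed
  have "(\<Sum>f\<in>outer_edges. mono1 (S_end f)) = (\<Sum>t\<in>A. mono1 (S_end (?g t)))"
    unfolding img[symmetric] by (subst sum.reindex[OF inj]) simp
  also have "\<dots> = (\<Sum>t\<in>A. mono1 (fst t))"
    by (intro sum.cong refl) (use A S_end_eq in auto)
  also have "\<dots> = (\<Sum>t\<in>Tok. mono1 (fst t)) + (\<Sum>t\<in>(\<lambda>w. (sn w, w)) ` Free. mono1 (fst t))"
    unfolding A_def using finTok finA by (intro sum.union_disjoint) (auto simp: Tok_def)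
  also have "(\<Sum>t\<in>(\<lambda>w. (sn w, w)) ` Free. mono1 (fst t)) = (\<Sum>w\<in>Free. mono1 (sn w))"
    by (subst sum.reindex) (auto simp: inj_on_def)
  finally show ?thesis .
qed

lemma edge_diff_pair:
  assumes "u \<noteq> v"
  shows "edge_diff E {u, v} a = (if Min {u, v} = u then 1 else - 1) * (vweight E a u - vweight E a v)"
  using assms by (auto simp: edge_diff_def min_def max_def)

text \<open>When the vertex sums vanish on \<open>T\<close>, the row of an outer edge is, up to
  sign, the vertex sum at its end in \<open>S\<close>. Rows with the same end repeat, and the
  permanent becomes a coefficient of a power of 2 times a monomial times
  \<open>pforms ps\<close>.\<close>

lemma ex_outer_directions:
  "\<exists>ws. permanent (edge_diff E) outer_edges ws \<noteq> 0 \<and> (\<forall>a\<in>set ws. \<forall>x\<in>T. vweight E a x = 0) \<and>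
    (\<forall>e. load ws e \<le> (if \<exists>t\<in>Tok. half_form t e \<noteq> 0 then 4 else 0) + card {w\<in>Free. free_form w e \<noteq> 0})"
proof -
  have "\<exists>ps. (\<forall>p\<in>set ps. fst p \<in> Tok \<and> snd p \<in> Tok \<and> centre (fst p) = centre (snd p) \<and> fst p \<noteq> snd p) \<and>
    (\<forall>t. occ ps t \<le> 4) \<and> Poly_Mapping.lookup (pforms ps) (\<Sum>t\<in>Tok. mono1 (fst t)) \<noteq> 0"
    by (rule token_pairs[OF finTok], erule (3) Tok_fst_inj, erule Tok_centre_two)
  then obtain ps where ps: "\<forall>p\<in>set ps. fst p \<in> Tok \<and> snd p \<in> Tok \<and> centre (fst p) = centre (snd p) \<and> fst p \<noteq> snd p"
    "\<forall>t. occ ps t \<le> 4" "Poly_Mapping.lookup (pforms ps) (\<Sum>t\<in>Tok. mono1 (fst t)) \<noteq> 0"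
    by (elim exE conjE) (rule that)
  have "finite Free" using fin sub by (auto intro: finite_subset)
  then obtain fl where fl: "distinct fl" "set fl = Free" using finite_distinct_list by blast
  define ws where "ws = map free_form fl @ map pair_form ps"
  have lin: "linform S (vweight E (pair_form p)) = pform p" if p: "p \<in> set ps" for p
  proof -
    obtain t t' where tt: "p = (t, t')" by (cases p)
    have T: "t \<in> Tok" "t' \<in> Tok" "centre t = centre t'" "t \<noteq> t'" using ps(1) p by (auto simp: tt)
    then have ft: "fst t \<noteq> fst t'" using Tok_fst_inj[of t t'] by blast
    have S: "fst t \<in> S" "fst t' \<in> S" using T by (auto simp: Tok_def)
    have "linform S (vweight E (pair_form p)) = (\<Sum>x\<in>S. (if x = fst t then Poly_Mapping.single (mono1 (fst t)) 1 else 0)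
        + (if x = fst t' then Poly_Mapping.single (mono1 (fst t')) (- (tsign t * tsign t')) else 0))"
      unfolding linform_def tt vweight_pair_form[OF T(1-3)]
      using ft by (intro sum.cong refl) auto
    also have "\<dots> = pform p" using S fin by (simp add: sum.distrib pform_def bform_def tt)
    finally show ?thesis .
  qed
  have linf: "linform S (vweight E (free_form w)) = Poly_Mapping.single (mono1 (sn w)) 2" if w: "w \<in> Free" for w
  proof -
    have S: "sn w \<in> S" using w sub sn(1) by auto
    have "linform S (vweight E (free_form w)) = (\<Sum>x\<in>S. if x = sn w then Poly_Mapping.single (mono1 (sn w)) 2 else 0)"
      unfolding linform_def vweight_free_form[OF w] by (intro sum.cong refl) auto
    also have "\<dots> = Poly_Mapping.single (mono1 (sn w)) 2" using S fin by simp
    finally show ?thesis .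
  qed
  have prod_free: "prod_list (map (\<lambda>w. linform S (vweight E (free_form w))) xs) =
      Poly_Mapping.single (\<Sum>w\<leftarrow>xs. mono1 (sn w)) (2 ^ length xs)" if "set xs \<subseteq> Free" for xs
    using that by (induction xs) (simp_all add: linf mult_single)
  have sum_free: "(\<Sum>w\<leftarrow>fl. mono1 (sn w)) = (\<Sum>w\<in>Free. mono1 (sn w))"
    using fl by (simp add: sum_list_distinct_conv_sum_set)
  have prod: "prod_list (map (linform S) (map (vweight E) ws)) =
      Poly_Mapping.single (\<Sum>w\<in>Free. mono1 (sn w)) (2 ^ length fl) * pforms ps"
  proof -
    have "prod_list (map (\<lambda>w. linform S (vweight E (free_form w))) fl) =
      Poly_Mapping.single (\<Sum>w\<in>Free. mono1 (sn w)) (2 ^ length fl)"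
      using prod_free[of fl] fl(2) by (simp add: sum_free)
    moreover have "map (\<lambda>p. linform S (vweight E (pair_form p))) ps = map pform ps"
      using lin by simp
    ultimately show ?thesis by (simp only: ws_def map_append map_map comp_def pforms_def prod_list.append)
  qed
  have vT: "vweight E a x = 0" if "a \<in> set ws" "x \<in> T" for a x
  proof -
    from that(1) consider w where "w \<in> Free" "a = free_form w" | p where "p \<in> set ps" "a = pair_form p"
      using fl by (auto simp: ws_def)
    then show ?thesis
    proof cases
      case 1
      then have "sn w \<in> S" using sub sn(1) by auto
      then show ?thesis using 1 that(2) ST_neq by (auto simp: vweight_free_form)
    next
      case 2
      obtain t t' where tt: "p = (t, t')" by (cases p)
      have T: "t \<in> Tok" "t' \<in> Tok" "centre t = centre t'" using ps(1) 2 by (auto simp: tt)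
      moreover have "fst t \<in> S" "fst t' \<in> S" using T by (auto simp: Tok_def)
      ultimately show ?thesis using 2 that(2) ST_neq by (auto simp: tt vweight_pair_form)
    qed
  qed
  have fin_outer: "finite outer_edges" using fin by (simp add: outer_edges_def)
  define \<epsilon> :: "nat set \<Rightarrow> int" where "\<epsilon> f = (if Min f = S_end f then 1 else -1)" for f
  have ed: "edge_diff E f a = \<epsilon> f * vweight E a (S_end f)" if f: "f \<in> outer_edges" and a: "a \<in> set ws" for f a
  proof -
    from f obtain x w where x: "x \<in> S" "w \<in> T" "f = {x, w}" "{x, w} \<in> E" by (rule outer_edges_cases)
    then show ?thesis
      using edge_diff_pair[OF ST_neq[OF x(1,2)], of a] vT[OF a x(2)] S_end_eq[OF x(1,2)]
      by (simp add: \<epsilon>_def)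
  qed
  have "permanent (edge_diff E) outer_edges ws = (\<Prod>f\<in>outer_edges. \<epsilon> f) * permanent (\<lambda>f a. vweight E a (S_end f)) outer_edges ws"
    by (rule permanent_row_scale[OF fin_outer ed])
  also have "permanent (\<lambda>f a. vweight E a (S_end f)) outer_edges ws = permanent (\<lambda>f w. w (S_end f)) outer_edges (map (vweight E) ws)"
    by (rule permanent_map)
  also have "\<dots> = (\<Prod>x\<in>S. fact (card {f\<in>outer_edges. S_end f = x})) *
      Poly_Mapping.lookup (prod_list (map (linform S) (map (vweight E) ws))) (\<Sum>f\<in>outer_edges. mono1 (S_end f))"
  proof (rule permanent_eq_lookup_prod_list[OF fin_outer fin(2)])
    show "S_end ` outer_edges \<subseteq> S" using S_end_eq by (auto elim!: outer_edges_cases)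
  qed
  also have "Poly_Mapping.lookup (prod_list (map (linform S) (map (vweight E) ws))) (\<Sum>f\<in>outer_edges. mono1 (S_end f)) =
      2 ^ length fl * Poly_Mapping.lookup (pforms ps) (\<Sum>t\<in>Tok. mono1 (fst t))"
    unfolding prod outer_edges_sum by (subst add.commute) (rule lookup_single_mult_add)
  finally have nz: "permanent (edge_diff E) outer_edges ws \<noteq> 0"
    using ps(3) fin_outer fin(2) by (auto simp: \<epsilon>_def)
  have "load ws e \<le> (if \<exists>t\<in>Tok. half_form t e \<noteq> 0 then 4 else 0) + card {w\<in>Free. free_form w e \<noteq> 0}" for e
  proof -
    have "load (map free_form fl) e = card {w\<in>Free. free_form w e \<noteq> 0}"
      using load_map_distinct[OF fl(1)] fl(2) by simp
    moreover have "load (map pair_form ps) e \<le> (if \<exists>t\<in>Tok. half_form t e \<noteq> 0 then 4 else 0)"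
    proof -
      have supp: "half_form (fst p) e \<noteq> 0 \<or> half_form (snd p) e \<noteq> 0" if "pair_form p e \<noteq> 0" for p
        using that by (auto simp: pair_form_def)
      show ?thesis
      proof (cases "\<exists>t\<in>Tok. half_form t e \<noteq> 0")
        case True
        then obtain t where t: "t \<in> Tok" "half_form t e \<noteq> 0" by auto
        have "fst p = t \<or> snd p = t" if "p \<in> set ps" "pair_form p e \<noteq> 0" for p
          using supp[OF that(2)] ps(1) that(1) half_form_support_unique[OF _ t(1) _ t(2)] by blast
        then have "filter (\<lambda>p. pair_form p e \<noteq> 0) ps = filter (\<lambda>p. pair_form p e \<noteq> 0) (filter (\<lambda>p. fst p = t \<or> snd p = t) ps)"
          unfolding filter_filter by (intro filter_cong) auto
        then have "length (filter (\<lambda>p. pair_form p e \<noteq> 0) ps) =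
            length (filter (\<lambda>p. pair_form p e \<noteq> 0) (filter (\<lambda>p. fst p = t \<or> snd p = t) ps))"
          by (rule arg_cong)
        also have "\<dots> \<le> occ ps t" unfolding occ_def by (rule length_filter_le)
        finally have "load (map pair_form ps) e \<le> occ ps t"
          unfolding load_def filter_map comp_def length_map .
        then show ?thesis using True ps(2)[rule_format, of t] by simp
      next
        case False
        have "pair_form p e = 0" if "p \<in> set ps" for p
          using supp[of p] False ps(1) that by blast
        then have "load (map pair_form ps) e = 0"
          by (simp add: load_def filter_map comp_def)
        then show ?thesis by simp
      qed
    qed
    ultimately show ?thesis by (simp add: ws_def)
  qed
  then show ?thesis using nz vT by (intro exI[of _ ws] conjI ballI allI)
qed

subsection \<open>Edges inside \<open>T\<close>\<close>

text \<open>Any linear order in which satellites precede all other vertices would do; it makes each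
  edge \<open>{w, \<pi> w}\<close> run from the satellite to its centre.\<close>

definition rank :: "nat \<Rightarrow> nat" where
  "rank v = (if v \<in> Sat then v else v + Suc (Max (insert 0 T)))"

lemma rank_Sat: "u \<in> Sat \<Longrightarrow> v \<notin> Sat \<Longrightarrow> rank u < rank v"
proof -
  assume a: "u \<in> Sat" "v \<notin> Sat"
  then have "u \<le> Max (insert 0 T)" using sub fin by (intro Max_ge) auto
  then show ?thesis using a by (simp add: rank_def)
qed

lemma rank_inj: "rank u = rank v \<Longrightarrow> u = v"
  using rank_Sat[of u v] rank_Sat[of v u] by (cases "u \<in> Sat"; cases "v \<in> Sat") (auto simp: rank_def)

definition tail_of :: "nat set \<Rightarrow> nat" where "tail_of e = (THE u. u \<in> e \<and> (\<forall>v\<in>e. rank u \<le> rank v))"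
definition head_of :: "nat set \<Rightarrow> nat" where "head_of e = (THE u. u \<in> e \<and> (\<forall>v\<in>e. rank v \<le> rank u))"

lemma tail_of_head_of: "rank u < rank w \<Longrightarrow> tail_of {u, w} = u \<and> head_of {u, w} = w"
  unfolding tail_of_def head_of_def by (intro conjI the_equality) auto

lemma inner_edges_cases:
  assumes "f \<in> inner_edges"
  obtains u w where "u \<in> T" "w \<in> T" "rank u < rank w" "f = {u, w}" "{u, w} \<in> E" "tail_of f = u" "head_of f = w"
proof -
  from assms have f: "f \<in> E" "f \<inter> S = {}" by (auto simp: inner_edges_def)
  from edge[OF f(1)] obtain u v where uv: "u \<in> S \<union> T" "v \<in> T" "u \<noteq> v" "f = {u, v}" by auto
  then have uT: "u \<in> T" using f(2) by auto
  have "rank u \<noteq> rank v" using uv(3) rank_inj by auto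
  then consider "rank u < rank v" | "rank v < rank u" by linarith
  then show ?thesis
  proof cases
    case 1
    then show ?thesis using that[of u v] uT uv f tail_of_head_of[OF 1] by simp
  next
    case 2
    then show ?thesis using that[of v u] uT uv f tail_of_head_of[OF 2] by (simp add: insert_commute)
  qed
qed

lemma edge_order_eq:
  assumes "{x, w} = {x', w'}" "rank x < rank w" "rank x' < rank w'"
  shows "x = x' \<and> w = w'"
  using assms by (auto simp: doubleton_eq_iff)

text \<open>Satellites of \<open>w\<close> are left out, since their edges to \<open>w\<close> may
  already carry four directions and must not serve as links.\<close>

definition in_nbrs :: "nat \<Rightarrow> nat set" where
  "in_nbrs w = {x\<in>T. {x, w} \<in> E \<and> rank x < rank w \<and> \<not> (x \<in> Sat \<and> \<pi> x = w)}"

definition pred_nbr :: "nat \<Rightarrow> nat \<Rightarrow> nat option" where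
  "pred_nbr w k = (if \<exists>x\<in>in_nbrs w. rank x < k
     then Some (SOME x. x \<in> in_nbrs w \<and> rank x < k \<and> (\<forall>y\<in>in_nbrs w. rank y < k \<longrightarrow> rank y \<le> rank x)) else None)"

lemma pred_nbr_Some:
  assumes "pred_nbr w k = Some x"
  shows "x \<in> in_nbrs w" "rank x < k" "\<And>y. y \<in> in_nbrs w \<Longrightarrow> rank y < k \<Longrightarrow> rank y \<le> rank x"
proof -
  let ?P = "\<lambda>x. x \<in> in_nbrs w \<and> rank x < k"
  from assms obtain z where z: "?P z" and x: "x = (SOME x. x \<in> in_nbrs w \<and> rank x < k \<and> (\<forall>y\<in>in_nbrs w. rank y < k \<longrightarrow> rank y \<le> rank x))"
    by (auto simp: pred_nbr_def split: if_splits)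
  have "\<exists>x. ?P x \<and> (\<forall>y. ?P y \<longrightarrow> rank y \<le> rank x)"
    by (rule ex_has_greatest_nat[of ?P z rank k]) (use z in auto)
  then have "\<exists>x. x \<in> in_nbrs w \<and> rank x < k \<and> (\<forall>y\<in>in_nbrs w. rank y < k \<longrightarrow> rank y \<le> rank x)" by auto
  from someI_ex[OF this] have "x \<in> in_nbrs w \<and> rank x < k \<and> (\<forall>y\<in>in_nbrs w. rank y < k \<longrightarrow> rank y \<le> rank x)"
    unfolding x .
  then show "x \<in> in_nbrs w" "rank x < k" "\<And>y. y \<in> in_nbrs w \<Longrightarrow> rank y < k \<Longrightarrow> rank y \<le> rank x" by auto
qed

lemma pred_nbr_None: "pred_nbr w k = None \<Longrightarrow> x \<in> in_nbrs w \<Longrightarrow> \<not> rank x < k"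
  by (auto simp: pred_nbr_def split: if_splits)

text \<open>If \<open>w = \<tau> y\<close> with \<open>w\<close> itself not free, the edge from \<open>w\<close> to \<open>sn y\<close> already carries up to five
  directions; the base of \<open>w\<close> is then the detour through \<open>y\<close>.\<close>

definition has_leaf :: "nat \<Rightarrow> bool" where "has_leaf w \<longleftrightarrow> w \<notin> Free \<and> w \<in> \<tau> ` Free"
definition leaf_of :: "nat \<Rightarrow> nat" where "leaf_of w = (SOME y. y \<in> Free \<and> \<tau> y = w)"

lemma leaf_of: "has_leaf w \<Longrightarrow> leaf_of w \<in> Free \<and> \<tau> (leaf_of w) = w"
  unfolding leaf_of_def has_leaf_def by (rule someI_ex) auto

definition base_sign :: "nat \<Rightarrow> int" where "base_sign w = (if has_leaf w then - 1 else 1)"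

definition base_form :: "nat \<Rightarrow> nat set \<Rightarrow> int" where
  "base_form w = (if has_leaf w then (\<lambda>e. edge_ind {sn (leaf_of w), leaf_of w} e - edge_ind {leaf_of w, w} e) else edge_ind {sn w, w})"

lemma vweight_base_form:
  assumes "w \<in> T" "x \<in> T"
  shows "vweight E (base_form w) x = base_sign w * (if x = w then 1 else 0)"
proof (cases "has_leaf w")
  case True
  define y where "y = leaf_of w"
  have y: "y \<in> Free" "\<tau> y = w" using leaf_of[OF True] by (auto simp: y_def)
  have yT: "y \<in> T" "sn y \<in> S" "{sn y, y} \<in> E" using y sub sn by auto
  have "vweight E (base_form w) x = vweight E (edge_ind {sn y, y}) x - vweight E (edge_ind {y, w}) x"
    using True by (simp add: base_form_def y_def vweight_diff)
  then show ?thesis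
    using True yT tau(2)[OF y(1)] tau_neq[OF y(1)] y(2) ST_neq[OF yT(2,1)] ST_neq[OF yT(2) assms(2)] fin(1)
    by (auto simp: vweight_ind base_sign_def)
next
  case False
  then show ?thesis
    using sn[OF assms(1)] ST_neq[OF sn(1)[OF assms(1)] assms(1)] ST_neq[OF sn(1)[OF assms(1)] assms(2)] fin(1)
    by (auto simp: base_form_def vweight_ind base_sign_def)
qed

lemma base_form_support:
  assumes "base_form w e \<noteq> 0"
  shows "(\<not> has_leaf w \<and> e = {sn w, w}) \<or> (has_leaf w \<and> (e = {sn (leaf_of w), leaf_of w} \<or> e = {leaf_of w, w}))"
  using assms by (simp add: base_form_def edge_ind_def split: if_splits)

definition link_form :: "nat \<Rightarrow> nat \<Rightarrow> nat set \<Rightarrow> int" where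
  "link_form w k e = (case pred_nbr w k of None \<Rightarrow> base_sign w * base_form w e | Some x \<Rightarrow> edge_ind {x, w} e)"

lemma vweight_link_form:
  assumes "w \<in> T" "x \<in> T"
  shows "vweight E (link_form w k) x = (if x = w then 1 else 0) + (case pred_nbr w k of None \<Rightarrow> 0 | Some y \<Rightarrow> if x = y then 1 else 0)"
proof (cases "pred_nbr w k")
  case None
  then have "link_form w k = (\<lambda>e. base_sign w * base_form w e)"
    by (simp add: link_form_def[abs_def])
  then have "vweight E (link_form w k) x = base_sign w * vweight E (base_form w) x"
    by (simp add: vweight_scale)
  then show ?thesis using None by (simp add: vweight_base_form[OF assms] base_sign_def)
next
  case (Some y)
  have y: "{y, w} \<in> E" "rank y < rank w" using pred_nbr_Some(1)[OF Some] by (auto simp: in_nbrs_def)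
  then have "y \<noteq> w" by auto
  moreover have "link_form w k = edge_ind {y, w}" by (rule ext) (simp add: link_form_def Some)
  ultimately show ?thesis using Some y fin(1) by (simp add: vweight_ind)
qed

definition star_edge :: "nat set \<Rightarrow> bool" where "star_edge f \<longleftrightarrow> tail_of f \<in> Sat \<and> \<pi> (tail_of f) = head_of f"
definition link_centre :: "nat set \<Rightarrow> nat" where "link_centre f = (if star_edge f then tail_of f else head_of f)"

text \<open>An edge from \<open>u\<close> to a later vertex \<open>w\<close> needs a direction that is \<open>u\<close> modulo \<open>S\<close> and earlier vertices
  of \<open>T\<close>. Walking via \<open>w\<close> to the preceding earlier neighbour of \<open>w\<close>, or to the base of \<open>w\<close> if there is none,
  uses each edge at most twice. Star edges may carry four directions already, so a satellite pays
  for its star edge with the last link at the satellite itself.\<close>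

definition inner_form :: "nat set \<Rightarrow> nat set \<Rightarrow> int" where
  "inner_form f e = (if star_edge f then link_form (link_centre f) (rank (tail_of f)) e else edge_ind f e - link_form (link_centre f) (rank (tail_of f)) e)"

lemma vweight_inner_form:
  assumes f: "f \<in> inner_edges" and x: "x \<in> T"
  shows "rank (tail_of f) < rank x \<Longrightarrow> vweight E (inner_form f) x = 0" "x = tail_of f \<Longrightarrow> vweight E (inner_form f) x = 1"
proof -
  from f obtain u w where u: "u \<in> T" "w \<in> T" "rank u < rank w" "f = {u, w}" "{u, w} \<in> E" "tail_of f = u" "head_of f = w"
    by (rule inner_edges_cases)
  have uw: "u \<noteq> w" using u by auto
  have it: "(case pred_nbr v (rank u) of None \<Rightarrow> 0 | Some y \<Rightarrow> if x = y then 1 else 0) = (0::int)" if "rank u \<le> rank x" for v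
    using that by (auto split: option.splits dest: pred_nbr_Some(2))
  have "vweight E (inner_form f) x = (if x = u then 1 else 0)" if ux: "rank u \<le> rank x"
  proof (cases "star_edge f")
    case True
    then have "inner_form f = link_form u (rank u)" using u by (simp add: inner_form_def[abs_def] link_centre_def)
    then show ?thesis using it[OF ux, of u] by (simp add: vweight_link_form[OF u(1) x])
  next
    case False
    then have "inner_form f = (\<lambda>e. edge_ind {u, w} e - link_form w (rank u) e)" using u by (simp add: inner_form_def[abs_def] link_centre_def)
    then have "vweight E (inner_form f) x = vweight E (edge_ind {u, w}) x - vweight E (link_form w (rank u)) x" by (simp add: vweight_diff)
    then show ?thesis using it[OF ux, of w] u uw fin(1) by (simp add: vweight_link_form[OF u(2) x] vweight_ind)
  qed
  then show "rank (tail_of f) < rank x \<Longrightarrow> vweight E (inner_form f) x = 0" "x = tail_of f \<Longrightarrow> vweight E (inner_form f) x = 1"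
    using u by auto
qed

text \<open>A direction vanishes at all vertices after its tail, so the later end of a row
  contributes nothing to columns with the same or an earlier tail. Edges with a common tail form a
  diagonal block whose rows are constantly 1 or constantly -1.\<close>

lemma ex_inner_directions:
  "\<exists>fs. distinct fs \<and> set fs = inner_edges \<and> permanent (edge_diff E) inner_edges (map inner_form fs) \<noteq> 0"
proof -
  define t where "t f = rank (tail_of f)" for f
  have fin_inner: "finite inner_edges" using fin by (simp add: inner_edges_def)
  then obtain xs where xs: "distinct xs" "set xs = inner_edges" using finite_distinct_list by blast
  define fs where "fs = sort_key t xs"
  have fs: "distinct fs" "set fs = inner_edges" "sorted (map t fs)" using xs by (simp_all add: fs_def)
  have ms: "image_mset t (mset_set inner_edges) = mset (map t fs)"
    using fs(1,2) by (metis mset_map mset_set_set)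
  define \<epsilon> :: "nat set \<Rightarrow> int" where "\<epsilon> f = (if Min f = tail_of f then 1 else - 1)" for f
  have "\<exists>N>0. permanent (edge_diff E) inner_edges (map inner_form fs) = (\<Prod>f\<in>inner_edges. \<epsilon> f) * N"
  proof (rule permanent_triangular[OF fin_inner ms fs(3)])
    fix f g assume f: "f \<in> inner_edges" and "g \<in> set fs" and tt: "t g < t f"
    then have g: "g \<in> inner_edges" using fs by simp
    from f obtain u w where u: "u \<in> T" "w \<in> T" "rank u < rank w" "f = {u, w}" "{u, w} \<in> E" "tail_of f = u" "head_of f = w"
      by (rule inner_edges_cases)
    have "vweight E (inner_form g) u = 0" "vweight E (inner_form g) w = 0"
      using vweight_inner_form(1)[OF g] u tt by (auto simp: t_def)
    moreover have "u \<noteq> w" using u by auto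
    ultimately show "edge_diff E f (inner_form g) = 0" using u(4) edge_diff_pair[of u w "inner_form g"] by simp
  next
    fix f g assume f: "f \<in> inner_edges" and "g \<in> set fs" and tt: "t f = t g"
    then have g: "g \<in> inner_edges" using fs by simp
    from f obtain u w where u: "u \<in> T" "w \<in> T" "rank u < rank w" "f = {u, w}" "{u, w} \<in> E" "tail_of f = u" "head_of f = w"
      by (rule inner_edges_cases)
    have gu: "tail_of g = u" using tt u rank_inj by (auto simp: t_def)
    have "vweight E (inner_form g) u = 1" "vweight E (inner_form g) w = 0"
      using vweight_inner_form[OF g] u gu by auto
    moreover have "u \<noteq> w" using u by auto
    ultimately show "edge_diff E f (inner_form g) = \<epsilon> f"
      using edge_diff_pair[of u w "inner_form g"] u by (simp add: \<epsilon>_def)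
  qed
  moreover have "(\<Prod>f\<in>inner_edges. \<epsilon> f) \<noteq> 0" using fin_inner by (simp add: \<epsilon>_def)
  ultimately show ?thesis using fs by (intro exI[of _ fs]) auto
qed

section \<open>Multiplicity of links and bases\<close>

lemma link_centre_cases:
  assumes f: "f \<in> inner_edges"
  shows "(\<not> star_edge f \<and> tail_of f \<in> in_nbrs (link_centre f)) \<or> (star_edge f \<and> tail_of f = link_centre f)"
proof -
  from f obtain u w where "u \<in> T" "w \<in> T" "rank u < rank w" "f = {u, w}" "{u, w} \<in> E" "tail_of f = u" "head_of f = w"
    by (rule inner_edges_cases)
  then show ?thesis by (auto simp: link_centre_def star_edge_def in_nbrs_def)
qed

lemma link_centre_T: "f \<in> inner_edges \<Longrightarrow> link_centre f \<in> T"
  by (erule inner_edges_cases) (simp add: link_centre_def)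

text \<open>The tail of \<open>f\<close> is itself an earlier neighbour of the common centre: it
  comes after the predecessor chosen for \<open>f\<close>, but not after the one chosen for
  \<open>g\<close>.\<close>

lemma pred_nbr_less:
  assumes f: "f \<in> inner_edges" and g: "g \<in> inner_edges" and l: "link_centre f = link_centre g" and k: "rank (tail_of f) < rank (tail_of g)"
  shows "pred_nbr (link_centre f) (rank (tail_of f)) \<noteq> pred_nbr (link_centre g) (rank (tail_of g))"
proof
  assume eq: "pred_nbr (link_centre f) (rank (tail_of f)) = pred_nbr (link_centre g) (rank (tail_of g))"
  have "rank (tail_of g) \<le> rank (link_centre g)" using link_centre_cases[OF g] by (auto simp: in_nbrs_def)
  then have "tail_of f \<in> in_nbrs (link_centre f)" using link_centre_cases[OF f] k l by auto
  then have inf: "tail_of f \<in> in_nbrs (link_centre g)" using l by simp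
  show False
  proof (cases "pred_nbr (link_centre g) (rank (tail_of g))")
    case None
    then show ?thesis using pred_nbr_None[OF None inf] k by simp
  next
    case (Some x)
    then have "rank x < rank (tail_of f)" using pred_nbr_Some(2)[of "link_centre f" "rank (tail_of f)" x] eq by simp
    moreover have "rank (tail_of f) \<le> rank x" using pred_nbr_Some(3)[OF Some inf k] .
    ultimately show False by simp
  qed
qed

lemma pred_nbr_inj:
  assumes f: "f \<in> inner_edges" and g: "g \<in> inner_edges" and l: "link_centre f = link_centre g"
    and eq: "pred_nbr (link_centre f) (rank (tail_of f)) = pred_nbr (link_centre g) (rank (tail_of g))"
  shows "f = g"
proof -
  have "rank (tail_of f) = rank (tail_of g)"
    using pred_nbr_less[OF f g l] pred_nbr_less[OF g f l[symmetric]] eq by (metis linorder_neqE_nat)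
  then have t: "tail_of f = tail_of g" by (rule rank_inj)
  from f obtain u w where u: "rank u < rank w" "f = {u, w}" "tail_of f = u" "head_of f = w" by (rule inner_edges_cases)
  from g obtain u' w' where u': "rank u' < rank w'" "g = {u', w'}" "tail_of g = u'" "head_of g = w'" by (rule inner_edges_cases)
  have "w = w'"
    using l t u u' by (auto simp: link_centre_def star_edge_def split: if_splits)
  then show ?thesis using t u u' by simp
qed

text \<open>The inner edges whose walk uses a given link of \<open>w\<close>, or the base of
  \<open>w\<close> for \<open>None\<close>. Such a class has at most one element, so loads are
  counted in classes.\<close>

definition link_class :: "nat \<Rightarrow> nat option \<Rightarrow> nat set set" where
  "link_class w i = {f\<in>inner_edges. link_centre f = w \<and> pred_nbr w (rank (tail_of f)) = i}"

lemma finite_link_class: "finite (link_class w i)"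
  using fin by (simp add: link_class_def inner_edges_def)

lemma card_link_class: "card (link_class w i) \<le> 1"
  by (rule card_le_1) (rule pred_nbr_inj, auto simp: link_class_def)

lemma link_form_support:
  assumes "f \<in> inner_edges" "link_form (link_centre f) (rank (tail_of f)) e \<noteq> 0"
  shows "(\<exists>x\<in>in_nbrs (link_centre f). e = {x, link_centre f} \<and> f \<in> link_class (link_centre f) (Some x)) \<or> (base_form (link_centre f) e \<noteq> 0 \<and> f \<in> link_class (link_centre f) None)"
proof (cases "pred_nbr (link_centre f) (rank (tail_of f))")
  case None
  then show ?thesis using assms by (auto simp: link_form_def link_class_def)
next
  case (Some x)
  then have "e = {x, link_centre f}" using assms by (simp add: link_form_def edge_ind_def split: if_splits)
  then show ?thesis using Some assms pred_nbr_Some(1)[OF Some] by (auto simp: link_class_def)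
qed

lemma inner_form_support:
  assumes "f \<in> inner_edges" "inner_form f e \<noteq> 0"
  shows "(f = e \<and> \<not> star_edge e) \<or> link_form (link_centre f) (rank (tail_of f)) e \<noteq> 0"
  using assms by (auto simp: inner_form_def edge_ind_def split: if_splits)

subsection \<open>Counting the directions at an edge\<close>

definition total_load :: "nat set \<Rightarrow> nat" where
  "total_load e = (if \<exists>t\<in>Tok. half_form t e \<noteq> 0 then 4 else 0) + card {w\<in>Free. free_form w e \<noteq> 0} +
    card {f\<in>inner_edges. inner_form f e \<noteq> 0}"

lemma free_form_support:
  "free_form v e \<noteq> 0 \<Longrightarrow> e = {sn v, v} \<or> e = {sn v, \<tau> v} \<or> e = {v, \<tau> v}"
  by (simp add: free_form_def edge_ind_def split: if_splits)

lemma half_form_support: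
  "half_form t e \<noteq> 0 \<Longrightarrow> e = {fst t, snd t} \<or> (snd t \<in> Sat \<and> e = {snd t, \<pi> (snd t)})"
  by (simp add: half_form_def edge_ind_def split: if_splits)

text \<open>For free \<open>w\<close> there are no pair forms, at most two triangles (that of
  \<open>w\<close> and one with \<open>\<tau> v = w\<close>) and at most two bases (that of
  \<open>w\<close> and the detour of \<open>\<tau> w\<close>). Otherwise the four uses of a token
  are joined by one triangle with \<open>\<tau> v = w\<close> or by the base of \<open>w\<close>,
  not both: such a triangle forces the base onto a detour.\<close>

lemma total_load_outer:
  assumes s: "s \<in> S" and w: "w \<in> T" and e: "e = {s, w}"
  shows "total_load e \<le> 5"
proof -
  have eS: "{u, v} \<noteq> e" if "u \<in> T" "v \<in> T" for u v
    using that s ST_neq by (auto simp: e doubleton_eq_iff)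
  have eST: "u = s \<and> v = w" if "{u, v} = e" "u \<in> S" "v \<in> T" for u v
    using that s w ST_neq by (auto simp: e doubleton_eq_iff)
  have leafT: "has_leaf v \<Longrightarrow> leaf_of v \<in> T \<and> sn (leaf_of v) \<in> S" for v
    using leaf_of[of v] sub sn(1) by auto
  have C: "{f\<in>inner_edges. inner_form f e \<noteq> 0} \<subseteq> (if has_leaf w then {} else link_class w None) \<union> (if w \<in> Free then link_class (\<tau> w) None else {})"
  proof
    fix f assume "f \<in> {f\<in>inner_edges. inner_form f e \<noteq> 0}"
    then have f: "f \<in> inner_edges" "inner_form f e \<noteq> 0" by auto
    have "f \<noteq> e" using f(1) s by (auto simp: inner_edges_def e)
    then have "link_form (link_centre f) (rank (tail_of f)) e \<noteq> 0" using inner_form_support[OF f] by auto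
    from link_form_support[OF f(1) this] show "f \<in> (if has_leaf w then {} else link_class w None) \<union> (if w \<in> Free then link_class (\<tau> w) None else {})"
    proof
      assume "\<exists>x\<in>in_nbrs (link_centre f). e = {x, link_centre f} \<and> f \<in> link_class (link_centre f) (Some x)"
      then show ?thesis using eS link_centre_T[OF f(1)] by (auto simp: in_nbrs_def)
    next
      assume b: "base_form (link_centre f) e \<noteq> 0 \<and> f \<in> link_class (link_centre f) None"
      from base_form_support[of "link_centre f" e] b consider "\<not> has_leaf (link_centre f)" "e = {sn (link_centre f), link_centre f}"
        | "has_leaf (link_centre f)" "e = {sn (leaf_of (link_centre f)), leaf_of (link_centre f)}" | "has_leaf (link_centre f)" "e = {leaf_of (link_centre f), link_centre f}" by auto
      then show ?thesis
      proof cases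
        case 1
        then have "link_centre f = w" using eST[of "sn (link_centre f)" "link_centre f"] link_centre_T[OF f(1)] sn(1) by auto
        then show ?thesis using b 1 by simp
      next
        case 2
        then have "leaf_of (link_centre f) = w" using eST leafT[of "link_centre f"] by auto
        then have "w \<in> Free" "\<tau> w = link_centre f" using leaf_of[OF 2(1)] by auto
        then show ?thesis using b by simp
      next
        case 3
        then show ?thesis using eS[of "leaf_of (link_centre f)" "link_centre f"] leafT[of "link_centre f"] link_centre_T[OF f(1)] by auto
      qed
    qed
  qed
  define B where "B = {v\<in>Free. \<tau> v = w \<and> sn v = s}"
  have finB: "finite B" using fin sub by (auto simp: B_def intro: finite_subset)
  have cB: "card B \<le> 1" by (rule card_le_1) (auto simp: B_def intro: tau(4))
  have F: "{v\<in>Free. free_form v e \<noteq> 0} \<subseteq> (if w \<in> Free then {w} else {}) \<union> B"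
  proof
    fix v assume "v \<in> {v\<in>Free. free_form v e \<noteq> 0}"
    then have v: "v \<in> Free" "free_form v e \<noteq> 0" by auto
    have vT: "v \<in> T" "\<tau> v \<in> T" "sn v \<in> S" using v sub tau(1) sn(1) by auto
    from free_form_support[OF v(2)] consider "e = {sn v, v}" | "e = {sn v, \<tau> v}" | "e = {v, \<tau> v}" by auto
    then show "v \<in> (if w \<in> Free then {w} else {}) \<union> B"
    proof cases
      case 1
      then show ?thesis using eST[of "sn v" v] vT v by auto
    next
      case 2
      then show ?thesis using eST[of "sn v" "\<tau> v"] vT v by (auto simp: B_def)
    next
      case 3
      then show ?thesis using eS[of v "\<tau> v"] vT by auto
    qed
  qed
  show ?thesis
  proof (cases "w \<in> Free")
    case True
    have "\<not> (\<exists>t\<in>Tok. half_form t e \<noteq> 0)"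
    proof
      assume "\<exists>t\<in>Tok. half_form t e \<noteq> 0"
      then obtain t where t: "t \<in> Tok" "half_form t e \<noteq> 0" by auto
      then have T: "fst t \<in> S" "snd t \<in> T" "snd t \<notin> Free" by (auto simp: Tok_def)
      from half_form_support[OF t(2)] show False
        using eST[of "fst t" "snd t"] eS[of "snd t" "\<pi> (snd t)"] T True pi(1) by auto
    qed
    moreover have "card {v\<in>Free. free_form v e \<noteq> 0} \<le> 2"
    proof -
      have "card {v\<in>Free. free_form v e \<noteq> 0} \<le> card ({w} \<union> B)"
        using F True finB by (intro card_mono) auto
      also have "\<dots> \<le> 2" using card_Un_le[of "{w}" B] cB by simp
      finally show ?thesis .
    qed
    moreover have "card {f\<in>inner_edges. inner_form f e \<noteq> 0} \<le> 2"
    proof -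
      have "card {f\<in>inner_edges. inner_form f e \<noteq> 0} \<le> card (link_class w None \<union> link_class (\<tau> w) None)"
        using C finite_link_class by (intro card_mono) (auto split: if_splits)
      also have "\<dots> \<le> 2"
        using card_Un_le[of "link_class w None" "link_class (\<tau> w) None"] card_link_class[of w None] card_link_class[of "\<tau> w" None] by simp
      finally show ?thesis .
    qed
    ultimately show ?thesis by (simp add: total_load_def)
  next
    case False
    have "card {v\<in>Free. free_form v e \<noteq> 0} + card {f\<in>inner_edges. inner_form f e \<noteq> 0} \<le> 1"
    proof (cases "has_leaf w")
      case True
      then have "{f\<in>inner_edges. inner_form f e \<noteq> 0} = {}" using C False by auto
      then have "card {f\<in>inner_edges. inner_form f e \<noteq> 0} = 0" by (simp only: card.empty)
      moreover have "card {v\<in>Free. free_form v e \<noteq> 0} \<le> card B"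
        using F False finB by (intro card_mono) auto
      ultimately show ?thesis using cB by simp
    next
      case nv: False
      then have "B = {}" using False by (auto simp: has_leaf_def B_def)
      then have "{v\<in>Free. free_form v e \<noteq> 0} = {}" using F False by auto
      then have "card {v\<in>Free. free_form v e \<noteq> 0} = 0" by (simp only: card.empty)
      moreover have "card {f\<in>inner_edges. inner_form f e \<noteq> 0} \<le> card (link_class w None)"
        using C nv False finite_link_class by (intro card_mono) auto
      ultimately show ?thesis using card_link_class[of w None] by simp
    qed
    then show ?thesis by (simp add: total_load_def)
  qed
qed

text \<open>A star edge carries pair forms only: its own walk avoids it, it is not a link, and
  neither end is free. Any other inner edge has no pair forms; it carries its own walk, one link,
  and at most two triangles and detours together, because a detour along it needs exactly one free
  end.\<close>

lemma total_load_inner: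
  assumes "e \<in> inner_edges"
  shows "total_load e \<le> 5"
proof -
  from assms obtain x w where e: "x \<in> T" "w \<in> T" "rank x < rank w" "e = {x, w}" "{x, w} \<in> E" "tail_of e = x" "head_of e = w"
    by (rule inner_edges_cases)
  have eS: "{u, v} \<noteq> e" if "u \<in> S" for u v
    using that e ST_neq by (auto simp: doubleton_eq_iff)
  have item_case: "link_centre f = w \<and> y = x" if "y \<in> in_nbrs (link_centre f)" "e = {y, link_centre f}" for f y
    using edge_order_eq[of x w y "link_centre f"] that e by (auto simp: in_nbrs_def)
  have bs_case: "has_leaf (link_centre f) \<and> e = {leaf_of (link_centre f), link_centre f}" if f: "f \<in> inner_edges" and "base_form (link_centre f) e \<noteq> 0" for f
    using base_form_support[OF that(2)] eS sn(1)[OF link_centre_T[OF f]] leaf_of[of "link_centre f"] sub sn(1) by blast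
  have free_case: "e = {v, \<tau> v}" if v: "v \<in> Free" "free_form v e \<noteq> 0" for v
    using free_form_support[OF v(2)] eS[of "sn v"] sn(1) v sub by auto
  have supp: "(f = e \<and> \<not> star_edge e) \<or> (\<not> star_edge e \<and> f \<in> link_class w (Some x)) \<or>
      (has_leaf (link_centre f) \<and> e = {leaf_of (link_centre f), link_centre f} \<and> f \<in> link_class (link_centre f) None)"
    if f: "f \<in> inner_edges" "inner_form f e \<noteq> 0" for f
  proof -
    from inner_form_support[OF f] show ?thesis
    proof
      assume "link_form (link_centre f) (rank (tail_of f)) e \<noteq> 0"
      from link_form_support[OF f(1) this] show ?thesis
      proof
        assume "\<exists>y\<in>in_nbrs (link_centre f). e = {y, link_centre f} \<and> f \<in> link_class (link_centre f) (Some y)"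
        then obtain y where y: "y \<in> in_nbrs (link_centre f)" "e = {y, link_centre f}" "f \<in> link_class (link_centre f) (Some y)" by auto
        have eq: "link_centre f = w" "y = x" using item_case[OF y(1,2)] by auto
        have "x \<in> in_nbrs w" using y(1) unfolding eq .
        then have "\<not> star_edge e" by (auto simp: star_edge_def in_nbrs_def e(6,7))
        then show ?thesis using y(3) unfolding eq by blast
      next
        assume "base_form (link_centre f) e \<noteq> 0 \<and> f \<in> link_class (link_centre f) None"
        then show ?thesis using bs_case[OF f(1)] by blast
      qed
    qed blast
  qed
  show ?thesis
  proof (cases "star_edge e")
    case True
    then have st: "x \<in> Sat" "\<pi> x = w" by (auto simp: star_edge_def e(6,7))
    have nf: "x \<notin> Free" "w \<notin> Free" using st sub(3) pi(1) by auto
    have "{v\<in>Free. free_form v e \<noteq> 0} = {}"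
      using free_case nf e(4) by (auto simp: doubleton_eq_iff)
    then have "card {v\<in>Free. free_form v e \<noteq> 0} = 0" by (simp only: card.empty)
    moreover have "card {f\<in>inner_edges. inner_form f e \<noteq> 0} = 0"
    proof -
      have False if f: "f \<in> inner_edges" "inner_form f e \<noteq> 0" for f
      proof -
        have "has_leaf (link_centre f)" "e = {leaf_of (link_centre f), link_centre f}" using supp[OF f] True by auto
        then show False using leaf_of[of "link_centre f"] nf e(4) by (auto simp: doubleton_eq_iff)
      qed
      then have "{f\<in>inner_edges. inner_form f e \<noteq> 0} = {}" by blast
      then show ?thesis by (simp only: card.empty)
    qed
    ultimately show ?thesis by (simp add: total_load_def)
  next
    case False
    have tok: "\<not> (\<exists>t\<in>Tok. half_form t e \<noteq> 0)"
    proof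
      assume "\<exists>t\<in>Tok. half_form t e \<noteq> 0"
      then obtain t where t: "t \<in> Tok" "half_form t e \<noteq> 0" by auto
      have "fst t \<in> S" using t(1) by (auto simp: Tok_def)
      then have st: "snd t \<in> Sat" "e = {snd t, \<pi> (snd t)}" using half_form_support[OF t(2)] eS by auto
      have "rank (snd t) < rank (\<pi> (snd t))" using rank_Sat[OF st(1)] pi(1)[OF st(1)] by auto
      then have "x = snd t" "w = \<pi> (snd t)" using edge_order_eq[of x w "snd t" "\<pi> (snd t)"] st e by auto
      then have "star_edge e" using st(1) unfolding star_edge_def e(6,7) by simp
      with False show False ..
    qed
    define F where "F = {x, w} \<inter> Free"
    have xw: "x \<noteq> w" using e(3) by auto
    have "{v\<in>Free. free_form v e \<noteq> 0} \<subseteq> F"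
      using free_case e(4) by (auto simp: F_def doubleton_eq_iff)
    then have cF: "card {v\<in>Free. free_form v e \<noteq> 0} \<le> card F" by (intro card_mono) (auto simp: F_def)
    define V where "V = {f\<in>inner_edges. has_leaf (link_centre f) \<and> e = {leaf_of (link_centre f), link_centre f} \<and> f \<in> link_class (link_centre f) None}"
    have V: "f \<in> (if x \<in> Free \<and> w \<notin> Free then link_class w None else if w \<in> Free \<and> x \<notin> Free then link_class x None else {})" if "f \<in> V" for f
    proof -
      have f: "has_leaf (link_centre f)" "e = {leaf_of (link_centre f), link_centre f}" "f \<in> link_class (link_centre f) None" using that by (auto simp: V_def)
      have "link_centre f \<notin> Free" "leaf_of (link_centre f) \<in> Free" using f(1) leaf_of[of "link_centre f"] by (auto simp: has_leaf_def)
      moreover have "(link_centre f = w \<and> leaf_of (link_centre f) = x) \<or> (link_centre f = x \<and> leaf_of (link_centre f) = w)"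
        using f(2) e(4) by (auto simp: doubleton_eq_iff)
      ultimately show ?thesis using f(3) by auto
    qed
    have finV: "finite V" using fin by (simp add: V_def inner_edges_def)
    have sum: "card F + card V \<le> 2"
    proof -
      have FV: "card F \<le> 1 \<and> card V \<le> 1" if ab: "a \<in> Free" "b \<notin> Free" "{x, w} = {a, b}" "V \<subseteq> link_class b None" for a b
      proof -
        have "F = {a}" using ab by (auto simp: F_def)
        moreover have "card V \<le> card (link_class b None)" using ab(4) finite_link_class by (intro card_mono) auto
        ultimately show ?thesis using card_link_class[of b None] by simp
      qed
      consider "x \<in> Free" "w \<in> Free" | "x \<in> Free" "w \<notin> Free" | "w \<in> Free" "x \<notin> Free" | "x \<notin> Free" "w \<notin> Free" by blast
      then show ?thesis
      proof cases
        case 1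
        then have "V = {}" "F = {x, w}" using V by (auto simp: F_def)
        then show ?thesis using xw by simp
      next
        case 2
        then have "V \<subseteq> link_class w None" using V by auto
        then show ?thesis using FV[of x w] 2 by simp
      next
        case 3
        then have "V \<subseteq> link_class x None" using V by auto
        then show ?thesis using FV[of w x] 3 by (simp add: insert_commute)
      next
        case 4
        then have "V = {}" "F = {}" using V by (auto simp: F_def)
        then show ?thesis by simp
      qed
    qed
    have "{f\<in>inner_edges. inner_form f e \<noteq> 0} \<subseteq> {e} \<union> (link_class w (Some x) \<union> V)"
      using supp by (auto simp: V_def)
    then have "card {f\<in>inner_edges. inner_form f e \<noteq> 0} \<le> card ({e} \<union> (link_class w (Some x) \<union> V))"
      using finite_link_class finV by (intro card_mono) auto
    also have "\<dots> \<le> 1 + (1 + card V)"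
      using card_Un_le[of "{e}" "link_class w (Some x) \<union> V"] card_Un_le[of "link_class w (Some x)" V] card_link_class[of w "Some x"] by simp
    finally show ?thesis using cF sum tok by (simp add: total_load_def)
  qed
qed

section \<open>The two blocks combined\<close>

lemma alg_choosable_6: "alg_choosable_1b E 6"
proof -
  obtain ws where ws: "permanent (edge_diff E) outer_edges ws \<noteq> 0" "\<forall>a\<in>set ws. \<forall>x\<in>T. vweight E a x = 0"
    "\<forall>e. load ws e \<le> (if \<exists>t\<in>Tok. half_form t e \<noteq> 0 then 4 else 0) + card {w\<in>Free. free_form w e \<noteq> 0}"
    using ex_outer_directions by (elim exE conjE) (rule that)
  obtain fs where fs: "distinct fs" "set fs = inner_edges" "permanent (edge_diff E) inner_edges (map inner_form fs) \<noteq> 0"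
    using ex_inner_directions by (elim exE conjE) (rule that)
  have fin_edges: "finite outer_edges" "finite inner_edges" using fin by (auto simp: outer_edges_def inner_edges_def)
  have "permanent (edge_diff E) (outer_edges \<union> inner_edges) (ws @ map inner_form fs) = permanent (edge_diff E) outer_edges ws * permanent (edge_diff E) inner_edges (map inner_form fs)"
  proof (rule permanent_append_block[OF fin_edges])
    show "outer_edges \<inter> inner_edges = {}" by (auto simp: outer_edges_def inner_edges_def)
    show "length ws = card outer_edges" by (rule permanent_length[OF fin_edges(1) ws(1)])
    fix g a assume g: "g \<in> inner_edges" and a: "a \<in> set ws"
    from g obtain u w where u: "u \<in> T" "w \<in> T" "rank u < rank w" "g = {u, w}" by (rule inner_edges_cases)
    then have "u \<noteq> w" by auto
    then show "edge_diff E g a = 0" using ws(2) a u edge_diff_pair[of u w a] by simp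
  qed
  moreover have "outer_edges \<union> inner_edges = E" by (auto simp: outer_edges_def inner_edges_def)
  ultimately have nz: "permanent (edge_diff E) E (ws @ map inner_form fs) \<noteq> 0" using ws(1) fs(3) by simp
  have "load (ws @ map inner_form fs) e \<le> 6 - 1" if e: "e \<in> E" for e
  proof -
    have "load (ws @ map inner_form fs) e \<le> total_load e"
      using ws(3)[rule_format, of e] load_map_distinct[OF fs(1), of inner_form e] fs(2) by (simp add: total_load_def)
    also have "total_load e \<le> 5"
    proof (cases "e \<in> inner_edges")
      case True
      then show ?thesis by (rule total_load_inner)
    next
      case False
      then have "e \<in> outer_edges" using e by (auto simp: outer_edges_def inner_edges_def)
      then show ?thesis by (rule outer_edges_cases) (auto intro: total_load_outer)
    qed
    finally show ?thesis by simp
  qed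
  with alg_choosable_if_permanent[OF fin(1) nz] show ?thesis by blast
qed

end

theorem theorem4p1:
  fixes n :: nat and E :: "nat set set"
  assumes "simple_graph n E"
    and "nice E"
  shows "alg_choosable_1b E 6"
  using ex_edge_split[OF assms] edge_split.alg_choosable_6 by blast

end
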